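(* Let $n\ge1$ be an integer and let $\Gamma=\Delta(3n^2)=(\mathbb{Z}_n\times\mathbb{Z}_n)\rtimes\mathbb{Z}_3\subset SU(3)$ be the ternary trihedral group. Then a spectral measure over $\mathbb{T}^2$ for $\Gamma$ is $$\mathrm{d}\varepsilon(\omega_1,\omega_2)=\frac13\,\mathrm{d}_{n/2}\omega_1\;\mathrm{d}_{n/2}\omega_2+\frac{1}{36\pi^4}J^2\,\mathrm{d}^{(3)}(\omega_1,\omega_2).$$
   Context: $\Delta(3n^2)$ is the subgroup of $SU(3)$, of order $3n^2$, generated by all diagonal matrices of determinant 1 whose entries are $n$-th roots of unity (a group isomorphic to $\mathbb{Z}_n\times\mathbb{Z}_n$) together with the cyclic permutation matrix $T=\begin{pmatrix}0&1&0\\0&0&1\\1&0&0\end{pmatrix}$. For a finite subgroup $\Gamma\subset SU(3)$ let $\rho$ be the 3-dimensional representation given by the inclusion. The McKay graph $\mathcal{G}_\Gamma$ has as vertices the irreducible representations of $\Gamma$ (up to isomorphism), with adjacency matrix $\Delta_{\sigma,\sigma'}$ = multiplicity of $\sigma'$ in $\rho\otimes\sigma$; $\Delta$ is normal. Let $e_1$ be the basis vector of the trivial representation. With $\mathbb{T}$ the unit circle and $R_{m_1,m_2}(\omega_1,\omega_2)=(\omega_1+\omega_2^{-1}+\omega_1^{-1}\omega_2)^{m_1}(\omega_1^{-1}+\omega_2+\omega_1\omega_2^{-1})^{m_2}$, a measure $\varepsilon$ on $\mathbb{T}^2$ is called a spectral measure over $\mathbb{T}^2$ of $\Gamma$ if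 $\int_{\mathbb{T}^2}R_{m_1,m_2}\,\mathrm{d}\varepsilon=\langle\Delta^{m_1}(\Delta^\ast)^{m_2} e_1,e_1\rangle$ for all integers $m_1,m_2\ge0$. For $2k\in\mathbb{N}$, $\mathrm{d}_k$ is the uniform probability measure on the $2k$-th roots of unity. For $N\in\mathbb{N}$, $\mathrm{d}^{(N)}$ is the uniform probability measure on $D_N=\{(e^{2\pi iq_1/3N},e^{2\pi iq_2/3N}) : q_1,q_2\in\{0,\dots,3N-1\},\ q_1+q_2\equiv0 \bmod 3\}$. $J$ is the function on $\mathbb{T}^2$ given at $(e^{2\pi i\theta_1},e^{2\pi i\theta_2})$ by $J=4\pi^2\big(\sin(2\pi(\theta_1+\theta_2))-\sin(2\pi(2\theta_1-\theta_2))-\sin(2\pi(2\theta_2-\theta_1))\big)$, and $J^2\mathrm{d}^{(N)}$ is the measure with density $J^2$ with respect to $\mathrm{d}^{(N)}$. *)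

theory Defs
  imports
    "HOL-Probability.Probability"
    "HOL-Algebra.Generated_Groups"
    "Jordan_Normal_Form.Schur_Decomposition"
begin

section \<open>Complex matrix representations of a group\<close>

text \<open>A representation consists of its degree and its matrices. Only the values of \<open>act\<close> on the
  carrier of the group matter.\<close>

datatype 'g rep = Rep (deg: nat) (act: "'g \<Rightarrow> complex mat")

definition GL :: "nat \<Rightarrow> complex mat monoid" where
  "GL d = units_of (ring_mat TYPE(complex) d ())"

definition representation :: "('g, 'b) monoid_scheme \<Rightarrow> 'g rep \<Rightarrow> bool" where
  "representation G \<sigma> \<longleftrightarrow> act \<sigma> \<in> hom G (GL (deg \<sigma>))"

definition invariant_subspace :: "('g, 'b) monoid_scheme \<Rightarrow> 'g rep \<Rightarrow> complex vec set \<Rightarrow> bool" where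
  "invariant_subspace G \<sigma> W \<longleftrightarrow>
     VectorSpace.subspace class_ring W (module_vec TYPE(complex) (deg \<sigma>)) \<and>
     (\<forall>g\<in>carrier G. \<forall>w\<in>W. act \<sigma> g *\<^sub>v w \<in> W)"

definition irreducible_rep :: "('g, 'b) monoid_scheme \<Rightarrow> 'g rep \<Rightarrow> bool" where
  "irreducible_rep G \<sigma> \<longleftrightarrow> representation G \<sigma> \<and> deg \<sigma> > 0 \<and>
     (\<forall>W. invariant_subspace G \<sigma> W \<longrightarrow> W = {0\<^sub>v (deg \<sigma>)} \<or> W = carrier_vec (deg \<sigma>))"

definition equivalent_rep :: "('g, 'b) monoid_scheme \<Rightarrow> 'g rep \<Rightarrow> 'g rep \<Rightarrow> bool" where
  "equivalent_rep G \<sigma> \<tau> \<longleftrightarrow> deg \<sigma> = deg \<tau> \<and>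
     (\<exists>P\<in>carrier_mat (deg \<sigma>) (deg \<sigma>). invertible_mat P \<and>
        (\<forall>g\<in>carrier G. P * act \<sigma> g = act \<tau> g * P))"

definition kronecker :: "complex mat \<Rightarrow> complex mat \<Rightarrow> complex mat" where
  "kronecker A B = Matrix.mat (dim_row A * dim_row B) (dim_col A * dim_col B)
     (\<lambda>(i, j). A $$ (i div dim_row B, j div dim_col B) * B $$ (i mod dim_row B, j mod dim_col B))"

definition tensor_rep :: "'g rep \<Rightarrow> 'g rep \<Rightarrow> 'g rep" where
  "tensor_rep \<sigma> \<tau> = Rep (deg \<sigma> * deg \<tau>) (\<lambda>g. kronecker (act \<sigma> g) (act \<tau> g))"

definition direct_sum_rep :: "'g rep list \<Rightarrow> 'g rep" where
  "direct_sum_rep \<sigma>s = Rep (sum_list (map deg \<sigma>s)) (\<lambda>g. diag_block_mat (map (\<lambda>\<sigma>. act \<sigma> g) \<sigma>s))"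

definition trivial_rep :: "'g rep" where
  "trivial_rep = Rep 1 (\<lambda>_. 1\<^sub>m 1)"

text \<open>The number of summands equivalent to \<open>\<sigma>\<close> in a decomposition of \<open>\<tau>\<close> into irreducibles;
  for finite groups such a decomposition exists and the number does not depend on it.\<close>

definition multiplicity_rep :: "('g, 'b) monoid_scheme \<Rightarrow> 'g rep \<Rightarrow> 'g rep \<Rightarrow> nat" where
  "multiplicity_rep G \<sigma> \<tau> = (THE m. \<exists>\<sigma>s. (\<forall>\<sigma>'\<in>set \<sigma>s. irreducible_rep G \<sigma>') \<and>
     equivalent_rep G \<tau> (direct_sum_rep \<sigma>s) \<and> m = length (filter (equivalent_rep G \<sigma>) \<sigma>s))"

definition irr_equiv :: "('g, 'b) monoid_scheme \<Rightarrow> ('g rep \<times> 'g rep) set" where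
  "irr_equiv G = {(\<sigma>, \<tau>). irreducible_rep G \<sigma> \<and> irreducible_rep G \<tau> \<and> equivalent_rep G \<sigma> \<tau>}"

definition Irr :: "('g, 'b) monoid_scheme \<Rightarrow> 'g rep set set" where
  "Irr G = {\<sigma>. irreducible_rep G \<sigma>} // irr_equiv G"

definition trivial_class :: "('g, 'b) monoid_scheme \<Rightarrow> 'g rep set" where
  "trivial_class G = irr_equiv G `` {trivial_rep}"


section \<open>The McKay graph of a finite subgroup of SU(3)\<close>

definition SU3 :: "complex mat monoid" where
  "SU3 = \<lparr>carrier = {A \<in> carrier_mat 3 3. mat_adjoint A * A = 1\<^sub>m 3 \<and> det A = 1},
          mult = (*), one = 1\<^sub>m 3\<rparr>"

text \<open>A subgroup \<open>\<Gamma>\<close> of SU(3) is given by its underlying set of matrices.\<close>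

definition grp :: "complex mat set \<Rightarrow> complex mat monoid" where
  "grp \<Gamma> = SU3\<lparr>carrier := \<Gamma>\<rparr>"

definition inclusion_rep :: "complex mat rep" where
  "inclusion_rep = Rep 3 (\<lambda>g. g)"

definition McKay_vertices :: "complex mat set \<Rightarrow> complex mat rep set set" where
  "McKay_vertices \<Gamma> = Irr (grp \<Gamma>)"

text \<open>Multiplicities depend only on equivalence classes, so the choice of representatives is
  immaterial.\<close>

definition McKay_adj :: "complex mat set \<Rightarrow> complex mat rep set \<Rightarrow> complex mat rep set \<Rightarrow> complex" where
  "McKay_adj \<Gamma> X Y = of_nat (multiplicity_rep (grp \<Gamma>) (SOME \<sigma>. \<sigma> \<in> Y)
     (tensor_rep inclusion_rep (SOME \<sigma>. \<sigma> \<in> X)))"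

text \<open>Matrices and vectors indexed by a finite set \<open>V\<close> of vertices.\<close>

definition apply_matrix :: "'v set \<Rightarrow> ('v \<Rightarrow> 'v \<Rightarrow> complex) \<Rightarrow> ('v \<Rightarrow> complex) \<Rightarrow> 'v \<Rightarrow> complex" where
  "apply_matrix V A v = (\<lambda>x. \<Sum>y\<in>V. A x y * v y)"

definition adjoint_matrix :: "('v \<Rightarrow> 'v \<Rightarrow> complex) \<Rightarrow> 'v \<Rightarrow> 'v \<Rightarrow> complex" where
  "adjoint_matrix A = (\<lambda>x y. cnj (A y x))"

definition inner_prod_on :: "'v set \<Rightarrow> ('v \<Rightarrow> complex) \<Rightarrow> ('v \<Rightarrow> complex) \<Rightarrow> complex" where
  "inner_prod_on V u v = (\<Sum>x\<in>V. u x * cnj (v x))"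

definition basis_vector :: "'v \<Rightarrow> 'v \<Rightarrow> complex" where
  "basis_vector x = (\<lambda>y. if y = x then 1 else 0)"

definition McKay_moment :: "complex mat set \<Rightarrow> nat \<Rightarrow> nat \<Rightarrow> complex" where
  "McKay_moment \<Gamma> m1 m2 =
     (let V = McKay_vertices \<Gamma>; \<Delta> = McKay_adj \<Gamma>; e1 = basis_vector (trivial_class (grp \<Gamma>))
      in inner_prod_on V
           ((apply_matrix V \<Delta> ^^ m1) ((apply_matrix V (adjoint_matrix \<Delta>) ^^ m2) e1)) e1)"


section \<open>Spectral measures over the torus\<close>

definition circle_space :: "complex measure" where
  "circle_space = restrict_space borel (sphere 0 1)"

definition torus_space :: "(complex \<times> complex) measure" where
  "torus_space = circle_space \<Otimes>\<^sub>M circle_space"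

definition R_fun :: "nat \<Rightarrow> nat \<Rightarrow> complex \<times> complex \<Rightarrow> complex" where
  "R_fun m1 m2 = (\<lambda>(\<omega>1, \<omega>2). (\<omega>1 + inverse \<omega>2 + inverse \<omega>1 * \<omega>2) ^ m1 *
                         (inverse \<omega>1 + \<omega>2 + \<omega>1 * inverse \<omega>2) ^ m2)"

definition spectral_measure :: "complex mat set \<Rightarrow> (complex \<times> complex) measure \<Rightarrow> bool" where
  "spectral_measure \<Gamma> \<epsilon> \<longleftrightarrow> sets \<epsilon> = sets torus_space \<and>
     (\<forall>m1 m2. has_bochner_integral \<epsilon> (R_fun m1 m2) (McKay_moment \<Gamma> m1 m2))"


section \<open>The measures\<close>

definition uniform_on :: "'a measure \<Rightarrow> 'a set \<Rightarrow> 'a measure" where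
  "uniform_on M S = distr (uniform_count_measure S) M (\<lambda>x. x)"

text \<open>Meant for \<open>2k\<close> a positive integer.\<close>

definition root_measure :: "real \<Rightarrow> complex measure" where
  "root_measure k = uniform_on circle_space {z. z ^ nat \<lfloor>2 * k\<rfloor> = 1}"

definition D_set :: "nat \<Rightarrow> (complex \<times> complex) set" where
  "D_set N = {(cis (2 * pi * real q1 / real (3 * N)), cis (2 * pi * real q2 / real (3 * N))) | q1 q2.
            q1 < 3 * N \<and> q2 < 3 * N \<and> (q1 + q2) mod 3 = 0}"

definition D_measure :: "nat \<Rightarrow> (complex \<times> complex) measure" where
  "D_measure N = uniform_on torus_space (D_set N)"

definition J_angle :: "real \<Rightarrow> real \<Rightarrow> real" where
  "J_angle \<theta>1 \<theta>2 = 4 * pi^2 * (sin (2 * pi * (\<theta>1 + \<theta>2)) - sin (2 * pi * (2 * \<theta>1 - \<theta>2))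
                                 - sin (2 * pi * (2 * \<theta>2 - \<theta>1)))"

definition J_fun :: "complex \<times> complex \<Rightarrow> real" where
  "J_fun = (\<lambda>(\<omega>1, \<omega>2). J_angle (Arg \<omega>1 / (2 * pi)) (Arg \<omega>2 / (2 * pi)))"

lemma J_angle_eq_Im:
  "J_angle \<theta>1 \<theta>2 = (let u = cis (2 * pi * \<theta>1); v = cis (2 * pi * \<theta>2) in
     4 * pi^2 * (Im (u * v) - Im (u^2 * inverse v) - Im (v^2 * inverse u)))"
proof -
  have 1: "cis (2 * pi * a) * cis (2 * pi * b) = cis (2 * pi * (a + b))"
    and 2: "cis (2 * pi * a) ^ 2 * inverse (cis (2 * pi * b)) = cis (2 * pi * (2 * a - b))"
    for a b
    by (simp_all add: cis_mult Complex.DeMoivre algebra_simps)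
  show ?thesis unfolding J_angle_def Let_def 1 2 by simp
qed

text \<open>The value of \<open>J_fun\<close> does not depend on the choice of the angles.\<close>

lemma J_fun_cis: "J_fun (cis (2 * pi * \<theta>1), cis (2 * pi * \<theta>2)) = J_angle \<theta>1 \<theta>2"
proof -
  have "cis (2 * pi * (Arg (cis t) / (2 * pi))) = cis t" for t
    using cis_Arg[of "cis t"] by (simp add: sgn_eq)
  then show ?thesis unfolding J_fun_def prod.case J_angle_eq_Im by (simp only:)
qed

definition add_measure :: "'a measure \<Rightarrow> 'a measure \<Rightarrow> 'a measure" where
  "add_measure M N = measure_of (space M) (sets M) (\<lambda>A. emeasure M A + emeasure N A)"

lemma emeasure_add_measure:
  assumes "sets N = sets M" "A \<in> sets M"
  shows "emeasure (add_measure M N) A = emeasure M A + emeasure N A"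
proof (rule emeasure_measure_of[OF add_measure_def])
  show "countably_additive (sets (add_measure M N)) (\<lambda>A. emeasure M A + emeasure N A)"
    using assms(1) by (auto simp: countably_additive_def add_measure_def suminf_add[symmetric]
        suminf_emeasure)
  show "A \<in> sets (add_measure M N)"
    using assms(2) by (simp add: add_measure_def)
qed (use sets.sets_into_space in \<open>auto simp: positive_def\<close>)


section \<open>The ternary trihedral groups\<close>

definition cyclic_T :: "complex mat" where
  "cyclic_T = mat_of_rows_list 3 [[0, 1, 0], [0, 0, 1], [1, 0, 0]]"

definition diag_roots :: "nat \<Rightarrow> complex mat set" where
  "diag_roots n = {mat_diag 3 t | t. (\<forall>i<3. t i ^ n = 1) \<and> det (mat_diag 3 t) = 1}"

definition trihedral :: "nat \<Rightarrow> complex mat set" where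
  "trihedral n = generate SU3 (insert cyclic_T (diag_roots n))"

end

theory Submission
  imports Defs "Jordan_Normal_Form.Spectral_Radius"
begin

text \<open>For every finite \<open>\<Gamma> \<subseteq> SU(3)\<close> and \<open>g \<in> \<Gamma>\<close> the vector of the values \<open>\<chi> g\<close> of the irreducible
  characters is a common eigenvector of \<open>\<Delta>\<close> and \<open>\<Delta>\<^sup>*\<close> with eigenvalues \<open>tr g\<close> and its conjugate.
  By orthogonality of characters, the basis vector of the trivial representation is the average of
  these eigenvectors over \<open>\<Gamma>\<close>, so the moments are the averages over \<open>\<Gamma>\<close> of \<open>(tr g)^m1 * cnj (tr g)^m2\<close>.

  In \<open>\<Delta>(3n\<^sup>2)\<close> the diagonal matrices, a third of the group, contribute \<open>R\<close> averaged over pairs of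
  \<open>n\<close>-th roots of unity, which is the first measure. All other elements have trace 0 and contribute
  \<open>2/3\<close> if \<open>m1 = m2 = 0\<close> and nothing otherwise. So does the second measure: \<open>J\<close> vanishes at all points
  of \<open>D\<^sub>3\<close> except six, at which \<open>J\<^sup>2 = 108 * pi^4\<close> and both factors of \<open>R\<close> vanish.\<close>

section \<open>Matrices\<close>

text \<open>\<open>multiplicity_rep\<close> is a definite description over all decompositions into
  irreducibles, so nothing is known about its value until a decomposition is shown to exist and all
  of them are shown to give the same count. Existence is complete reducibility; the count is then
  forced to be an inner product of characters. The set of irreducible classes must also be known to
  be finite, since a sum over an infinite set is 0 by convention. The adjoint gets its own
  eigenvector equation: its entries are multiplicities for the complex conjugate of the inclusion,
  and this uses that the inverse of a unitary matrix is its adjoint. Origin of 1/(36 pi^4):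
  \<open>D_set 3\<close> has 27 points, so each of the six points in the support receives the mass
  108 pi^4 / (27 * 36 pi^4) = 1/9, which adds up to 2/3.\<close>

lemma index_mult_sum:
  fixes A B :: "'a :: comm_semiring_0 mat"
  assumes "A \<in> carrier_mat n m" "B \<in> carrier_mat m p" "i < n" "j < p"
  shows "(A * B) $$ (i, j) = (\<Sum>k<m. A $$ (i, k) * B $$ (k, j))"
  using assms by (auto simp: scalar_prod_def atLeast0LessThan)

lemma mult_mat_unit_vec:
  fixes A :: "'a :: comm_semiring_1 mat"
  assumes "A \<in> carrier_mat n m" "j < m"
  shows "A *\<^sub>v unit_vec m j = col A j"
  using assms by (intro eq_vecI) (auto simp: scalar_prod_right_unit)

section \<open>Traces\<close>

definition mat_trace :: "'a :: comm_monoid_add mat \<Rightarrow> 'a" where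
  "mat_trace A = (\<Sum>i<dim_row A. A $$ (i, i))"

lemma mat_trace_mult_commute:
  fixes A B :: "'a :: comm_semiring_0 mat"
  assumes "A \<in> carrier_mat n m" "B \<in> carrier_mat m n"
  shows "mat_trace (A * B) = mat_trace (B * A)"
proof -
  have "mat_trace (A * B) = (\<Sum>i<n. \<Sum>k<m. A $$ (i, k) * B $$ (k, i))"
    using assms unfolding mat_trace_def
    by (auto simp: index_mult_sum[OF assms] simp del: index_mult_mat(1) intro!: sum.cong)
  also have "\<dots> = (\<Sum>k<m. \<Sum>i<n. B $$ (k, i) * A $$ (i, k))"
    by (subst sum.swap) (simp add: mult.commute)
  also have "\<dots> = mat_trace (B * A)"
    using assms unfolding mat_trace_def
    by (auto simp: index_mult_sum[OF assms(2,1)] simp del: index_mult_mat(1) intro!: sum.cong)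
  finally show ?thesis .
qed

text \<open>Similarity is given by the intertwining relation of \<open>equivalent_rep\<close>, so
  that the lemma applies to it directly; cyclicity of the trace moves the inverse around.\<close>

lemma mat_trace_similar:
  fixes A B P :: "'a :: field mat"
  assumes A: "A \<in> carrier_mat n n" and B: "B \<in> carrier_mat n n" and P: "P \<in> carrier_mat n n"
    and inv: "invertible_mat P" and eq: "P * A = B * P"
  shows "mat_trace A = mat_trace B"
proof -
  obtain Q where Q: "P * Q = 1\<^sub>m n" "Q * P = 1\<^sub>m (dim_row Q)"
    using inv P unfolding invertible_mat_def inverts_mat_def by auto
  have "dim_col (P * Q) = n" "dim_col (Q * P) = dim_row Q" using Q by auto
  then have Qc: "Q \<in> carrier_mat n n" using P by auto
  have "mat_trace A = mat_trace (Q * P * A)" using Q Qc A by auto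
  also have "\<dots> = mat_trace (Q * (B * P))" using Qc P A eq by simp
  also have "\<dots> = mat_trace (B * P * Q)"
    by (rule mat_trace_mult_commute[of _ n n]) (use Qc P B in auto)
  also have "\<dots> = mat_trace B" using Qc P B Q by simp
  finally show ?thesis .
qed

lemma mat_trace_four_block:
  assumes "A \<in> carrier_mat n n" "D \<in> carrier_mat m m"
  shows "mat_trace (four_block_mat A B C D) = mat_trace A + mat_trace D"
proof -
  have *: "{..<n + m} = {..<n} \<union> (\<lambda>i. i + n) ` {..<m}"
  proof -
    have "i \<in> (\<lambda>i. i + n) ` {..<m}" if "\<not> i < n" "i < n + m" for i
      using that by (intro image_eqI[of _ _ "i - n"]) auto
    then show ?thesis by auto
  qed
  have "mat_trace (four_block_mat A B C D) =
      (\<Sum>i<n. four_block_mat A B C D $$ (i, i)) +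
      (\<Sum>i\<in>(\<lambda>i. i + n) ` {..<m}. four_block_mat A B C D $$ (i, i))"
    using assms unfolding mat_trace_def
    by (simp add: * sum.union_disjoint del: index_mat_four_block(1))
       (subst sum.union_disjoint, auto)
  also have "(\<Sum>i\<in>(\<lambda>i. i + n) ` {..<m}. four_block_mat A B C D $$ (i, i)) = mat_trace D"
    using assms unfolding mat_trace_def by (subst sum.reindex) (auto intro!: sum.cong)
  also have "(\<Sum>i<n. four_block_mat A B C D $$ (i, i)) = mat_trace A"
    using assms unfolding mat_trace_def by (auto intro!: sum.cong)
  finally show ?thesis .
qed

lemma mat_trace_diag_block:
  assumes "\<forall>A\<in>set As. square_mat A"
  shows "mat_trace (diag_block_mat As) = sum_list (map mat_trace As)"
  using assms
proof (induction As)
  case Nil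
  then show ?case by (simp add: mat_trace_def)
next
  case (Cons A As)
  have "square_mat (diag_block_mat As)" using Cons.prems by (intro diag_block_mat_square) auto
  then have "mat_trace (diag_block_mat (A # As)) = mat_trace A + mat_trace (diag_block_mat As)"
    unfolding diag_block_mat.simps Let_def
    using Cons.prems by (intro mat_trace_four_block carrier_matI) auto
  then show ?case using Cons by simp
qed

subsection \<open>Kronecker products\<close>

text \<open>The map from k to (\<open>k div m\<close>, \<open>k mod m\<close>) is the pairing of
  indices built into \<open>kronecker\<close>.\<close>

lemma sum_div_mod:
  fixes f :: "nat \<Rightarrow> nat \<Rightarrow> 'a :: comm_monoid_add"
  shows "(\<Sum>k<n * m. f (k div m) (k mod m)) = (\<Sum>i<n. \<Sum>j<m. f i j)"
  unfolding sum_mult_product by (intro sum.cong refl) auto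

lemma kronecker_carrier:
  "A \<in> carrier_mat n m \<Longrightarrow> B \<in> carrier_mat p q \<Longrightarrow> kronecker A B \<in> carrier_mat (n * p) (m * q)"
  by (auto simp: kronecker_def)

lemma index_kronecker:
  assumes "A \<in> carrier_mat n m" "B \<in> carrier_mat p q" "i < n * p" "j < m * q"
  shows "kronecker A B $$ (i, j) = A $$ (i div p, j div q) * B $$ (i mod p, j mod q)"
  using assms by (auto simp: kronecker_def)

text \<open>Splitting the joint summation index into its two parts makes the sum factor into the two
  matrix products.\<close>

lemma mult_kronecker:
  assumes A: "A \<in> carrier_mat n m" and B: "B \<in> carrier_mat p q"
    and C: "C \<in> carrier_mat m r" and D: "D \<in> carrier_mat q s"
  shows "kronecker A B * kronecker C D = kronecker (A * C) (B * D)"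
proof (rule eq_matI)
  fix i j assume "i < dim_row (kronecker (A * C) (B * D))" "j < dim_col (kronecker (A * C) (B * D))"
  then have ij: "i < n * p" "j < r * s" using assms by (auto simp: kronecker_def)
  \<comment> \<open>The bounds on the remainders need \<open>p\<close> and \<open>s\<close>
    positive; otherwise \<open>i < n * p\<close> and \<open>j < r * s\<close> would be
    impossible.\<close>
  then have ij': "i div p < n" "i mod p < p" "j div s < r" "j mod s < s"
    by (auto simp: less_mult_imp_div_less intro!: mod_less_divisor)
       (metis mult_0_right gr0I not_less_zero)+
  have "(kronecker A B * kronecker C D) $$ (i, j) =
     (\<Sum>k<m * q. kronecker A B $$ (i, k) * kronecker C D $$ (k, j))"
    using kronecker_carrier[OF A B] kronecker_carrier[OF C D] ij by (rule index_mult_sum)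
  also have "\<dots> = (\<Sum>k<m * q. (A $$ (i div p, k div q) * B $$ (i mod p, k mod q)) *
       (C $$ (k div q, j div s) * D $$ (k mod q, j mod s)))"
    by (intro sum.cong refl)
       (simp add: index_kronecker[OF A B ij(1)] index_kronecker[OF C D _ ij(2)])
  also have "\<dots> = (\<Sum>a<m. \<Sum>b<q. (A $$ (i div p, a) * B $$ (i mod p, b)) *
       (C $$ (a, j div s) * D $$ (b, j mod s)))"
    by (rule sum_div_mod)
  also have "\<dots> = (\<Sum>a<m. A $$ (i div p, a) * C $$ (a, j div s)) *
       (\<Sum>b<q. B $$ (i mod p, b) * D $$ (b, j mod s))"
    by (simp add: sum_product algebra_simps)
  also have "\<dots> = (A * C) $$ (i div p, j div s) * (B * D) $$ (i mod p, j mod s)"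
    using ij' by (simp add: index_mult_sum[OF A C] index_mult_sum[OF B D])
  also have "\<dots> = kronecker (A * C) (B * D) $$ (i, j)"
    by (rule index_kronecker[symmetric]) (use assms ij in auto)
  finally show "(kronecker A B * kronecker C D) $$ (i, j) = kronecker (A * C) (B * D) $$ (i, j)" .
qed (use assms in \<open>auto simp: kronecker_def\<close>)

lemma kronecker_one: "kronecker (1\<^sub>m n) (1\<^sub>m m) = 1\<^sub>m (n * m)"
proof (rule eq_matI)
  fix i j assume "i < dim_row (1\<^sub>m (n * m) :: complex mat)" "j < dim_col (1\<^sub>m (n * m) :: complex mat)"
  then have ij: "i < n * m" "j < n * m" by auto
  then have "m > 0" by (metis mult_0_right gr0I not_less_zero)
  then have "i div m < n" "j div m < n" "i mod m < m" "j mod m < m"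
    using ij by (auto simp: less_mult_imp_div_less)
  moreover have "i = j \<longleftrightarrow> i div m = j div m \<and> i mod m = j mod m"
    by (metis div_mult_mod_eq)
  ultimately show "kronecker (1\<^sub>m n) (1\<^sub>m m) $$ (i, j) = (1\<^sub>m (n * m) :: complex mat) $$ (i, j)"
    using ij by (auto simp: index_kronecker[of _ n n _ m m])
qed (auto simp: kronecker_def)

lemma mat_trace_kronecker:
  assumes A: "A \<in> carrier_mat n n" and B: "B \<in> carrier_mat m m"
  shows "mat_trace (kronecker A B) = mat_trace A * mat_trace B"
proof -
  have "mat_trace (kronecker A B) = (\<Sum>k<n * m. A $$ (k div m, k div m) * B $$ (k mod m, k mod m))"
    using kronecker_carrier[OF A B] unfolding mat_trace_def
    by (auto simp: index_kronecker[OF A B] intro!: sum.cong)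
  also have "\<dots> = (\<Sum>a<n. \<Sum>b<m. A $$ (a, a) * B $$ (b, b))"
    by (rule sum_div_mod)
  also have "\<dots> = mat_trace A * mat_trace B"
    using A B by (simp add: mat_trace_def sum_product)
  finally show ?thesis .
qed

subsection \<open>Sums of matrices\<close>

text \<open>Matrices of all sizes form one type without a common zero, so sums over a set are formed
  entrywise, with the size given explicitly.\<close>

definition mat_sum :: "nat \<Rightarrow> nat \<Rightarrow> ('b \<Rightarrow> 'a :: comm_monoid_add mat) \<Rightarrow> 'b set \<Rightarrow> 'a mat" where
  "mat_sum n m f S = Matrix.mat n m (\<lambda>ij. \<Sum>g\<in>S. f g $$ ij)"

lemma mat_sum_carrier [simp]: "mat_sum n m f S \<in> carrier_mat n m"
  by (simp add: mat_sum_def)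

lemma mat_sum_dim [simp]: "dim_row (mat_sum n m f S) = n" "dim_col (mat_sum n m f S) = m"
  by (simp_all add: mat_sum_def)

lemma index_mat_sum [simp]:
  "i < n \<Longrightarrow> j < m \<Longrightarrow> mat_sum n m f S $$ (i, j) = (\<Sum>g\<in>S. f g $$ (i, j))"
  by (simp add: mat_sum_def)

lemma mat_sum_cong:
  "(\<And>g. g \<in> S \<Longrightarrow> f g = h g) \<Longrightarrow> mat_sum n m f S = mat_sum n m h S"
  by (rule eq_matI) auto

lemma mat_sum_reindex_bij:
  "bij_betw \<phi> S S \<Longrightarrow> mat_sum n m f S = mat_sum n m (\<lambda>g. f (\<phi> g)) S"
  by (rule eq_matI) (simp_all add: sum.reindex_bij_betw[where g = "\<lambda>g. f g $$ _", symmetric])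

lemma mult_mat_sum:
  fixes f :: "'b \<Rightarrow> 'a :: comm_semiring_0 mat"
  assumes A: "A \<in> carrier_mat p n" and f: "\<And>g. g \<in> S \<Longrightarrow> f g \<in> carrier_mat n m"
  shows "A * mat_sum n m f S = mat_sum p m (\<lambda>g. A * f g) S"
proof (rule eq_matI)
  fix i j assume "i < dim_row (mat_sum p m (\<lambda>g. A * f g) S)" "j < dim_col (mat_sum p m (\<lambda>g. A * f g) S)"
  then have ij: "i < p" "j < m" by auto
  have "(A * mat_sum n m f S) $$ (i, j) = (\<Sum>k<n. A $$ (i, k) * (\<Sum>g\<in>S. f g $$ (k, j)))"
    using ij by (simp add: index_mult_sum[OF A mat_sum_carrier])
  also have "\<dots> = (\<Sum>g\<in>S. \<Sum>k<n. A $$ (i, k) * f g $$ (k, j))"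
    by (subst sum.swap) (simp add: sum_distrib_left)
  also have "\<dots> = (\<Sum>g\<in>S. (A * f g) $$ (i, j))"
    by (intro sum.cong refl) (use ij in \<open>simp add: index_mult_sum[OF A f]\<close>)
  finally show "(A * mat_sum n m f S) $$ (i, j) = mat_sum p m (\<lambda>g. A * f g) S $$ (i, j)"
    using ij by simp
qed (use A in auto)

lemma mat_sum_mult:
  fixes f :: "'b \<Rightarrow> 'a :: comm_semiring_0 mat"
  assumes A: "A \<in> carrier_mat m p" and f: "\<And>g. g \<in> S \<Longrightarrow> f g \<in> carrier_mat n m"
  shows "mat_sum n m f S * A = mat_sum n p (\<lambda>g. f g * A) S"
proof (rule eq_matI)
  fix i j assume "i < dim_row (mat_sum n p (\<lambda>g. f g * A) S)" "j < dim_col (mat_sum n p (\<lambda>g. f g * A) S)"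
  then have ij: "i < n" "j < p" by auto
  have "(mat_sum n m f S * A) $$ (i, j) = (\<Sum>k<m. (\<Sum>g\<in>S. f g $$ (i, k)) * A $$ (k, j))"
    using ij by (simp add: index_mult_sum[OF mat_sum_carrier A])
  also have "\<dots> = (\<Sum>g\<in>S. \<Sum>k<m. f g $$ (i, k) * A $$ (k, j))"
    by (subst sum.swap) (simp add: sum_distrib_right)
  also have "\<dots> = (\<Sum>g\<in>S. (f g * A) $$ (i, j))"
    by (intro sum.cong refl) (use ij in \<open>simp add: index_mult_sum[OF f A]\<close>)
  finally show "(mat_sum n m f S * A) $$ (i, j) = mat_sum n p (\<lambda>g. f g * A) S $$ (i, j)"
    using ij by simp
qed (use A in auto)

lemma mat_trace_mat_sum:
  assumes "\<And>g. g \<in> S \<Longrightarrow> f g \<in> carrier_mat n n"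
  shows "mat_trace (mat_sum n n f S) = (\<Sum>g\<in>S. mat_trace (f g))"
proof -
  have "mat_trace (mat_sum n n f S) = (\<Sum>i<n. \<Sum>g\<in>S. f g $$ (i, i))" by (simp add: mat_trace_def)
  also have "\<dots> = (\<Sum>g\<in>S. \<Sum>i<n. f g $$ (i, i))" by (rule sum.swap)
  also have "\<dots> = (\<Sum>g\<in>S. mat_trace (f g))"
    by (intro sum.cong refl) (simp add: mat_trace_def carrier_matD(1)[OF assms])
  finally show ?thesis .
qed

subsection \<open>Invertible matrices\<close>

lemma invertible_matI:
  assumes "P \<in> carrier_mat n n" "Q \<in> carrier_mat n n" "P * Q = 1\<^sub>m n" "Q * P = 1\<^sub>m n"
  shows "invertible_mat P"
  using assms unfolding invertible_mat_def inverts_mat_def by auto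

lemma invertible_matE:
  assumes "invertible_mat P" "P \<in> carrier_mat n n"
  obtains Q where "Q \<in> carrier_mat n n" "P * Q = 1\<^sub>m n" "Q * P = 1\<^sub>m n"
proof -
  obtain Q where Q: "P * Q = 1\<^sub>m n" "Q * P = 1\<^sub>m (dim_row Q)"
    using assms unfolding invertible_mat_def inverts_mat_def by auto
  have "dim_col (P * Q) = n" "dim_col (Q * P) = dim_row Q" using Q by auto
  then have "Q \<in> carrier_mat n n" using assms by auto
  with Q show thesis using that by auto
qed

lemma invertible_mat_if_det:
  fixes P :: "'a :: field mat"
  assumes P: "P \<in> carrier_mat n n" and d: "det P \<noteq> 0"
  shows "invertible_mat P"
  using det_non_zero_imp_unit[OF P d] P invertible_matI[OF P]
  unfolding Units_def by (auto simp: ring_mat_simps)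

lemma invertible_mat_mult:
  assumes "P \<in> carrier_mat n n" "Q \<in> carrier_mat n n"
    and "invertible_mat P" "invertible_mat (Q :: 'a :: comm_semiring_1 mat)"
  shows "invertible_mat (P * Q)"
proof -
  obtain P' where P': "P' \<in> carrier_mat n n" "P * P' = 1\<^sub>m n" "P' * P = 1\<^sub>m n"
    using invertible_matE[OF assms(3,1)] by blast
  obtain Q' where Q': "Q' \<in> carrier_mat n n" "Q * Q' = 1\<^sub>m n" "Q' * Q = 1\<^sub>m n"
    using invertible_matE[OF assms(4,2)] by blast
  have "P * Q * (Q' * P') = P * (Q * (Q' * P'))" using assms P'(1) Q'(1) by (intro assoc_mult_mat) auto
  also have "Q * (Q' * P') = Q * Q' * P'" using assms P'(1) Q'(1) by (intro assoc_mult_mat[symmetric]) auto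
  finally have "P * Q * (Q' * P') = 1\<^sub>m n" using P' Q' by simp
  moreover have "Q' * P' * (P * Q) = Q' * (P' * (P * Q))"
    using assms P'(1) Q'(1) by (intro assoc_mult_mat) auto
  moreover have "P' * (P * Q) = P' * P * Q"
    using assms P'(1) by (intro assoc_mult_mat[symmetric]) auto
  ultimately show ?thesis
    by (intro invertible_matI[of _ n "Q' * P'"]) (use assms P' Q' in auto)
qed

text \<open>Among all invertible matrices choose one with the longest initial segment of columns in \<open>W\<close>;
  a vector of \<open>W\<close> outside their span could replace one of the remaining columns.\<close>

lemma adapted_basis:
  fixes W :: "'a :: field vec set"
  assumes W: "W \<subseteq> carrier_vec d"
  obtains P r where "P \<in> carrier_mat d d" "det P \<noteq> 0" "r \<le> d"
    "\<And>j. j < r \<Longrightarrow> col P j \<in> W"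
    "\<And>w. w \<in> W \<Longrightarrow> \<exists>v\<in>carrier_vec d. w = P *\<^sub>v v \<and> (\<forall>i<d. i \<ge> r \<longrightarrow> v $ i = 0)"
proof -
  define good where "good r \<longleftrightarrow> r \<le> d \<and>
    (\<exists>P\<in>carrier_mat d d. det P \<noteq> 0 \<and> (\<forall>j<r. col P j \<in> W))" for r
  have "good 0" unfolding good_def by (auto intro!: bexI[of _ "1\<^sub>m d"])
  moreover have bnd: "\<forall>y. good y \<longrightarrow> y \<le> d" by (auto simp: good_def)
  ultimately obtain r where r: "good r" "\<And>s. good s \<Longrightarrow> s \<le> r"
    using GreatestI_nat[of good 0 d] Greatest_le_nat[of good _ d] by blast
  then obtain P where P: "P \<in> carrier_mat d d" "det P \<noteq> 0" "\<forall>j<r. col P j \<in> W" and rd: "r \<le> d"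
    unfolding good_def by auto
  obtain Q where Q: "Q \<in> carrier_mat d d" "P * Q = 1\<^sub>m d"
    using invertible_matE[OF invertible_mat_if_det[OF P(1,2)] P(1)] by metis
  have "\<exists>v\<in>carrier_vec d. w = P *\<^sub>v v \<and> (\<forall>i<d. i \<ge> r \<longrightarrow> v $ i = 0)" if w: "w \<in> W" for w
  proof (rule ccontr)
    define v where "v = Q *\<^sub>v w"
    have wc: "w \<in> carrier_vec d" using w W by auto
    have v: "v \<in> carrier_vec d" "P *\<^sub>v v = w"
      using Q P wc by (auto simp: v_def assoc_mult_mat_vec[symmetric])
    assume "\<not> (\<exists>v\<in>carrier_vec d. w = P *\<^sub>v v \<and> (\<forall>i<d. i \<ge> r \<longrightarrow> v $ i = 0))"
    with v obtain j where j: "j < d" "j \<ge> r" "v $ j \<noteq> 0" by blast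
    \<comment> \<open>\<open>E\<close> is the identity with column \<open>j\<close> replaced by the
      coordinates \<open>v\<close> of \<open>w\<close>, so \<open>P * E\<close> is \<open>P\<close>
      with column \<open>j\<close> replaced by \<open>w\<close>.\<close>
    define E where "E = Matrix.mat d d (\<lambda>(a, b). if b = j then v $ a else if a = b then 1 else 0)"
    have E: "E \<in> carrier_mat d d" by (simp add: E_def)
    have Eu: "(E *\<^sub>v u) $ a = v $ a * u $ j + (if a = j then 0 else u $ a)"
      if "u \<in> carrier_vec d" "a < d" for u a
    proof -
      have "(E *\<^sub>v u) $ a = (\<Sum>b<d. (if b = j then v $ a else if a = b then 1 else 0) * u $ b)"
        using that by (simp add: E_def scalar_prod_def atLeast0LessThan)
      also have "\<dots> = v $ a * u $ j + (\<Sum>b\<in>{..<d} - {j}. if a = b then u $ b else 0)"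
      proof -
        have "(\<Sum>b\<in>{..<d} - {j}. (if b = j then v $ a else if a = b then 1 else 0) * u $ b) =
            (\<Sum>b\<in>{..<d} - {j}. if a = b then u $ b else 0)"
          by (rule sum.cong) auto
        then show ?thesis using j(1) by (simp add: sum.remove[of "{..<d}" j])
      qed
      also have "(\<Sum>b\<in>{..<d} - {j}. if a = b then u $ b else 0) = (if a = j then 0 else u $ a)"
        using that by (auto simp: sum.delta')
      finally show ?thesis .
    qed
    have "det E \<noteq> 0"
    proof
      assume "det E = 0"
      then obtain u where u: "u \<in> carrier_vec d" "u \<noteq> 0\<^sub>v d" "E *\<^sub>v u = 0\<^sub>v d"
        using det_0_iff_vec_prod_zero_field[OF E] by auto
      \<comment> \<open>Row \<open>j\<close> of the equation reads \<open>v $ j * u $ j = 0\<close>,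
        and \<open>v $ j\<close> is nonzero; the other rows then give
        \<open>u $ a = 0\<close>.\<close>
      have "u $ j = 0" using Eu[OF u(1) j(1)] u(3) j by simp
      then have "u $ a = 0" if "a < d" for a using Eu[OF u(1) that] u(3) that by (cases "a = j") auto
      then show False using u by auto
    qed
    \<comment> \<open>As \<open>j \<ge> r\<close>, the swap puts \<open>w\<close> right after the
      columns already in \<open>W\<close> and leaves those in place, against the maximality of
      \<open>r\<close>.\<close>
    define P' where "P' = swapcols r j (P * E)"
    have rd': "r < d" using j by simp
    have PE: "P * E \<in> carrier_mat d d" using P E by simp
    have P'c: "P' \<in> carrier_mat d d" using PE by (simp add: P'_def)
    have "det (P * E) \<noteq> 0" using det_mult[OF P(1) E] P \<open>det E \<noteq> 0\<close> by simp
    then have "det P' \<noteq> 0"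
    proof (cases "r = j")
      case True
      then have "P' = P * E" unfolding P'_def using PE by (intro eq_matI) auto
      then show ?thesis using \<open>det (P * E) \<noteq> 0\<close> by simp
    next
      case False
      then show ?thesis
        using det_swapcols[OF rd' j(1) False PE] \<open>det (P * E) \<noteq> 0\<close> by (simp add: P'_def)
    qed
    have colE: "col E b = (if b = j then v else unit_vec d b)" if "b < d" for b
      using that v by (intro eq_vecI) (auto simp: E_def)
    have colPE: "col (P * E) b = (if b = j then w else col P b)" if "b < d" for b
      using that P E v by (auto simp: col_mult2[OF P(1) E that] colE)
    have "col P' b \<in> W" if "b < Suc r" for b
    proof -
      have bd: "b < d" using that rd' by simp
      have "col P' b = col (P * E) (if b = r then j else if b = j then r else b)"
        using bd rd' j PE by (intro eq_vecI) (auto simp: P'_def)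
      then show ?thesis using that j rd' w P(3) colPE by (auto simp: less_Suc_eq split: if_splits)
    qed
    then have "good (Suc r)" unfolding good_def using P'c \<open>det P' \<noteq> 0\<close> rd' by auto
    then show False using r by fastforce
  qed
  then show thesis using that P rd by blast
qed

section \<open>Representations of finite groups\<close>

lemma subspace_module_vec_iff:
  "VectorSpace.subspace class_ring W (module_vec TYPE('a :: field) d) \<longleftrightarrow>
     W \<subseteq> carrier_vec d \<and> 0\<^sub>v d \<in> W \<and> (\<forall>v\<in>W. \<forall>w\<in>W. v + w \<in> W) \<and> (\<forall>c. \<forall>v\<in>W. c \<cdot>\<^sub>v v \<in> W)"
  unfolding VectorSpace.subspace_def submodule_def
  using vec_vs[of d, where 'a = 'a] vec_module[of d, where 'a = 'a]
  by (auto simp: module_vec_simps)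

text \<open>Membership in \<open>GL\<close> comes from the group:
  \<open>act \<sigma> (inv g)\<close> is the inverse matrix, by multiplicativity and the value at
  the unit.\<close>

lemma representationI:
  assumes "\<And>g. g \<in> carrier G \<Longrightarrow> act \<sigma> g \<in> carrier_mat (deg \<sigma>) (deg \<sigma>)"
    and "\<And>g h. g \<in> carrier G \<Longrightarrow> h \<in> carrier G \<Longrightarrow> act \<sigma> (g \<otimes>\<^bsub>G\<^esub> h) = act \<sigma> g * act \<sigma> h"
    and "act \<sigma> \<one>\<^bsub>G\<^esub> = 1\<^sub>m (deg \<sigma>)" and "group G"
  shows "representation G \<sigma>"
proof -
  interpret group G by fact
  have "act \<sigma> g \<in> carrier (GL (deg \<sigma>))" if g: "g \<in> carrier G" for g
  proof -
    have "act \<sigma> g * act \<sigma> (inv\<^bsub>G\<^esub> g) = 1\<^sub>m (deg \<sigma>)"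
        "act \<sigma> (inv\<^bsub>G\<^esub> g) * act \<sigma> g = 1\<^sub>m (deg \<sigma>)"
      using g assms(2)[of g "inv\<^bsub>G\<^esub> g"] assms(2)[of "inv\<^bsub>G\<^esub> g" g] assms(3) by auto
    then show ?thesis
      using assms(1)[OF g] assms(1)[of "inv\<^bsub>G\<^esub> g"] g
      by (auto simp: GL_def units_of_def Units_def ring_mat_simps)
  qed
  then show ?thesis
    using assms(2) by (auto simp: representation_def hom_def GL_def units_of_def ring_mat_simps)
qed

definition character :: "'g rep \<Rightarrow> 'g \<Rightarrow> complex" where
  "character \<sigma> g = mat_trace (act \<sigma> g)"

lemma equivalent_repI:
  assumes "P \<in> carrier_mat (deg \<sigma>) (deg \<sigma>)" "invertible_mat P" "deg \<sigma> = deg \<tau>"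
    and "\<And>g. g \<in> carrier G \<Longrightarrow> P * act \<sigma> g = act \<tau> g * P"
  shows "equivalent_rep G \<sigma> \<tau>"
  unfolding equivalent_rep_def using assms by blast

lemma equivalent_repE:
  assumes "equivalent_rep G \<sigma> \<tau>"
  obtains P where "P \<in> carrier_mat (deg \<sigma>) (deg \<sigma>)" "invertible_mat P" "deg \<tau> = deg \<sigma>"
    and "\<And>g. g \<in> carrier G \<Longrightarrow> P * act \<sigma> g = act \<tau> g * P"
  using assms unfolding equivalent_rep_def by metis

lemma equivalent_rep_refl: "equivalent_rep G \<sigma> \<sigma>" if "representation G \<sigma>"
proof -
  have "act \<sigma> g \<in> carrier_mat (deg \<sigma>) (deg \<sigma>)" if "g \<in> carrier G" for g
    using that \<open>representation G \<sigma>\<close>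
    by (auto simp: representation_def hom_def GL_def units_of_def Units_def ring_mat_simps)
  then show ?thesis
    by (intro equivalent_repI[of "1\<^sub>m (deg \<sigma>)"] invertible_matI[of _ "deg \<sigma>" "1\<^sub>m (deg \<sigma>)"])
       (auto simp: left_mult_one_mat[of _ "deg \<sigma>" "deg \<sigma>"] right_mult_one_mat[of _ "deg \<sigma>" "deg \<sigma>"])
qed

locale finite_group = group G for G (structure) + assumes fin: "finite (carrier G)"
begin

abbreviation ord_c :: complex where "ord_c \<equiv> of_nat (card (carrier G))"

lemma card_pos: "card (carrier G) > 0"
  using fin one_closed by (auto simp: card_gt_0_iff)

lemma rep_carrier: "representation G \<sigma> \<Longrightarrow> g \<in> carrier G \<Longrightarrow> act \<sigma> g \<in> carrier_mat (deg \<sigma>) (deg \<sigma>)"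
  by (auto simp: representation_def hom_def GL_def units_of_def Units_def ring_mat_simps)

lemma rep_mult:
  "representation G \<sigma> \<Longrightarrow> g \<in> carrier G \<Longrightarrow> h \<in> carrier G \<Longrightarrow> act \<sigma> (g \<otimes> h) = act \<sigma> g * act \<sigma> h"
  by (auto simp: representation_def hom_def GL_def units_of_def Units_def ring_mat_simps)

lemma rep_one:
  assumes \<sigma>: "representation G \<sigma>"
  shows "act \<sigma> \<one> = 1\<^sub>m (deg \<sigma>)"
proof -
  interpret R: ring "ring_mat TYPE(complex) (deg \<sigma>) ()" by (rule ring_mat)
  have "group (GL (deg \<sigma>))" unfolding GL_def by (rule R.units_group)
  then have "act \<sigma> \<one> = \<one>\<^bsub>GL (deg \<sigma>)\<^esub>"
    using \<sigma> unfolding representation_def by (intro hom_one is_group)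
  then show ?thesis by (simp add: GL_def units_of_def ring_mat_simps)
qed

lemma rep_inv:
  assumes "representation G \<sigma>" "g \<in> carrier G"
  shows "act \<sigma> g * act \<sigma> (inv g) = 1\<^sub>m (deg \<sigma>)" "act \<sigma> (inv g) * act \<sigma> g = 1\<^sub>m (deg \<sigma>)"
  using assms by (simp_all flip: rep_mult add: rep_one)

lemma bij_inv: "bij_betw (\<lambda>g. inv g) (carrier G) (carrier G)"
  by (rule bij_betwI[of _ _ _ "\<lambda>g. inv g"]) auto

lemma bij_mult_left: "h \<in> carrier G \<Longrightarrow> bij_betw (\<lambda>g. h \<otimes> g) (carrier G) (carrier G)"
  by (rule bij_betwI[of _ _ _ "\<lambda>g. inv h \<otimes> g"]) (auto simp: m_assoc[symmetric])

lemma sum_inv: "(\<Sum>g\<in>carrier G. f (inv g)) = (\<Sum>g\<in>carrier G. f g)"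
  using sum.reindex_bij_betw[OF bij_inv] .

text \<open>Only the sizes of the matrices are assumed, so that the lemma also applies to
  \<open>direct_sum_rep\<close>, for which just the sizes are established.\<close>

lemma equivalent_rep_sym:
  assumes "equivalent_rep G \<sigma> \<tau>"
    and "\<And>g. g \<in> carrier G \<Longrightarrow> act \<sigma> g \<in> carrier_mat (deg \<sigma>) (deg \<sigma>)"
    and "\<And>g. g \<in> carrier G \<Longrightarrow> act \<tau> g \<in> carrier_mat (deg \<tau>) (deg \<tau>)"
  shows "equivalent_rep G \<tau> \<sigma>"
proof -
  define d where "d = deg \<sigma>"
  obtain P where P: "P \<in> carrier_mat d d" "invertible_mat P" and d': "deg \<tau> = d"
    and PE: "\<And>g. g \<in> carrier G \<Longrightarrow> P * act \<sigma> g = act \<tau> g * P"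
    using equivalent_repE[OF assms(1)] unfolding d_def by blast
  obtain Q where Q: "Q \<in> carrier_mat d d" "P * Q = 1\<^sub>m d" "Q * P = 1\<^sub>m d"
    using invertible_matE[OF P(2,1)] by metis
  have "Q * act \<tau> g = act \<sigma> g * Q" if g: "g \<in> carrier G" for g
  proof -
    have s: "act \<sigma> g \<in> carrier_mat d d" and t: "act \<tau> g \<in> carrier_mat d d"
      using assms(2,3)[OF g] d' by (auto simp: d_def)
    have "Q * act \<tau> g = Q * (act \<tau> g * (P * Q))" using t Q by simp
    also have "\<dots> = Q * (act \<tau> g * P * Q)" by (subst assoc_mult_mat[OF t P(1) Q(1)]) simp
    also have "\<dots> = Q * (P * act \<sigma> g * Q)" using PE[OF g] by simp
    also have "\<dots> = Q * (P * (act \<sigma> g * Q))" by (subst assoc_mult_mat[OF P(1) s Q(1)]) simp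
    also have "\<dots> = Q * P * (act \<sigma> g * Q)"
      by (rule assoc_mult_mat[symmetric, of _ d d _ d _ d]) (use P Q s in auto)
    also have "\<dots> = act \<sigma> g * Q" using s Q by simp
    finally show ?thesis .
  qed
  then show ?thesis using Q(1) d' invertible_matI[OF Q(1) P(1) Q(3,2)]
    by (intro equivalent_repI[of Q]) (simp_all add: d_def)
qed

lemma equivalent_rep_trans:
  assumes "equivalent_rep G \<sigma> \<tau>" "equivalent_rep G \<tau> \<rho>"
    and s: "\<And>g. g \<in> carrier G \<Longrightarrow> act \<sigma> g \<in> carrier_mat (deg \<sigma>) (deg \<sigma>)"
    and t: "\<And>g. g \<in> carrier G \<Longrightarrow> act \<tau> g \<in> carrier_mat (deg \<tau>) (deg \<tau>)"
    and r: "\<And>g. g \<in> carrier G \<Longrightarrow> act \<rho> g \<in> carrier_mat (deg \<rho>) (deg \<rho>)"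
  shows "equivalent_rep G \<sigma> \<rho>"
proof -
  define d where "d = deg \<sigma>"
  obtain P where P: "P \<in> carrier_mat d d" "invertible_mat P" and d': "deg \<tau> = d"
    and PE: "\<And>g. g \<in> carrier G \<Longrightarrow> P * act \<sigma> g = act \<tau> g * P"
    using equivalent_repE[OF assms(1)] unfolding d_def by blast
  obtain Q where Q: "Q \<in> carrier_mat d d" "invertible_mat Q" and d'': "deg \<rho> = d"
    and QE: "\<And>g. g \<in> carrier G \<Longrightarrow> Q * act \<tau> g = act \<rho> g * Q"
    using equivalent_repE[OF assms(2)] unfolding d' by blast
  have "Q * P * act \<sigma> g = act \<rho> g * (Q * P)" if g: "g \<in> carrier G" for g
  proof -
    note c = s[OF g] t[OF g] r[OF g]
    then have c: "act \<sigma> g \<in> carrier_mat d d" "act \<tau> g \<in> carrier_mat d d" "act \<rho> g \<in> carrier_mat d d"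
      using d' d'' by (auto simp: d_def)
    have "Q * P * act \<sigma> g = Q * (P * act \<sigma> g)" by (rule assoc_mult_mat[OF Q(1) P(1) c(1)])
    also have "\<dots> = Q * act \<tau> g * P"
      unfolding PE[OF g] by (rule assoc_mult_mat[OF Q(1) c(2) P(1), symmetric])
    also have "\<dots> = act \<rho> g * (Q * P)"
      unfolding QE[OF g] by (rule assoc_mult_mat[OF c(3) Q(1) P(1)])
    finally show ?thesis .
  qed
  moreover have "Q * P \<in> carrier_mat d d" using Q(1) P(1) by simp
  ultimately show ?thesis using invertible_mat_mult[OF Q(1) P(1) Q(2) P(2)] d' d''
    by (intro equivalent_repI[of "Q * P"]) (simp_all add: d_def)
qed

lemma character_equivalent:
  assumes "equivalent_rep G \<sigma> \<tau>" "g \<in> carrier G"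
    and "act \<sigma> g \<in> carrier_mat (deg \<sigma>) (deg \<sigma>)" "act \<tau> g \<in> carrier_mat (deg \<tau>) (deg \<tau>)"
  shows "character \<sigma> g = character \<tau> g"
  using assms unfolding equivalent_rep_def character_def by (metis mat_trace_similar)

subsection \<open>Schur's lemma and orthogonality of characters\<close>

text \<open>Schur's lemma: the kernel \<open>K\<close> and the image \<open>I\<close> of a nonzero
  intertwiner are invariant, so irreducibility forces \<open>K\<close> to be zero and
  \<open>I\<close> to be everything. The inverse \<open>R\<close> is assembled from preimages of the
  unit vectors.\<close>

lemma irreducible_intertwiner:
  assumes \<sigma>: "irreducible_rep G \<sigma>" and \<tau>: "irreducible_rep G \<tau>"
    and P: "P \<in> carrier_mat (deg \<tau>) (deg \<sigma>)"
    and comm: "\<And>g. g \<in> carrier G \<Longrightarrow> P * act \<sigma> g = act \<tau> g * P"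
    and nz: "P \<noteq> 0\<^sub>m (deg \<tau>) (deg \<sigma>)"
  shows "deg \<sigma> = deg \<tau>" "invertible_mat P"
proof -
  define n m where "n = deg \<sigma>" and "m = deg \<tau>"
  note P = P[folded n_def m_def]
  have rs: "representation G \<sigma>" and rt: "representation G \<tau>"
    using \<sigma> \<tau> by (auto simp: irreducible_rep_def)
  define K where "K = {v \<in> carrier_vec n. P *\<^sub>v v = 0\<^sub>v m}"
  define I where "I = (\<lambda>v. P *\<^sub>v v) ` carrier_vec n"
  have sc: "act \<sigma> g \<in> carrier_mat n n" "act \<tau> g \<in> carrier_mat m m" if "g \<in> carrier G" for g
    using that rep_carrier[OF rs] rep_carrier[OF rt] by (auto simp: n_def m_def)
  have comm_v: "P *\<^sub>v (act \<sigma> g *\<^sub>v v) = act \<tau> g *\<^sub>v (P *\<^sub>v v)"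
    if "g \<in> carrier G" "v \<in> carrier_vec n" for g v
    using comm[OF that(1)] assoc_mult_mat_vec[OF P sc(1)[OF that(1)] that(2)]
      assoc_mult_mat_vec[OF sc(2)[OF that(1)] P that(2)] by simp
  have zero_v: "A *\<^sub>v 0\<^sub>v m = 0\<^sub>v m" if "A \<in> carrier_mat m m" for A :: "complex mat"
    using that by (intro eq_vecI) auto
  have "invariant_subspace G \<sigma> K"
    unfolding invariant_subspace_def subspace_module_vec_iff K_def n_def[symmetric]
    using P sc comm_v zero_v
    by (auto simp: mult_add_distrib_mat_vec[OF P] mult_mat_vec[OF P] intro!: mult_mat_vec_carrier)
  then have "K = {0\<^sub>v n} \<or> K = carrier_vec n" using \<sigma> by (auto simp: irreducible_rep_def n_def)
  moreover have "K \<noteq> carrier_vec n"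
  proof
    assume K: "K = carrier_vec n"
    have "P = 0\<^sub>m m n"
    proof (rule eq_matI)
      fix i j assume ij: "i < dim_row (0\<^sub>m m n :: complex mat)" "j < dim_col (0\<^sub>m m n :: complex mat)"
      have "unit_vec n j \<in> K" using K by simp
      then have "col P j = 0\<^sub>v m" using ij P by (simp add: K_def mult_mat_unit_vec[OF P])
      then have "col P j $ i = 0" using ij by simp
      then show "P $$ (i, j) = (0\<^sub>m m n :: complex mat) $$ (i, j)" using ij P by simp
    qed (use P in auto)
    with nz show False by (simp add: n_def m_def)
  qed
  ultimately have K: "K = {0\<^sub>v n}" by simp
  have "invariant_subspace G \<tau> I"
    unfolding invariant_subspace_def subspace_module_vec_iff m_def[symmetric]
  proof (intro conjI ballI allI)
    show "I \<subseteq> carrier_vec m" unfolding I_def using P by auto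
    show "0\<^sub>v m \<in> I" unfolding I_def using P by (intro image_eqI[of _ _ "0\<^sub>v n"]) (auto intro!: eq_vecI)
    show "v + w \<in> I" if "v \<in> I" "w \<in> I" for v w
      using that unfolding I_def by (auto simp: mult_add_distrib_mat_vec[OF P, symmetric])
    show "c \<cdot>\<^sub>v v \<in> I" if "v \<in> I" for c v
      using that unfolding I_def by (auto simp: mult_mat_vec[OF P, symmetric])
    show "act \<tau> g *\<^sub>v w \<in> I" if "g \<in> carrier G" "w \<in> I" for g w
      using that sc unfolding I_def by (auto simp: comm_v[symmetric] intro!: imageI mult_mat_vec_carrier)
  qed
  then have "I = {0\<^sub>v m} \<or> I = carrier_vec m" using \<tau> by (auto simp: irreducible_rep_def m_def)
  moreover have "I \<noteq> {0\<^sub>v m}"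
  proof
    assume "I = {0\<^sub>v m}"
    then have "K = carrier_vec n" by (auto simp: K_def I_def)
    with \<open>K \<noteq> carrier_vec n\<close> show False ..
  qed
  ultimately have I: "I = carrier_vec m" by simp
  have "\<exists>v. \<forall>i<m. v i \<in> carrier_vec n \<and> P *\<^sub>v v i = unit_vec m i"
  proof -
    have "\<forall>i. \<exists>v. v \<in> carrier_vec n \<and> P *\<^sub>v v = unit_vec m i"
    proof
      fix i
      have "unit_vec m i \<in> I" using I by simp
      then show "\<exists>v. v \<in> carrier_vec n \<and> P *\<^sub>v v = unit_vec m i" unfolding I_def by (metis imageE)
    qed
    then show ?thesis by metis
  qed
  then obtain v where v: "\<And>i. i < m \<Longrightarrow> v i \<in> carrier_vec n \<and> P *\<^sub>v v i = unit_vec m i" by blast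
  define R where "R = Matrix.mat n m (\<lambda>(i, j). v j $ i)"
  have R: "R \<in> carrier_mat n m" by (simp add: R_def)
  have "col R j = v j" if "j < m" for j
    using that v[OF that] by (intro eq_vecI) (auto simp: R_def)
  then have PR: "P * R = 1\<^sub>m m"
  proof (intro mat_col_eqI)
    fix j assume "j < dim_col (1\<^sub>m m :: complex mat)"
    then have j: "j < m" by simp
    then have "col (P * R) j = P *\<^sub>v v j" using \<open>\<And>j. j < m \<Longrightarrow> col R j = v j\<close> by (subst col_mult2[OF P R]) auto
    then show "col (P * R) j = col (1\<^sub>m m) j" using v[OF j] j by simp
  qed (use P R in auto)
  have "R * P = 1\<^sub>m n"
  proof (rule mat_col_eqI)
    fix j assume "j < dim_col (1\<^sub>m n :: complex mat)"
    then have j: "j < n" by simp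
    \<comment> \<open>Injectivity makes the right inverse a left inverse: \<open>P\<close> sends
      both \<open>R *\<^sub>v col P j\<close> and \<open>unit_vec n j\<close> to
      \<open>col P j\<close>.\<close>
    have "R *\<^sub>v col P j - unit_vec n j \<in> K"
    proof -
      have cj: "col P j \<in> carrier_vec m" using P j by auto
      have "P *\<^sub>v (R *\<^sub>v col P j) = col P j"
        using assoc_mult_mat_vec[OF P R cj] PR cj by simp
      then have "P *\<^sub>v (R *\<^sub>v col P j - unit_vec n j) = col P j - col P j"
        using mult_minus_distrib_mat_vec[OF P, of "R *\<^sub>v col P j" "unit_vec n j"] R cj j P
        by (auto simp: mult_mat_unit_vec[OF P])
      then show ?thesis unfolding K_def using R cj by auto
    qed
    then have diff: "R *\<^sub>v col P j - unit_vec n j = 0\<^sub>v n" using K by simp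
    have "R *\<^sub>v col P j = unit_vec n j"
    proof (rule eq_vecI)
      fix i assume "i < dim_vec (unit_vec n j :: complex Matrix.vec)"
      then have i: "i < n" by simp
      have "(R *\<^sub>v col P j - unit_vec n j) $ i = 0" unfolding diff using i by simp
      then show "(R *\<^sub>v col P j) $ i = unit_vec n j $ i"
        using i by (subst (asm) index_minus_vec(1)) simp_all
    qed (use R in simp)
    then show "col (R * P) j = col (1\<^sub>m n) j" using j by (simp add: col_mult2[OF R P])
  qed (use R P in auto)
  \<comment> \<open>Both products are identity matrices, and their traces agree; in characteristic 0
    this forces equal sizes.\<close>
  have "of_nat m = mat_trace (P * R)" by (simp add: PR mat_trace_def)
  also have "\<dots> = mat_trace (R * P)" by (rule mat_trace_mult_commute[OF P R])
  also have "\<dots> = of_nat n" by (simp add: \<open>R * P = 1\<^sub>m n\<close> mat_trace_def)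
  finally have "m = n" by simp
  then show "deg \<sigma> = deg \<tau>" by (simp add: n_def m_def)
  show "invertible_mat P"
    using P R PR \<open>R * P = 1\<^sub>m n\<close> \<open>m = n\<close> by (intro invertible_matI[of _ n R]) auto
qed

text \<open>Over the complex numbers \<open>P\<close> has an eigenvalue \<open>c\<close>. The
  difference of \<open>P\<close> and the scalar matrix of \<open>c\<close> still commutes with the
  group but kills an eigenvector, so by Schur's lemma it vanishes.\<close>

lemma irreducible_commutant:
  assumes \<sigma>: "irreducible_rep G \<sigma>" and P: "P \<in> carrier_mat (deg \<sigma>) (deg \<sigma>)"
    and comm: "\<And>g. g \<in> carrier G \<Longrightarrow> P * act \<sigma> g = act \<sigma> g * P"
  obtains c where "P = c \<cdot>\<^sub>m 1\<^sub>m (deg \<sigma>)"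
proof -
  define d where "d = deg \<sigma>"
  note P = P[folded d_def]
  have rs: "representation G \<sigma>" and d0: "d > 0" using \<sigma> by (auto simp: irreducible_rep_def d_def)
  obtain c v where v: "v \<in> carrier_vec d" "v \<noteq> 0\<^sub>v d" "P *\<^sub>v v = c \<cdot>\<^sub>v v"
    using spectrum_non_empty[OF P d0] P by (auto simp: spectrum_def eigenvalue_def eigenvector_def)
  define B where "B = P - c \<cdot>\<^sub>m 1\<^sub>m d"
  have B: "B \<in> carrier_mat d d" unfolding B_def using P by (intro minus_carrier_mat) auto
  have "B * act \<sigma> g = act \<sigma> g * B" if g: "g \<in> carrier G" for g
  proof -
    have s: "act \<sigma> g \<in> carrier_mat d d" using rep_carrier[OF rs g] by (simp add: d_def)
    then show ?thesis
      using comm[OF g] P mult_smult_assoc_mat[of "1\<^sub>m d" d d "act \<sigma> g" d c]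
        mult_smult_distrib[OF s, of "1\<^sub>m d" d c] unfolding B_def
      by (simp add: minus_mult_distrib_mat[of _ d d _ _ d] mult_minus_distrib_mat[of _ d d _ d])
  qed
  moreover have "\<not> invertible_mat B"
  proof
    assume "invertible_mat B"
    then obtain Q where Q: "Q \<in> carrier_mat d d" "Q * B = 1\<^sub>m d" using invertible_matE[OF _ B] by metis
    have "B *\<^sub>v v = P *\<^sub>v v - (c \<cdot>\<^sub>m 1\<^sub>m d) *\<^sub>v v"
      unfolding B_def using P v by (intro minus_mult_distrib_mat_vec) auto
    also have "(c \<cdot>\<^sub>m 1\<^sub>m d) *\<^sub>v v = c \<cdot>\<^sub>v v" using v by (intro eq_vecI) auto
    finally have "B *\<^sub>v v = 0\<^sub>v d" using v by simp
    then have "(Q * B) *\<^sub>v v = Q *\<^sub>v 0\<^sub>v d" using assoc_mult_mat_vec[OF Q(1) B v(1)] by simp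
    also have "\<dots> = 0\<^sub>v d" using Q by (intro eq_vecI) auto
    finally show False using v Q by simp
  qed
  ultimately have "B = 0\<^sub>m d d"
    using irreducible_intertwiner(2)[OF \<sigma> \<sigma>, of B] B by (auto simp: d_def)
  then have "P $$ (i, j) - (c \<cdot>\<^sub>m 1\<^sub>m d) $$ (i, j) = 0" if "i < d" "j < d" for i j
    using that P by (auto simp: B_def dest!: arg_cong[of _ _ "\<lambda>M. M $$ (i, j)"])
  then have "P = c \<cdot>\<^sub>m 1\<^sub>m d" using P by (intro eq_matI) auto
  then show thesis using that by (simp add: d_def)
qed

text \<open>For representations this is \<open>card (carrier G)\<close> times the projection of
  \<open>M\<close> onto the space of intertwiners from \<open>\<tau>\<close> to
  \<open>\<sigma>\<close>; the factor is kept to avoid divisions.\<close>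

definition average :: "'a rep \<Rightarrow> 'a rep \<Rightarrow> complex mat \<Rightarrow> complex mat" where
  "average \<sigma> \<tau> M = mat_sum (deg \<sigma>) (deg \<tau>) (\<lambda>g. act \<sigma> g * M * act \<tau> (inv g)) (carrier G)"

lemma average_intertwines:
  assumes rs: "representation G \<sigma>" and rt: "representation G \<tau>"
    and M: "M \<in> carrier_mat (deg \<sigma>) (deg \<tau>)" and h: "h \<in> carrier G"
  shows "average \<sigma> \<tau> M * act \<tau> h = act \<sigma> h * average \<sigma> \<tau> M"
proof -
  define n m where "n = deg \<sigma>" and "m = deg \<tau>"
  note M = M[folded n_def m_def]
  have c: "act \<sigma> g \<in> carrier_mat n n" "act \<tau> g \<in> carrier_mat m m" if "g \<in> carrier G" for g
    using that rep_carrier[OF rs] rep_carrier[OF rt] by (auto simp: n_def m_def)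
  have X: "act \<sigma> g * M * act \<tau> k \<in> carrier_mat n m" if "g \<in> carrier G" "k \<in> carrier G" for g k
    using M c(1)[OF that(1)] c(2)[OF that(2)] by auto
  have "act \<sigma> h * average \<sigma> \<tau> M = mat_sum n m (\<lambda>g. act \<sigma> h * (act \<sigma> g * M * act \<tau> (inv g))) (carrier G)"
    unfolding average_def n_def[symmetric] m_def[symmetric]
    by (rule mult_mat_sum) (use c h X in auto)
  \<comment> \<open>Written in terms of \<open>h \<otimes> g\<close>, so that reindexing can remove
    the translation by \<open>h\<close>; the extra factor \<open>act \<tau> h\<close> turns
    \<open>inv (h \<otimes> g)\<close> back into \<open>inv g\<close>.\<close>
  also have "\<dots> = mat_sum n m (\<lambda>g. act \<sigma> (h \<otimes> g) * M * act \<tau> (inv (h \<otimes> g)) * act \<tau> h) (carrier G)"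
  proof (rule mat_sum_cong)
    fix g assume g: "g \<in> carrier G"
    have "act \<sigma> (h \<otimes> g) * M \<in> carrier_mat n m"
      by (rule mult_carrier_mat[OF c(1)]) (use M h g in auto)
    then have 1: "act \<sigma> (h \<otimes> g) * M * act \<tau> (inv (h \<otimes> g)) * act \<tau> h =
        act \<sigma> (h \<otimes> g) * M * (act \<tau> (inv (h \<otimes> g)) * act \<tau> h)"
      by (rule assoc_mult_mat[of _ n m _ m _ m]) (use c h g in auto)
    have 2: "act \<tau> (inv (h \<otimes> g)) * act \<tau> h = act \<tau> (inv g)"
      using rep_mult[OF rt, of "inv (h \<otimes> g)" h] g h by (simp add: inv_mult_group m_assoc)
    have 3: "act \<sigma> (h \<otimes> g) * M = act \<sigma> h * (act \<sigma> g * M)"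
      unfolding rep_mult[OF rs h g] by (rule assoc_mult_mat[of _ n n _ n _ m]) (use M c h g in auto)
    have 4: "act \<sigma> h * (act \<sigma> g * M) * act \<tau> (inv g) = act \<sigma> h * (act \<sigma> g * M * act \<tau> (inv g))"
      by (rule assoc_mult_mat[of _ n n _ m _ m]) (use M c h g mult_carrier_mat[OF c(1)[OF g] M] in auto)
    show "act \<sigma> h * (act \<sigma> g * M * act \<tau> (inv g)) =
      act \<sigma> (h \<otimes> g) * M * act \<tau> (inv (h \<otimes> g)) * act \<tau> h"
      unfolding 1 2 unfolding 3 4 ..
  qed
  also have "\<dots> = mat_sum n m (\<lambda>g. act \<sigma> g * M * act \<tau> (inv g) * act \<tau> h) (carrier G)"
    by (rule mat_sum_reindex_bij[OF bij_mult_left[OF h], symmetric])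
  also have "\<dots> = average \<sigma> \<tau> M * act \<tau> h"
    unfolding average_def n_def[symmetric] m_def[symmetric]
    by (rule mat_sum_mult[symmetric]) (use c h X in auto)
  finally show ?thesis ..
qed

end

section \<open>Matrix coefficients and the orthogonality relations\<close>

definition elementary_mat :: "nat \<Rightarrow> nat \<Rightarrow> nat \<Rightarrow> nat \<Rightarrow> 'a :: zero_neq_one mat" where
  "elementary_mat n m j k = Matrix.mat n m (\<lambda>(a, b). if a = j \<and> b = k then 1 else 0)"

lemma elementary_mat_carrier [simp]: "elementary_mat n m j k \<in> carrier_mat n m"
  by (simp add: elementary_mat_def)

text \<open>A matrix unit between two factors isolates one entry of each, so the entries of its
  average are sums over the group of products of matrix coefficients.\<close>

lemma index_mult_elementary_mat:
  fixes A B :: "'a :: comm_semiring_1 mat"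
  assumes A: "A \<in> carrier_mat p n" and B: "B \<in> carrier_mat m q"
    and "i < p" "l < q" "j < n" "k < m"
  shows "(A * elementary_mat n m j k * B) $$ (i, l) = A $$ (i, j) * B $$ (k, l)"
proof -
  have 1: "(A * elementary_mat n m j k) $$ (i, b) = (if b = k then A $$ (i, j) else 0)" if "b < m" for b
  proof -
    have "(A * elementary_mat n m j k) $$ (i, b) =
        (\<Sum>a<n. if a = j then (if b = k then A $$ (i, a) else 0) else 0)"
      unfolding index_mult_sum[OF A elementary_mat_carrier assms(3) that]
      by (intro sum.cong) (use that in \<open>auto simp: elementary_mat_def\<close>)
    then show ?thesis using assms by simp
  qed
  have "(A * elementary_mat n m j k * B) $$ (i, l) =
     (\<Sum>b<m. (A * elementary_mat n m j k) $$ (i, b) * B $$ (b, l))"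
    by (rule index_mult_sum[of _ p]) (use assms in auto)
  also have "\<dots> = (\<Sum>b<m. if b = k then A $$ (i, j) * B $$ (b, l) else 0)"
    by (intro sum.cong) (auto simp: 1)
  finally show ?thesis using assms by simp
qed

context finite_group
begin

lemma index_average:
  assumes "representation G \<sigma>" "representation G \<tau>" "i < deg \<sigma>" "j < deg \<sigma>" "k < deg \<tau>" "l < deg \<tau>"
  shows "average \<sigma> \<tau> (elementary_mat (deg \<sigma>) (deg \<tau>) j k) $$ (i, l) =
    (\<Sum>g\<in>carrier G. act \<sigma> g $$ (i, j) * act \<tau> (inv g) $$ (k, l))"
  unfolding average_def using assms
  by (auto intro!: sum.cong index_mult_elementary_mat rep_carrier)

text \<open>The usual inner product has the conjugate of \<open>\<psi> g\<close> in place of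
  \<open>\<psi> (inv g)\<close>. For characters of a finite group the two agree, and with the
  inverse the matrices need not be made unitary first.\<close>

definition char_prod :: "('a \<Rightarrow> complex) \<Rightarrow> ('a \<Rightarrow> complex) \<Rightarrow> complex" where
  "char_prod \<phi> \<psi> = (\<Sum>g\<in>carrier G. \<phi> g * \<psi> (inv g)) / ord_c"

text \<open>A product of two traces is a double sum over diagonal entries; summed over the group,
  each term is an entry of an averaged matrix unit, to which Schur's lemma applies.\<close>

lemma char_prod_characters:
  assumes rs: "representation G \<sigma>" and rt: "representation G \<tau>"
  shows "char_prod (character \<sigma>) (character \<tau>) = (\<Sum>i<deg \<sigma>. \<Sum>k<deg \<tau>.
    average \<sigma> \<tau> (elementary_mat (deg \<sigma>) (deg \<tau>) i k) $$ (i, k)) / ord_c"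
proof -
  have "(\<Sum>g\<in>carrier G. character \<sigma> g * character \<tau> (inv g)) =
      (\<Sum>g\<in>carrier G. \<Sum>i<deg \<sigma>. \<Sum>k<deg \<tau>. act \<sigma> g $$ (i, i) * act \<tau> (inv g) $$ (k, k))"
  proof (rule sum.cong[OF refl])
    fix g assume g: "g \<in> carrier G"
    have "dim_row (act \<sigma> g) = deg \<sigma>" "dim_row (act \<tau> (inv g)) = deg \<tau>"
      using rep_carrier[OF rs g] rep_carrier[OF rt, of "inv g"] g by auto
    then show "character \<sigma> g * character \<tau> (inv g) =
        (\<Sum>i<deg \<sigma>. \<Sum>k<deg \<tau>. act \<sigma> g $$ (i, i) * act \<tau> (inv g) $$ (k, k))"
      by (simp add: character_def mat_trace_def sum_product)
  qed
  also have "\<dots> = (\<Sum>i<deg \<sigma>. \<Sum>k<deg \<tau>. \<Sum>g\<in>carrier G. act \<sigma> g $$ (i, i) * act \<tau> (inv g) $$ (k, k))"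
    by (subst sum.swap) (intro sum.cong refl sum.swap)
  also have "\<dots> = (\<Sum>i<deg \<sigma>. \<Sum>k<deg \<tau>.
    average \<sigma> \<tau> (elementary_mat (deg \<sigma>) (deg \<tau>) i k) $$ (i, k))"
    by (intro sum.cong refl) (simp add: index_average[OF rs rt])
  finally show ?thesis by (simp add: char_prod_def)
qed

text \<open>Averaging any matrix gives an intertwiner from \<open>\<tau>\<close> to
  \<open>\<sigma>\<close>, and a nonzero one would be an equivalence.\<close>

lemma char_prod_inequivalent:
  assumes \<sigma>: "irreducible_rep G \<sigma>" and \<tau>: "irreducible_rep G \<tau>" and ne: "\<not> equivalent_rep G \<tau> \<sigma>"
  shows "char_prod (character \<sigma>) (character \<tau>) = 0"
proof -
  have rs: "representation G \<sigma>" and rt: "representation G \<tau>"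
    using \<sigma> \<tau> by (auto simp: irreducible_rep_def)
  have "average \<sigma> \<tau> M = 0\<^sub>m (deg \<sigma>) (deg \<tau>)" if M: "M \<in> carrier_mat (deg \<sigma>) (deg \<tau>)" for M
  proof (rule ccontr)
    assume nz: "average \<sigma> \<tau> M \<noteq> 0\<^sub>m (deg \<sigma>) (deg \<tau>)"
    have c: "average \<sigma> \<tau> M \<in> carrier_mat (deg \<sigma>) (deg \<tau>)" by (simp add: average_def)
    note * = irreducible_intertwiner[OF \<tau> \<sigma> c average_intertwines[OF rs rt M] nz]
    have "equivalent_rep G \<tau> \<sigma>"
      by (rule equivalent_repI[of "average \<sigma> \<tau> M"])
         (use * c average_intertwines[OF rs rt M] in simp_all)
    with ne show False ..
  qed
  then show ?thesis by (simp add: char_prod_characters[OF rs rt])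
qed

text \<open>By Schur's lemma an averaged matrix unit is a scalar matrix. Conjugation preserves the
  trace, which fixes the scalar: \<open>ord_c / of_nat d\<close> for a diagonal unit and 0 for any
  other. The \<open>d\<close> diagonal contributions add up to \<open>ord_c\<close>.\<close>

lemma char_prod_self:
  assumes \<sigma>: "irreducible_rep G \<sigma>"
  shows "char_prod (character \<sigma>) (character \<sigma>) = 1"
proof -
  define d where "d = deg \<sigma>"
  have rs: "representation G \<sigma>" and d0: "d > 0" using \<sigma> by (auto simp: irreducible_rep_def d_def)
  have avg: "average \<sigma> \<sigma> (elementary_mat d d j k) $$ (i, l) =
      (if i = l \<and> j = k then ord_c / of_nat d else 0)"
    if "i < d" "j < d" "k < d" "l < d" for i j k l
  proof -
    let ?M = "elementary_mat d d j k :: complex mat"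
    have c: "average \<sigma> \<sigma> ?M \<in> carrier_mat (deg \<sigma>) (deg \<sigma>)" by (simp add: average_def)
    obtain c where c: "average \<sigma> \<sigma> ?M = c \<cdot>\<^sub>m 1\<^sub>m d"
      using irreducible_commutant[OF \<sigma> c average_intertwines[OF rs rs]] by (auto simp: d_def)
    have "c * of_nat d = mat_trace (average \<sigma> \<sigma> ?M)"
      unfolding c by (simp add: mat_trace_def)
    also have "\<dots> = (\<Sum>g\<in>carrier G. mat_trace (act \<sigma> g * ?M * act \<sigma> (inv g)))"
      unfolding average_def d_def[symmetric]
      by (rule mat_trace_mat_sum) (auto simp: d_def intro!: mult_carrier_mat rep_carrier[OF rs])
    also have "\<dots> = (\<Sum>g\<in>carrier G. mat_trace ?M)"
    proof (rule sum.cong[OF refl])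
      fix g assume g: "g \<in> carrier G"
      have s: "act \<sigma> g \<in> carrier_mat d d" "act \<sigma> (inv g) \<in> carrier_mat d d"
        using rep_carrier[OF rs] g by (auto simp: d_def)
      have "mat_trace (act \<sigma> g * ?M * act \<sigma> (inv g)) = mat_trace (act \<sigma> (inv g) * (act \<sigma> g * ?M))"
        by (rule mat_trace_mult_commute[of _ d d]) (use s in auto)
      also have "act \<sigma> (inv g) * (act \<sigma> g * ?M) = act \<sigma> (inv g) * act \<sigma> g * ?M"
        by (rule assoc_mult_mat[symmetric, of _ d d _ d _ d]) (use s in auto)
      also have "\<dots> = ?M" using rep_inv(2)[OF rs g]
        by (simp add: d_def left_mult_one_mat[of _ "deg \<sigma>" "deg \<sigma>"])
      finally show "mat_trace (act \<sigma> g * ?M * act \<sigma> (inv g)) = mat_trace ?M" .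
    qed
    also have "mat_trace ?M = (if j = k then 1 else 0)"
      using that by (auto simp: mat_trace_def elementary_mat_def)
    finally have "c = (if j = k then ord_c / of_nat d else 0)"
      using d0 by (auto simp: field_simps)
    then show ?thesis using that by (simp add: c)
  qed
  have "(\<Sum>i<d. \<Sum>k<d. average \<sigma> \<sigma> (elementary_mat d d i k) $$ (i, k)) =
     (\<Sum>i<d. \<Sum>k<d. if i = k then ord_c / of_nat d else 0)"
    by (intro sum.cong refl) (simp add: avg)
  also have "\<dots> = ord_c" using d0 by simp
  finally show ?thesis using card_pos by (simp add: char_prod_characters[OF rs rs] flip: d_def)
qed

lemma irreducible_rep_carrier:
  "irreducible_rep G \<sigma> \<Longrightarrow> g \<in> carrier G \<Longrightarrow> act \<sigma> g \<in> carrier_mat (deg \<sigma>) (deg \<sigma>)"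
  by (auto simp: irreducible_rep_def intro: rep_carrier)

lemma character_equivalent_irreducible:
  "irreducible_rep G \<sigma> \<Longrightarrow> irreducible_rep G \<tau> \<Longrightarrow> equivalent_rep G \<sigma> \<tau> \<Longrightarrow> g \<in> carrier G \<Longrightarrow>
    character \<sigma> g = character \<tau> g"
  by (intro character_equivalent irreducible_rep_carrier)

lemma equivalent_irreducible_sym:
  "irreducible_rep G \<sigma> \<Longrightarrow> irreducible_rep G \<tau> \<Longrightarrow> equivalent_rep G \<sigma> \<tau> \<Longrightarrow> equivalent_rep G \<tau> \<sigma>"
  by (rule equivalent_rep_sym) (auto dest: irreducible_rep_carrier)

lemma char_prod_irreducible:
  assumes \<sigma>: "irreducible_rep G \<sigma>" and \<tau>: "irreducible_rep G \<tau>"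
  shows "char_prod (character \<sigma>) (character \<tau>) = (if equivalent_rep G \<tau> \<sigma> then 1 else 0)"
proof (cases "equivalent_rep G \<tau> \<sigma>")
  case True
  have "char_prod (character \<sigma>) (character \<tau>) = char_prod (character \<sigma>) (character \<sigma>)"
    unfolding char_prod_def
    using character_equivalent_irreducible[OF \<tau> \<sigma> True] by simp
  then show ?thesis using True char_prod_self[OF \<sigma>] by simp
qed (use char_prod_inequivalent[OF \<sigma> \<tau>] in simp)

end

section \<open>Direct sums and block matrices\<close>

lemma direct_sum_carrier:
  assumes "\<forall>\<sigma>\<in>set \<sigma>s. act \<sigma> g \<in> carrier_mat (deg \<sigma>) (deg \<sigma>)"
  shows "act (direct_sum_rep \<sigma>s) g \<in> carrier_mat (deg (direct_sum_rep \<sigma>s)) (deg (direct_sum_rep \<sigma>s))"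
proof -
  have "map dim_row (map (\<lambda>\<sigma>. act \<sigma> g) \<sigma>s) = map deg \<sigma>s" "map dim_col (map (\<lambda>\<sigma>. act \<sigma> g) \<sigma>s) = map deg \<sigma>s"
    using assms by auto
  then show ?thesis
    unfolding direct_sum_rep_def rep.sel by (intro carrier_matI) (simp_all only: dim_diag_block_mat)
qed

lemma direct_sum_rep_singleton: "direct_sum_rep [\<sigma>] = \<sigma>"
  by (cases \<sigma>) (simp add: direct_sum_rep_def del: diag_block_mat.simps)

lemma act_direct_sum_append:
  assumes "act (direct_sum_rep \<sigma>s) g \<in> carrier_mat n n" "act (direct_sum_rep \<tau>s) g \<in> carrier_mat m m"
  shows "act (direct_sum_rep (\<sigma>s @ \<tau>s)) g =
    four_block_mat (act (direct_sum_rep \<sigma>s) g) (0\<^sub>m n m) (0\<^sub>m m n) (act (direct_sum_rep \<tau>s) g)"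
  using assms by (simp add: direct_sum_rep_def diag_block_mat_append Let_def)

lemma character_direct_sum:
  assumes "\<forall>\<sigma>\<in>set \<sigma>s. act \<sigma> g \<in> carrier_mat (deg \<sigma>) (deg \<sigma>)"
  shows "character (direct_sum_rep \<sigma>s) g = (\<Sum>\<sigma>\<leftarrow>\<sigma>s. character \<sigma> g)"
proof -
  have "\<forall>A\<in>set (map (\<lambda>\<sigma>. act \<sigma> g) \<sigma>s). square_mat A" using assms by auto
  then show ?thesis by (simp add: character_def direct_sum_rep_def mat_trace_diag_block comp_def)
qed

text \<open>Used to read off the laws of the single blocks from the multiplicativity of a block
  triangular representation.\<close>

lemma four_block_mat_inject:
  assumes c: "A \<in> carrier_mat n n" "B \<in> carrier_mat n m" "C \<in> carrier_mat m n" "D \<in> carrier_mat m m"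
    and c': "A' \<in> carrier_mat n n" "B' \<in> carrier_mat n m" "C' \<in> carrier_mat m n" "D' \<in> carrier_mat m m"
    and eq: "four_block_mat A B C D = four_block_mat A' B' C' D'"
  shows "A = A'" "B = B'" "C = C'" "D = D'"
proof -
  have *: "four_block_mat A B C D $$ (i, j) = four_block_mat A' B' C' D' $$ (i, j)" for i j
    using eq by simp
  show "A = A'"
  proof (rule eq_matI)
    fix i j assume "i < dim_row A'" "j < dim_col A'"
    then show "A $$ (i, j) = A' $$ (i, j)" using *[of i j] c c' by simp
  qed (use c c' in auto)
  show "B = B'"
  proof (rule eq_matI)
    fix i j assume "i < dim_row B'" "j < dim_col B'"
    then show "B $$ (i, j) = B' $$ (i, j)" using *[of i "j + n"] c c' by simp
  qed (use c c' in auto)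
  show "C = C'"
  proof (rule eq_matI)
    fix i j assume "i < dim_row C'" "j < dim_col C'"
    then show "C $$ (i, j) = C' $$ (i, j)" using *[of "i + n" j] c c' by simp
  qed (use c c' in auto)
  show "D = D'"
  proof (rule eq_matI)
    fix i j assume "i < dim_row D'" "j < dim_col D'"
    then show "D $$ (i, j) = D' $$ (i, j)" using *[of "i + n" "j + n"] c c' by simp
  qed (use c c' in auto)
qed

lemma invertible_upper_unitriangular_block:
  fixes X :: "'a :: comm_ring_1 mat"
  assumes X: "X \<in> carrier_mat n m"
  shows "invertible_mat (four_block_mat (1\<^sub>m n) X (0\<^sub>m m n) (1\<^sub>m m))"
proof (rule invertible_matI[of _ "n + m" "four_block_mat (1\<^sub>m n) (- X) (0\<^sub>m m n) (1\<^sub>m m)"])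
  have "X + - X = 0\<^sub>m n m" "- X + X = 0\<^sub>m n m" "- 0\<^sub>m m m = (0\<^sub>m m m :: 'a mat)"
    "- 0\<^sub>m n n = (0\<^sub>m n n :: 'a mat)"
    using X by (auto intro!: eq_matI)
  then show "four_block_mat (1\<^sub>m n) X (0\<^sub>m m n) (1\<^sub>m m) * four_block_mat (1\<^sub>m n) (- X) (0\<^sub>m m n) (1\<^sub>m m) = 1\<^sub>m (n + m)"
    "four_block_mat (1\<^sub>m n) (- X) (0\<^sub>m m n) (1\<^sub>m m) * four_block_mat (1\<^sub>m n) X (0\<^sub>m m n) (1\<^sub>m m) = 1\<^sub>m (n + m)"
    using X by (simp_all add: mult_four_block_mat[of _ n n _ m _ m _ _ n _ m])
qed simp_all

lemma inverse_smult_add_smult: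
  fixes A B :: "'a :: field mat"
  assumes "A \<in> carrier_mat n m" "B \<in> carrier_mat n m" "k \<noteq> 0"
  shows "(1 / k) \<cdot>\<^sub>m (A + k \<cdot>\<^sub>m B) = (1 / k) \<cdot>\<^sub>m A + B"
  using assms by (intro eq_matI) (simp_all add: field_simps)

lemma invertible_diag_block:
  fixes P Q :: "'a :: comm_ring_1 mat"
  assumes P: "P \<in> carrier_mat n n" "invertible_mat P" and Q: "Q \<in> carrier_mat m m" "invertible_mat Q"
  shows "invertible_mat (four_block_mat P (0\<^sub>m n m) (0\<^sub>m m n) Q)"
proof -
  obtain P' where P': "P' \<in> carrier_mat n n" "P * P' = 1\<^sub>m n" "P' * P = 1\<^sub>m n"
    using invertible_matE[OF P(2,1)] by metis
  obtain Q' where Q': "Q' \<in> carrier_mat m m" "Q * Q' = 1\<^sub>m m" "Q' * Q = 1\<^sub>m m"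
    using invertible_matE[OF Q(2,1)] by metis
  show ?thesis
    by (rule invertible_matI[of _ "n + m" "four_block_mat P' (0\<^sub>m n m) (0\<^sub>m m n) Q'"])
      (use P P' Q Q' in \<open>simp_all add: mult_four_block_mat[of _ n n _ m _ m _ _ n _ m]\<close>)
qed

text \<open>\<open>P *\<^sub>v v\<close> is a combination of the first \<open>r\<close> columns. The
  induction switches on one coordinate at a time, because a subspace is given by closure under
  binary sums and scaling.\<close>

lemma mult_mat_vec_initial_columns:
  fixes P :: "'a :: field mat" and v :: "'a Matrix.vec"
  assumes W: "VectorSpace.subspace class_ring W (module_vec TYPE('a) d)"
    and P: "P \<in> carrier_mat d d" and cols: "\<And>j. j < r \<Longrightarrow> col P j \<in> W" and r: "r \<le> d"
    and v: "v \<in> carrier_vec d" "\<And>i. i < d \<Longrightarrow> i \<ge> r \<Longrightarrow> v $ i = 0"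
  shows "P *\<^sub>v v \<in> W"
proof -
  note W = W[unfolded subspace_module_vec_iff]
  have "P *\<^sub>v Matrix.vec d (\<lambda>i. if i < k then v $ i else 0) \<in> W" if "k \<le> r" for k
    using that
  proof (induction k)
    case 0
    have "P *\<^sub>v Matrix.vec d (\<lambda>i. if i < 0 then v $ i else 0) = 0\<^sub>v d"
      using P by (intro eq_vecI) (auto simp: scalar_prod_def)
    then show ?case using W by simp
  next
    case (Suc k)
    then have k: "k < d" "k < r" using r by auto
    let ?u = "Matrix.vec d (\<lambda>i. if i < k then v $ i else 0)"
    have "Matrix.vec d (\<lambda>i. if i < Suc k then v $ i else 0) = ?u + v $ k \<cdot>\<^sub>v unit_vec d k"
      using k by (intro eq_vecI) (auto simp: less_Suc_eq)
    then have "P *\<^sub>v Matrix.vec d (\<lambda>i. if i < Suc k then v $ i else 0) = P *\<^sub>v ?u + v $ k \<cdot>\<^sub>v col P k"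
      using mult_mat_unit_vec[OF P k(1)] by (simp add: mult_add_distrib_mat_vec[OF P] mult_mat_vec[OF P])
    then show ?case using W Suc cols[OF k(2)] by simp
  qed
  moreover have "Matrix.vec d (\<lambda>i. if i < r then v $ i else 0) = v"
    using v by (intro eq_vecI) auto
  ultimately show ?thesis by (metis order_refl)
qed

context finite_group
begin

subsection \<open>Complete reducibility\<close>

text \<open>In a basis adapted to an invariant subspace the matrices have diagonal blocks \<open>a\<close>, \<open>c\<close> and an
  upper right block with \<open>b (gh) = a g * b h + b g * c h\<close>. Hence the average \<open>X\<close> of
  \<open>b h * c (h\<^sup>-\<^sup>1)\<close> satisfies \<open>a g * X + b g = X * c g\<close>, and conjugation by the unitriangular block
  matrix of \<open>X\<close> removes \<open>b\<close>.\<close>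

lemma reducible_splits:
  assumes rt: "representation G \<tau>" and "deg \<tau> > 0" and red: "\<not> irreducible_rep G \<tau>"
  obtains \<alpha> \<gamma> where "representation G \<alpha>" "representation G \<gamma>" "deg \<alpha> < deg \<tau>" "deg \<gamma> < deg \<tau>"
    "equivalent_rep G \<tau> (direct_sum_rep [\<alpha>, \<gamma>])"
proof -
  define d where "d = deg \<tau>"
  have tc: "act \<tau> g \<in> carrier_mat d d" if "g \<in> carrier G" for g
    using rep_carrier[OF rt that] by (simp add: d_def)
  obtain W where W: "invariant_subspace G \<tau> W" "W \<noteq> {0\<^sub>v d}" "W \<noteq> carrier_vec d"
    using assms by (auto simp: irreducible_rep_def d_def)
  have sub: "VectorSpace.subspace class_ring W (module_vec TYPE(complex) d)"
    and inv: "\<And>g w. g \<in> carrier G \<Longrightarrow> w \<in> W \<Longrightarrow> act \<tau> g *\<^sub>v w \<in> W"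
    using W by (auto simp: invariant_subspace_def d_def)
  note sub' = sub[unfolded subspace_module_vec_iff]
  obtain P r where P: "P \<in> carrier_mat d d" "det P \<noteq> 0" "r \<le> d"
    and colW: "\<And>j. j < r \<Longrightarrow> col P j \<in> W"
    and Wspan: "\<And>w. w \<in> W \<Longrightarrow> \<exists>v\<in>carrier_vec d. w = P *\<^sub>v v \<and> (\<forall>i<d. i \<ge> r \<longrightarrow> v $ i = 0)"
    using adapted_basis[of W d] sub' by auto
  obtain Q where Q: "Q \<in> carrier_mat d d" "P * Q = 1\<^sub>m d" "Q * P = 1\<^sub>m d"
    using invertible_matE[OF invertible_mat_if_det[OF P(1,2)] P(1)] by metis
  \<comment> \<open>The bounds \<open>0 < r\<close> and \<open>r < d\<close> express that
    \<open>W\<close> is neither zero nor everything; they make both blocks smaller than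
    \<open>\<tau>\<close>.\<close>
  have "r > 0"
  proof (rule ccontr)
    assume "\<not> r > 0"
    have "w = 0\<^sub>v d" if w: "w \<in> W" for w
    proof -
      obtain v where v: "v \<in> carrier_vec d" "w = P *\<^sub>v v" "\<forall>i<d. v $ i = 0"
        using Wspan[OF w] \<open>\<not> r > 0\<close> by auto
      then have "v = 0\<^sub>v d" by (intro eq_vecI) auto
      then show ?thesis using v P by (auto intro!: eq_vecI)
    qed
    with W(2) sub' show False by blast
  qed
  have "r < d"
  proof (rule ccontr)
    assume "\<not> r < d"
    then have "r = d" using P by simp
    have "w \<in> W" if w: "w \<in> carrier_vec d" for w
    proof -
      have "P *\<^sub>v (Q *\<^sub>v w) \<in> W"
        by (rule mult_mat_vec_initial_columns[OF sub P(1) colW P(3)]) (use Q w \<open>r = d\<close> in auto)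
      then show ?thesis using assoc_mult_mat_vec[OF P(1) Q(1) w] Q w by simp
    qed
    with W(3) sub' show False by blast
  qed
  define s where "s = d - r"
  have drs: "d = r + s" using \<open>r < d\<close> by (simp add: s_def)
  \<comment> \<open>This is \<open>\<tau>\<close> in the coordinates given by the columns of
    \<open>P\<close>.\<close>
  define \<tau>' where "\<tau>' g = Q * (act \<tau> g * P)" for g
  have \<tau>'c: "\<tau>' g \<in> carrier_mat d d" if "g \<in> carrier G" for g
    using tc[OF that] P Q by (simp add: \<tau>'_def)
  have P\<tau>': "P * \<tau>' g = act \<tau> g * P" if g: "g \<in> carrier G" for g
  proof -
    have "P * \<tau>' g = P * Q * (act \<tau> g * P)"
      unfolding \<tau>'_def by (rule assoc_mult_mat[symmetric, of _ d d _ d _ d]) (use tc[OF g] P Q in auto)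
    then show ?thesis using Q tc[OF g] P left_mult_one_mat[of "act \<tau> g * P" d d] by simp
  qed
  have \<tau>'_mult: "\<tau>' (g \<otimes> h) = \<tau>' g * \<tau>' h" if g: "g \<in> carrier G" and h: "h \<in> carrier G" for g h
  proof -
    have "\<tau>' g * \<tau>' h = Q * (act \<tau> g * P * \<tau>' h)"
      unfolding \<tau>'_def[of g] using tc[OF g] \<tau>'c[OF h] P Q by (intro assoc_mult_mat[of _ d d _ d _ d]) auto
    also have "act \<tau> g * P * \<tau>' h = act \<tau> g * (P * \<tau>' h)"
      using tc[OF g] \<tau>'c[OF h] P by (intro assoc_mult_mat[of _ d d _ d _ d]) auto
    also have "\<dots> = act \<tau> g * (act \<tau> h * P)" unfolding P\<tau>'[OF h] ..
    also have "\<dots> = act \<tau> g * act \<tau> h * P"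
      using tc[OF g] tc[OF h] P by (intro assoc_mult_mat[symmetric, of _ d d _ d _ d]) auto
    finally show ?thesis using rep_mult[OF rt g h] by (simp add: \<tau>'_def)
  qed
  have \<tau>'_one: "\<tau>' \<one> = 1\<^sub>m d"
    using rep_one[OF rt] P Q by (simp add: \<tau>'_def d_def left_mult_one_mat[of _ "deg \<tau>" "deg \<tau>"])
  \<comment> \<open>Invariance of \<open>W\<close>: the images of the first \<open>r\<close> basis
    vectors stay in \<open>W\<close>, whose members have zero coordinates from index
    \<open>r\<close> on.\<close>
  have lower_left: "\<tau>' g $$ (i, j) = 0" if g: "g \<in> carrier G" and ij: "r \<le> i" "i < d" "j < r" for g i j
  proof -
    have cj: "col P j \<in> carrier_vec d" "j < d" using P ij \<open>r < d\<close> by auto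
    obtain v where v: "v \<in> carrier_vec d" "act \<tau> g *\<^sub>v col P j = P *\<^sub>v v" "v $ i = 0"
      using Wspan[OF inv[OF g colW[OF ij(3)]]] ij by auto
    have "col (\<tau>' g) j = Q *\<^sub>v col (act \<tau> g * P) j"
      unfolding \<tau>'_def by (rule col_mult2[of _ d d _ d]) (use tc[OF g] P Q cj in auto)
    also have "col (act \<tau> g * P) j = act \<tau> g *\<^sub>v col P j"
      by (rule col_mult2[OF tc[OF g] P(1) cj(2)])
    also have "Q *\<^sub>v (act \<tau> g *\<^sub>v col P j) = v"
      unfolding v(2) using v(1) assoc_mult_mat_vec[OF Q(1) P(1) v(1), symmetric] Q(3) by simp
    finally have "col (\<tau>' g) j $ i = 0" using v by simp
    then show ?thesis using \<tau>'c[OF g] ij cj by simp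
  qed
  define a where "a g = Matrix.mat r r (\<lambda>(i, j). \<tau>' g $$ (i, j))" for g
  define b where "b g = Matrix.mat r s (\<lambda>(i, j). \<tau>' g $$ (i, j + r))" for g
  define c where "c g = Matrix.mat s s (\<lambda>(i, j). \<tau>' g $$ (i + r, j + r))" for g
  have abc: "a g \<in> carrier_mat r r" "b g \<in> carrier_mat r s" "c g \<in> carrier_mat s s" for g
    by (simp_all add: a_def b_def c_def)
  have block: "\<tau>' g = four_block_mat (a g) (b g) (0\<^sub>m s r) (c g)" if g: "g \<in> carrier G" for g
    using \<tau>'c[OF g] drs lower_left[OF g] by (intro eq_matI) (auto simp: a_def b_def c_def)
  have mult: "a (g \<otimes> h) = a g * a h \<and> b (g \<otimes> h) = a g * b h + b g * c h \<and> c (g \<otimes> h) = c g * c h"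
    if g: "g \<in> carrier G" and h: "h \<in> carrier G" for g h
  proof -
    have "four_block_mat (a (g \<otimes> h)) (b (g \<otimes> h)) (0\<^sub>m s r) (c (g \<otimes> h)) = \<tau>' g * \<tau>' h"
      using block[of "g \<otimes> h"] \<tau>'_mult[OF g h] g h by simp
    also have "\<dots> = four_block_mat (a g * a h + b g * 0\<^sub>m s r) (a g * b h + b g * c h)
        (0\<^sub>m s r * a h + c g * 0\<^sub>m s r) (0\<^sub>m s r * b h + c g * c h)"
      unfolding block[OF g] block[OF h] using abc
      by (intro mult_four_block_mat[of _ r r _ s _ s _ _ r _ s]) auto
    also have "\<dots> = four_block_mat (a g * a h) (a g * b h + b g * c h) (0\<^sub>m s r) (c g * c h)"
      using abc[of g] abc[of h] mult_carrier_mat[OF abc(1)[of g] abc(1)[of h]]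
        mult_carrier_mat[OF abc(3)[of g] abc(3)[of h]]
      by simp
    finally have eq: "four_block_mat (a (g \<otimes> h)) (b (g \<otimes> h)) (0\<^sub>m s r) (c (g \<otimes> h)) =
      four_block_mat (a g * a h) (a g * b h + b g * c h) (0\<^sub>m s r) (c g * c h)" .
    have "a g * b h + b g * c h \<in> carrier_mat r s"
      by (rule add_carrier_mat[OF mult_carrier_mat[OF abc(2,3)]])
    from four_block_mat_inject[OF abc(1,2) zero_carrier_mat abc(3) mult_carrier_mat[OF abc(1,1)] this
        zero_carrier_mat mult_carrier_mat[OF abc(3,3)] eq]
    show ?thesis by simp
  qed
  have one: "a \<one> = 1\<^sub>m r" "c \<one> = 1\<^sub>m s"
    unfolding a_def c_def \<tau>'_one using drs by (auto intro!: eq_matI)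
  define \<alpha> where "\<alpha> = Rep r a"
  define \<gamma> where "\<gamma> = Rep s c"
  have ra: "representation G \<alpha>" and rc: "representation G \<gamma>"
    using mult one abc by (auto intro!: representationI is_group simp: \<alpha>_def \<gamma>_def)
  \<comment> \<open>\<open>S\<close> is \<open>card (carrier G)\<close> times the wanted
    \<open>X\<close>; hence the factor \<open>ord_c\<close> in \<open>aS\<close>, divided out only
    afterwards.\<close>
  define S where "S = mat_sum r s (\<lambda>h. b h * c (inv h)) (carrier G)"
  have S: "S \<in> carrier_mat r s" by (simp add: S_def)
  have bc: "b h * c k \<in> carrier_mat r s" for h k by (rule mult_carrier_mat[OF abc(2,3)])
  have aS: "a g * S + ord_c \<cdot>\<^sub>m b g = S * c g" if g: "g \<in> carrier G" for g
  proof -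
    have "S * c g = mat_sum r s (\<lambda>h. b h * c (inv h) * c g) (carrier G)"
      unfolding S_def by (rule mat_sum_mult[OF abc(3) bc])
    also have "\<dots> = mat_sum r s (\<lambda>h. b (g \<otimes> h) * c (inv (g \<otimes> h)) * c g) (carrier G)"
      by (rule mat_sum_reindex_bij[OF bij_mult_left[OF g]])
    \<comment> \<open>The product rule for \<open>b\<close> splits each summand in two; the part
      \<open>b g\<close> no longer depends on \<open>h\<close> and so is counted once per group
      element.\<close>
    also have "\<dots> = mat_sum r s (\<lambda>h. a g * (b h * c (inv h)) + b g) (carrier G)"
    proof (rule mat_sum_cong)
      fix h assume h: "h \<in> carrier G"
      have 1: "c (inv (g \<otimes> h)) * c g = c (inv h)"
        using mult[of "inv (g \<otimes> h)" g] g h by (simp add: inv_mult_group m_assoc)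
      have 2: "c h * c (inv h) = 1\<^sub>m s" using mult[of h "inv h"] h one by simp
      have ab: "a g * b h \<in> carrier_mat r s" by (rule mult_carrier_mat[OF abc(1,2)])
      have "b (g \<otimes> h) * c (inv (g \<otimes> h)) * c g = b (g \<otimes> h) * (c (inv (g \<otimes> h)) * c g)"
        by (rule assoc_mult_mat[OF abc(2,3,3)])
      also have "\<dots> = (a g * b h + b g * c h) * c (inv h)" using mult[OF g h] 1 by simp
      also have "\<dots> = a g * b h * c (inv h) + b g * c h * c (inv h)"
        by (rule add_mult_distrib_mat[OF ab bc abc(3)])
      also have "a g * b h * c (inv h) = a g * (b h * c (inv h))"
        by (rule assoc_mult_mat[OF abc(1,2,3)])
      also have "b g * c h * c (inv h) = b g"
        using assoc_mult_mat[OF abc(2,3,3), of g h "inv h"] 2 right_mult_one_mat[OF abc(2)] by simp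
      finally show "b (g \<otimes> h) * c (inv (g \<otimes> h)) * c g = a g * (b h * c (inv h)) + b g" .
    qed
    also have "\<dots> = mat_sum r s (\<lambda>h. a g * (b h * c (inv h))) (carrier G) + ord_c \<cdot>\<^sub>m b g"
      using abc(2)[of g] by (intro eq_matI) (auto simp: sum.distrib)
    also have "mat_sum r s (\<lambda>h. a g * (b h * c (inv h))) (carrier G) = a g * S"
      unfolding S_def by (rule mult_mat_sum[symmetric, OF abc(1) bc])
    finally show ?thesis ..
  qed
  define X where "X = (1 / ord_c) \<cdot>\<^sub>m S"
  have X: "X \<in> carrier_mat r s" using S by (simp add: X_def)
  have aX: "a g * X + b g = X * c g" if g: "g \<in> carrier G" for g
  proof -
    have "X * c g = (1 / ord_c) \<cdot>\<^sub>m (a g * S + ord_c \<cdot>\<^sub>m b g)"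
      unfolding X_def aS[OF g] by (rule mult_smult_assoc_mat[OF S abc(3)])
    also have "\<dots> = (1 / ord_c) \<cdot>\<^sub>m (a g * S) + b g"
      by (rule inverse_smult_add_smult[OF mult_carrier_mat[OF abc(1) S] abc(2)]) (use card_pos in simp)
    also have "(1 / ord_c) \<cdot>\<^sub>m (a g * S) = a g * X"
      unfolding X_def by (rule mult_smult_distrib[symmetric, OF abc(1) S])
    finally show ?thesis ..
  qed
  define U where "U = four_block_mat (1\<^sub>m r) X (0\<^sub>m s r) (1\<^sub>m s)"
  have U: "U \<in> carrier_mat d d" using X by (simp add: U_def drs)
  define D where "D g = four_block_mat (a g) (0\<^sub>m r s) (0\<^sub>m s r) (c g)" for g
  have D: "D g \<in> carrier_mat d d" for g using abc[of g] by (simp add: D_def drs)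
  have \<tau>'U: "\<tau>' g * U = U * D g" if g: "g \<in> carrier G" for g
  proof -
    have 1: "\<tau>' g * U = four_block_mat (a g * 1\<^sub>m r + b g * 0\<^sub>m s r) (a g * X + b g * 1\<^sub>m s)
        (0\<^sub>m s r * 1\<^sub>m r + c g * 0\<^sub>m s r) (0\<^sub>m s r * X + c g * 1\<^sub>m s)"
      unfolding block[OF g] U_def using abc[of g] X
      by (intro mult_four_block_mat[of _ r r _ s _ s _ _ r _ s]) auto
    have 2: "U * D g = four_block_mat (1\<^sub>m r * a g + X * 0\<^sub>m s r) (1\<^sub>m r * 0\<^sub>m r s + X * c g)
        (0\<^sub>m s r * a g + 1\<^sub>m s * 0\<^sub>m s r) (0\<^sub>m s r * 0\<^sub>m r s + 1\<^sub>m s * c g)"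
      unfolding D_def U_def using abc[of g] X
      by (intro mult_four_block_mat[of _ r r _ s _ s _ _ r _ s]) auto
    show ?thesis unfolding 1 2
      using abc[of g] X aX[OF g] mult_carrier_mat[OF X abc(3)[of g]] by simp
  qed
  have act_sum: "act (direct_sum_rep [\<alpha>, \<gamma>]) g = D g" "deg (direct_sum_rep [\<alpha>, \<gamma>]) = d" for g
  proof -
    have "act (direct_sum_rep ([\<alpha>] @ [\<gamma>])) g = four_block_mat (act \<alpha> g) (0\<^sub>m r s) (0\<^sub>m s r) (act \<gamma> g)"
      using act_direct_sum_append[of "[\<alpha>]" g r "[\<gamma>]" s] abc(1,3)[of g]
      unfolding direct_sum_rep_singleton \<alpha>_def \<gamma>_def rep.sel by blast
    then show "act (direct_sum_rep [\<alpha>, \<gamma>]) g = D g"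
      unfolding D_def \<alpha>_def \<gamma>_def rep.sel append.simps .
    show "deg (direct_sum_rep [\<alpha>, \<gamma>]) = d"
      by (simp add: direct_sum_rep_def \<alpha>_def \<gamma>_def drs)
  qed
  \<comment> \<open>\<open>U\<close> carries the block diagonal form to \<open>\<tau>'\<close>, and
    \<open>P\<close> carries \<open>\<tau>'\<close> to \<open>\<tau>\<close>; so
    \<open>P * U\<close> is an equivalence from the direct sum, which symmetry then
    reverses.\<close>
  have "equivalent_rep G (direct_sum_rep [\<alpha>, \<gamma>]) \<tau>"
  proof (rule equivalent_repI[of "P * U"])
    show "invertible_mat (P * U)"
      using invertible_mat_if_det[OF P(1,2)] invertible_upper_unitriangular_block[OF X]
      by (intro invertible_mat_mult[OF P(1) U]) (simp_all add: U_def)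
    fix g assume g: "g \<in> carrier G"
    have "P * U * D g = P * (U * D g)" by (rule assoc_mult_mat[OF P(1) U D])
    also have "\<dots> = P * \<tau>' g * U"
      unfolding \<tau>'U[OF g, symmetric] by (rule assoc_mult_mat[symmetric, OF P(1) \<tau>'c[OF g] U])
    also have "\<dots> = act \<tau> g * (P * U)"
      unfolding P\<tau>'[OF g] by (rule assoc_mult_mat[OF tc[OF g] P(1) U])
    finally show "P * U * act (direct_sum_rep [\<alpha>, \<gamma>]) g = act \<tau> g * (P * U)"
      by (simp only: act_sum)
  qed (use P U in \<open>simp_all add: act_sum flip: d_def\<close>)
  then have "equivalent_rep G \<tau> (direct_sum_rep [\<alpha>, \<gamma>])"
    by (rule equivalent_rep_sym) (use D tc in \<open>simp_all add: act_sum flip: d_def\<close>)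
  with that[OF ra rc] show thesis
    using \<open>0 < r\<close> \<open>r < d\<close> by (simp add: \<alpha>_def \<gamma>_def s_def flip: d_def)
qed

text \<open>Induction on the degree by splitting. Degree 0 is a case of its own, since
  \<open>irreducible_rep\<close> requires a positive degree; there the empty list is the
  decomposition.\<close>

theorem complete_reducibility:
  assumes "representation G \<tau>"
  shows "\<exists>\<sigma>s. (\<forall>\<sigma>\<in>set \<sigma>s. irreducible_rep G \<sigma>) \<and> equivalent_rep G \<tau> (direct_sum_rep \<sigma>s)"
  using assms
proof (induction "deg \<tau>" arbitrary: \<tau> rule: less_induct)
  case less
  note rt = less.prems
  consider "deg \<tau> = 0" | "irreducible_rep G \<tau>" | "deg \<tau> > 0" "\<not> irreducible_rep G \<tau>" by blast
  then show ?case
  proof cases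
    case 1
    have "equivalent_rep G \<tau> (direct_sum_rep [])"
    proof (rule equivalent_repI[of "1\<^sub>m 0"])
      show "invertible_mat (1\<^sub>m 0 :: complex mat)" by (rule invertible_matI[of _ 0 "1\<^sub>m 0"]) auto
      show "1\<^sub>m 0 * act \<tau> g = act (direct_sum_rep []) g * 1\<^sub>m 0" if "g \<in> carrier G" for g
        using rep_carrier[OF rt that] 1 by (intro eq_matI) (auto simp: direct_sum_rep_def)
    qed (use 1 in \<open>simp_all add: direct_sum_rep_def\<close>)
    then show ?thesis by (intro exI[of _ "[]"]) simp
  next
    case 2
    then show ?thesis using equivalent_rep_refl[OF rt]
      by (intro exI[of _ "[\<tau>]"]) (simp add: direct_sum_rep_singleton)
  next
    case 3
    obtain \<alpha> \<gamma> where ac: "representation G \<alpha>" "representation G \<gamma>" "deg \<alpha> < deg \<tau>" "deg \<gamma> < deg \<tau>"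
      "equivalent_rep G \<tau> (direct_sum_rep [\<alpha>, \<gamma>])"
      using reducible_splits[OF rt 3] .
    obtain \<sigma>s where s: "\<forall>\<sigma>\<in>set \<sigma>s. irreducible_rep G \<sigma>" "equivalent_rep G \<alpha> (direct_sum_rep \<sigma>s)"
      using less.hyps[OF ac(3,1)] by blast
    obtain \<rho>s where r: "\<forall>\<sigma>\<in>set \<rho>s. irreducible_rep G \<sigma>" "equivalent_rep G \<gamma> (direct_sum_rep \<rho>s)"
      using less.hyps[OF ac(4,2)] by blast
    define n m where "n = deg \<alpha>" and "m = deg \<gamma>"
    have c: "act \<alpha> g \<in> carrier_mat n n" "act \<gamma> g \<in> carrier_mat m m" if "g \<in> carrier G" for g
      using that ac(1,2) by (auto simp: n_def m_def intro: rep_carrier)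
    obtain P where P: "P \<in> carrier_mat n n" "invertible_mat P" "deg (direct_sum_rep \<sigma>s) = n"
      "\<And>g. g \<in> carrier G \<Longrightarrow> P * act \<alpha> g = act (direct_sum_rep \<sigma>s) g * P"
      using equivalent_repE[OF s(2)] unfolding n_def by metis
    obtain Q where Q: "Q \<in> carrier_mat m m" "invertible_mat Q" "deg (direct_sum_rep \<rho>s) = m"
      "\<And>g. g \<in> carrier G \<Longrightarrow> Q * act \<gamma> g = act (direct_sum_rep \<rho>s) g * Q"
      using equivalent_repE[OF r(2)] unfolding m_def by metis
    have d: "act (direct_sum_rep \<sigma>s) g \<in> carrier_mat n n" "act (direct_sum_rep \<rho>s) g \<in> carrier_mat m m"
      if "g \<in> carrier G" for g
      using direct_sum_carrier[of \<sigma>s g] direct_sum_carrier[of \<rho>s g] s(1) r(1) that P(3) Q(3)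
      by (auto dest: irreducible_rep_carrier)
    have "equivalent_rep G (direct_sum_rep [\<alpha>, \<gamma>]) (direct_sum_rep (\<sigma>s @ \<rho>s))"
    proof (rule equivalent_repI[of "four_block_mat P (0\<^sub>m n m) (0\<^sub>m m n) Q"])
      fix g assume g: "g \<in> carrier G"
      have 1: "act (direct_sum_rep [\<alpha>, \<gamma>]) g = four_block_mat (act \<alpha> g) (0\<^sub>m n m) (0\<^sub>m m n) (act \<gamma> g)"
        using act_direct_sum_append[of "[\<alpha>]" g n "[\<gamma>]" m] c[OF g] by (simp add: direct_sum_rep_singleton)
      show "four_block_mat P (0\<^sub>m n m) (0\<^sub>m m n) Q * act (direct_sum_rep [\<alpha>, \<gamma>]) g =
          act (direct_sum_rep (\<sigma>s @ \<rho>s)) g * four_block_mat P (0\<^sub>m n m) (0\<^sub>m m n) Q"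
        unfolding 1 act_direct_sum_append[OF d[OF g]]
        using c[OF g] d[OF g] P Q g
          mult_carrier_mat[OF P(1) c(1)[OF g]] mult_carrier_mat[OF Q(1) c(2)[OF g]]
        by (simp add: mult_four_block_mat[of _ n n _ m _ m _ _ n _ m])
    qed (use P Q invertible_diag_block[OF P(1,2) Q(1,2)] in
        \<open>simp_all add: direct_sum_rep_def n_def m_def\<close>)
    then have "equivalent_rep G \<tau> (direct_sum_rep (\<sigma>s @ \<rho>s))"
      using s(1) r(1) ac(1,2) by (intro equivalent_rep_trans[OF ac(5)] rep_carrier[OF rt] direct_sum_carrier)
        (auto dest: irreducible_rep_carrier rep_carrier)
    then show ?thesis using s(1) r(1) by (intro exI[of _ "\<sigma>s @ \<rho>s"]) auto
  qed
qed

section \<open>Multiplicities as inner products of characters\<close>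

lemma char_prod_sum_list:
  "char_prod (\<lambda>g. \<Sum>\<sigma>\<leftarrow>\<sigma>s. \<phi> \<sigma> g) \<psi> = (\<Sum>\<sigma>\<leftarrow>\<sigma>s. char_prod (\<phi> \<sigma>) \<psi>)"
  by (induction \<sigma>s) (simp_all add: char_prod_def sum.distrib add_divide_distrib distrib_right)

lemma char_prod_cong:
  assumes "\<And>g. g \<in> carrier G \<Longrightarrow> \<phi> g = \<phi>' g" "\<And>g. g \<in> carrier G \<Longrightarrow> \<psi> g = \<psi>' g"
  shows "char_prod \<phi> \<psi> = char_prod \<phi>' \<psi>'"
  using assms by (simp add: char_prod_def)

lemma character_decomposition:
  assumes rt: "representation G \<tau>" and irr: "\<forall>\<sigma>\<in>set \<sigma>s. irreducible_rep G \<sigma>"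
    and eq: "equivalent_rep G \<tau> (direct_sum_rep \<sigma>s)" and g: "g \<in> carrier G"
  shows "character \<tau> g = (\<Sum>\<sigma>\<leftarrow>\<sigma>s. character \<sigma> g)"
proof -
  have c: "\<forall>\<sigma>\<in>set \<sigma>s. act \<sigma> g \<in> carrier_mat (deg \<sigma>) (deg \<sigma>)"
    using irr g by (auto dest: irreducible_rep_carrier)
  have "character \<tau> g = character (direct_sum_rep \<sigma>s) g"
    by (rule character_equivalent[OF eq g rep_carrier[OF rt g] direct_sum_carrier[OF c]])
  then show ?thesis by (simp add: character_direct_sum[OF c])
qed

text \<open>By orthogonality the count in any decomposition equals an inner product that does not
  mention the decomposition, so all counts agree; together with existence this evaluates the
  definite description.\<close>

lemma multiplicity_rep_eq_char_prod:
  assumes \<sigma>: "irreducible_rep G \<sigma>" and rt: "representation G \<tau>"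
  shows "of_nat (multiplicity_rep G \<sigma> \<tau>) = char_prod (character \<tau>) (character \<sigma>)"
proof -
  have count: "of_nat (length (filter (equivalent_rep G \<sigma>) \<sigma>s)) = char_prod (character \<tau>) (character \<sigma>)"
    if "\<forall>\<rho>\<in>set \<sigma>s. irreducible_rep G \<rho>" "equivalent_rep G \<tau> (direct_sum_rep \<sigma>s)" for \<sigma>s
  proof -
    have "char_prod (character \<tau>) (character \<sigma>) =
        char_prod (\<lambda>g. \<Sum>\<rho>\<leftarrow>\<sigma>s. character \<rho> g) (character \<sigma>)"
      by (rule char_prod_cong) (auto simp: character_decomposition[OF rt that])
    also have "\<dots> = (\<Sum>\<rho>\<leftarrow>\<sigma>s. char_prod (character \<rho>) (character \<sigma>))"
      by (rule char_prod_sum_list)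
    also have "\<dots> = of_nat (length (filter (equivalent_rep G \<sigma>) \<sigma>s))"
      using that(1) by (induction \<sigma>s) (auto simp: char_prod_irreducible \<sigma>)
    finally show ?thesis ..
  qed
  let ?R = "\<lambda>m. \<exists>\<sigma>s. (\<forall>\<sigma>'\<in>set \<sigma>s. irreducible_rep G \<sigma>') \<and>
     equivalent_rep G \<tau> (direct_sum_rep \<sigma>s) \<and> m = length (filter (equivalent_rep G \<sigma>) \<sigma>s)"
  obtain \<sigma>s where s: "\<forall>\<rho>\<in>set \<sigma>s. irreducible_rep G \<rho>" "equivalent_rep G \<tau> (direct_sum_rep \<sigma>s)"
    using complete_reducibility[OF rt] by blast
  have "multiplicity_rep G \<sigma> \<tau> = length (filter (equivalent_rep G \<sigma>) \<sigma>s)"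
    unfolding multiplicity_rep_def
  proof (rule the_equality)
    show "?R (length (filter (equivalent_rep G \<sigma>) \<sigma>s))" using s by blast
    fix m assume "?R m"
    then obtain \<rho>s where r: "\<forall>\<rho>\<in>set \<rho>s. irreducible_rep G \<rho>" "equivalent_rep G \<tau> (direct_sum_rep \<rho>s)"
      "m = length (filter (equivalent_rep G \<sigma>) \<rho>s)" by blast
    have "(of_nat m :: complex) = of_nat (length (filter (equivalent_rep G \<sigma>) \<sigma>s))"
      using count[OF r(1,2)] count[OF s] r(3) by simp
    then show "m = length (filter (equivalent_rep G \<sigma>) \<sigma>s)" by simp
  qed
  then show ?thesis using count[OF s] by simp
qed

subsection \<open>Equivalence classes of irreducible representations\<close>

lemma equiv_irr_equiv: "equiv {\<sigma>. irreducible_rep G \<sigma>} (irr_equiv G)"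
proof (rule equivI)
  show "irr_equiv G \<subseteq> {\<sigma>. irreducible_rep G \<sigma>} \<times> {\<sigma>. irreducible_rep G \<sigma>}" by (auto simp: irr_equiv_def)
  show "refl_on {\<sigma>. irreducible_rep G \<sigma>} (irr_equiv G)"
    by (auto simp: refl_on_def irr_equiv_def irreducible_rep_def intro: equivalent_rep_refl)
  show "sym (irr_equiv G)"
    by (auto simp: sym_def irr_equiv_def intro: equivalent_irreducible_sym)
  show "trans (irr_equiv G)"
    unfolding trans_def irr_equiv_def
    by (auto dest: irreducible_rep_carrier intro: equivalent_rep_trans)
qed

text \<open>The representative is chosen by the same term as in \<open>McKay_adj\<close>, so that
  both unfold to the same expression; on the carrier the values do not depend on the choice.\<close>

definition class_character :: "'a rep set \<Rightarrow> 'a \<Rightarrow> complex" where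
  "class_character X = character (SOME \<sigma>. \<sigma> \<in> X)"

lemma Irr_representative:
  assumes "X \<in> Irr G"
  shows "(SOME \<sigma>. \<sigma> \<in> X) \<in> X" "irreducible_rep G (SOME \<sigma>. \<sigma> \<in> X)"
proof -
  have "X \<noteq> {}" using assms in_quotient_imp_non_empty[OF equiv_irr_equiv] by (auto simp: Irr_def)
  then show 1: "(SOME \<sigma>. \<sigma> \<in> X) \<in> X" using someI_ex[of "\<lambda>\<sigma>. \<sigma> \<in> X"] by blast
  have "X \<subseteq> {\<sigma>. irreducible_rep G \<sigma>}"
    using assms in_quotient_imp_subset[OF equiv_irr_equiv] by (auto simp: Irr_def)
  with 1 show "irreducible_rep G (SOME \<sigma>. \<sigma> \<in> X)" by blast
qed

lemma Irr_eq_iff: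
  assumes "X \<in> Irr G" "Y \<in> Irr G" "\<sigma> \<in> X" "\<tau> \<in> Y"
  shows "equivalent_rep G \<sigma> \<tau> \<longleftrightarrow> X = Y"
proof -
  have "irreducible_rep G \<sigma>" "irreducible_rep G \<tau>"
    using assms in_quotient_imp_subset[OF equiv_irr_equiv] by (auto simp: Irr_def)
  then show ?thesis
    using quotient_eq_iff[OF equiv_irr_equiv, of X Y \<sigma> \<tau>] assms by (auto simp: Irr_def irr_equiv_def)
qed

lemma irreducible_in_Irr:
  assumes "irreducible_rep G \<sigma>"
  obtains X where "X \<in> Irr G" "\<sigma> \<in> X" "\<And>g. g \<in> carrier G \<Longrightarrow> class_character X g = character \<sigma> g"
proof -
  let ?X = "irr_equiv G `` {\<sigma>}"
  have X: "?X \<in> Irr G" using assms by (auto simp: Irr_def intro: quotientI)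
  have s: "\<sigma> \<in> ?X" using equiv_class_self[OF equiv_irr_equiv] assms by auto
  have "equivalent_rep G (SOME \<tau>. \<tau> \<in> ?X) \<sigma>"
    using Irr_eq_iff[OF X X Irr_representative(1)[OF X] s] by simp
  then have "class_character ?X g = character \<sigma> g" if "g \<in> carrier G" for g
    unfolding class_character_def
    using character_equivalent_irreducible[OF Irr_representative(2)[OF X] assms _ that] by blast
  with X s show thesis using that by blast
qed

lemma char_prod_class_character:
  assumes "X \<in> Irr G" "Y \<in> Irr G"
  shows "char_prod (class_character X) (class_character Y) = (if X = Y then 1 else 0)"
  using char_prod_irreducible[OF Irr_representative(2)[OF assms(1)] Irr_representative(2)[OF assms(2)]]
    Irr_eq_iff[OF assms(2,1) Irr_representative(1)[OF assms(2)] Irr_representative(1)[OF assms(1)]]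
  by (auto simp: class_character_def)

text \<open>With more than \<open>|G|\<close> orthogonal characters, the matrices of the values \<open>\<chi>\<^sub>i g\<close> and
  \<open>\<chi>\<^sub>i (g\<^sup>-\<^sup>1) / |G|\<close>, padded with zeros to square matrices, would be inverse to each other although
  one of them has a zero row.\<close>

lemma finite_Irr: "finite (Irr G)"
proof (rule ccontr)
  define N where "N = card (carrier G)"
  \<comment> \<open>One more than the group order, so that \<open>N\<close> is the index of a column
    of \<open>A\<close> and a row of \<open>B\<close> that consist of padding.\<close>
  define k where "k = Suc N"
  assume "infinite (Irr G)"
  then obtain S where S: "S \<subseteq> Irr G" "finite S" "card S = k"
    using infinite_arbitrarily_large[of "Irr G" k] by metis
  obtain e where e: "bij_betw e {0..<k} S"
    using ex_bij_betw_nat_finite[OF S(2)] S(3) by metis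
  obtain f where f: "bij_betw f {0..<N} (carrier G)"
    using ex_bij_betw_nat_finite[OF fin] unfolding N_def by metis
  define A where "A = Matrix.mat k k (\<lambda>(i, j). if j < N then class_character (e i) (f j) else 0)"
  define B where "B = Matrix.mat k k (\<lambda>(j, i). if j < N then class_character (e i) (inv (f j)) / ord_c else 0)"
  have A: "A \<in> carrier_mat k k" and B: "B \<in> carrier_mat k k" by (auto simp: A_def B_def)
  have "A * B = 1\<^sub>m k"
  proof (rule eq_matI)
    fix i l assume "i < dim_row (1\<^sub>m k :: complex mat)" "l < dim_col (1\<^sub>m k :: complex mat)"
    then have il: "i < k" "l < k" by auto
    then have e': "e i \<in> Irr G" "e l \<in> Irr G" using e S(1) by (auto simp: bij_betw_def)
    have "(A * B) $$ (i, l) = (\<Sum>j<k. A $$ (i, j) * B $$ (j, l))"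
      by (rule index_mult_sum[OF A B il])
    also have "\<dots> = (\<Sum>j<N. A $$ (i, j) * B $$ (j, l))"
      using il by (simp add: k_def A_def)
    also have "\<dots> = (\<Sum>j=0..<N. class_character (e i) (f j) * class_character (e l) (inv (f j)) / ord_c)"
      using il by (intro sum.cong) (auto simp: A_def B_def k_def)
    also have "\<dots> = (\<Sum>g\<in>carrier G. class_character (e i) g * class_character (e l) (inv g) / ord_c)"
      by (rule sum.reindex_bij_betw[OF f])
    also have "\<dots> = char_prod (class_character (e i)) (class_character (e l))"
      by (simp add: char_prod_def sum_divide_distrib)
    also have "\<dots> = (if e i = e l then 1 else 0)" by (rule char_prod_class_character[OF e'])
    also have "\<dots> = (1\<^sub>m k :: complex mat) $$ (i, l)"
      using il bij_betw_imp_inj_on[OF e] by (auto simp: inj_on_def)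
    finally show "(A * B) $$ (i, l) = (1\<^sub>m k :: complex mat) $$ (i, l)" .
  qed (use A B in auto)
  \<comment> \<open>The padding to square matrices serves this step, where a right inverse becomes a
    left inverse.\<close>
  then have "B * A = 1\<^sub>m k" by (rule mat_mult_left_right_inverse[OF A B])
  then have "(B * A) $$ (N, N) = 1" by (simp add: k_def)
  moreover have "(B * A) $$ (N, N) = (\<Sum>j<k. B $$ (N, j) * A $$ (j, N))"
    by (rule index_mult_sum[OF B A]) (auto simp: k_def)
  moreover have "\<dots> = 0" by (intro sum.neutral) (auto simp: B_def k_def)
  ultimately show False by simp
qed

text \<open>For an irreducible \<open>\<tau>\<close> orthogonality leaves a single term of the sum;
  both sides are additive over a decomposition into irreducibles.\<close>

lemma character_expansion:
  assumes rt: "representation G \<tau>" and g: "g \<in> carrier G"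
  shows "(\<Sum>X\<in>Irr G. char_prod (character \<tau>) (class_character X) * class_character X g) = character \<tau> g"
proof -
  have irr: "(\<Sum>X\<in>Irr G. char_prod (character \<sigma>) (class_character X) * class_character X g) = character \<sigma> g"
    if \<sigma>: "irreducible_rep G \<sigma>" for \<sigma>
  proof -
    obtain Y where Y: "Y \<in> Irr G" "\<And>g. g \<in> carrier G \<Longrightarrow> class_character Y g = character \<sigma> g"
      using irreducible_in_Irr[OF \<sigma>] by metis
    have "char_prod (character \<sigma>) (class_character X) = (if Y = X then 1 else 0)" if "X \<in> Irr G" for X
      unfolding char_prod_class_character[OF Y(1) that, symmetric] using Y(2) by (intro char_prod_cong) auto
    then have "(\<Sum>X\<in>Irr G. char_prod (character \<sigma>) (class_character X) * class_character X g) =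
        (\<Sum>X\<in>Irr G. if Y = X then class_character X g else 0)"
      by (intro sum.cong) auto
    then show ?thesis using Y finite_Irr g by simp
  qed
  obtain \<sigma>s where s: "\<forall>\<sigma>\<in>set \<sigma>s. irreducible_rep G \<sigma>" "equivalent_rep G \<tau> (direct_sum_rep \<sigma>s)"
    using complete_reducibility[OF rt] by blast
  have "char_prod (character \<tau>) \<psi> = (\<Sum>\<sigma>\<leftarrow>\<sigma>s. char_prod (character \<sigma>) \<psi>)" for \<psi>
    unfolding char_prod_sum_list[symmetric]
    by (rule char_prod_cong) (auto simp: character_decomposition[OF rt s])
  then have "(\<Sum>X\<in>Irr G. char_prod (character \<tau>) (class_character X) * class_character X g) =
      (\<Sum>X\<in>Irr G. (\<Sum>\<sigma>\<leftarrow>\<sigma>s. char_prod (character \<sigma>) (class_character X)) * class_character X g)"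
    by simp
  also have "\<dots> = (\<Sum>\<sigma>\<leftarrow>\<sigma>s. character \<sigma> g)"
    using s(1) by (induction \<sigma>s) (simp_all add: distrib_right sum.distrib irr)
  finally show ?thesis by (simp add: character_decomposition[OF rt s g])
qed

section \<open>Tensor products and the trivial representation\<close>

lemma representation_tensor:
  assumes r: "representation G \<rho>" and s: "representation G \<sigma>"
  shows "representation G (tensor_rep \<rho> \<sigma>)"
proof (rule representationI)
  fix g h assume g: "g \<in> carrier G" and h: "h \<in> carrier G"
  show "act (tensor_rep \<rho> \<sigma>) (g \<otimes> h) = act (tensor_rep \<rho> \<sigma>) g * act (tensor_rep \<rho> \<sigma>) h"
    by (simp add: tensor_rep_def rep_mult[OF r g h] rep_mult[OF s g h]
        mult_kronecker[OF rep_carrier[OF r g] rep_carrier[OF s g] rep_carrier[OF r h] rep_carrier[OF s h]])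
qed (auto simp: tensor_rep_def kronecker_one rep_one[OF r] rep_one[OF s] is_group
    intro: kronecker_carrier rep_carrier[OF r] rep_carrier[OF s])

lemma character_tensor:
  assumes "representation G \<rho>" "representation G \<sigma>" "g \<in> carrier G"
  shows "character (tensor_rep \<rho> \<sigma>) g = character \<rho> g * character \<sigma> g"
  using mat_trace_kronecker[OF rep_carrier[OF assms(1,3)] rep_carrier[OF assms(2,3)]]
  by (simp add: character_def tensor_rep_def)

lemma irreducible_trivial: "irreducible_rep G trivial_rep"
  unfolding irreducible_rep_def
proof (intro conjI allI impI)
  show "representation G trivial_rep"
    by (rule representationI) (auto simp: trivial_rep_def is_group)
  show "deg trivial_rep > 0" by (simp add: trivial_rep_def)
  fix W assume "invariant_subspace G trivial_rep W"
  then have "VectorSpace.subspace class_ring W (module_vec TYPE(complex) 1)"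
    by (simp add: invariant_subspace_def trivial_rep_def)
  note W = this[unfolded subspace_module_vec_iff]
  have "carrier_vec 1 \<subseteq> W" if w: "w \<in> W" "w \<noteq> 0\<^sub>v 1" for w
  proof
    fix v :: "complex Matrix.vec" assume v: "v \<in> carrier_vec 1"
    have wc: "w \<in> carrier_vec 1" using W w by auto
    have "w $ 0 \<noteq> 0" using wc w by (auto simp: Matrix.vec_eq_iff)
    then have "v = (v $ 0 / w $ 0) \<cdot>\<^sub>v w" using v wc by (intro eq_vecI) auto
    then show "v \<in> W" using W w by metis
  qed
  then show "W = {0\<^sub>v (deg trivial_rep)} \<or> W = carrier_vec (deg trivial_rep)"
    using W by (auto simp: trivial_rep_def)
qed

lemma trivial_class_in_Irr: "trivial_class G \<in> Irr G"
  using irreducible_trivial by (auto simp: trivial_class_def Irr_def intro: quotientI)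

lemma class_character_trivial:
  assumes "g \<in> carrier G"
  shows "class_character (trivial_class G) g = 1"
proof -
  have "trivial_rep \<in> trivial_class G"
    using equiv_class_self[OF equiv_irr_equiv] irreducible_trivial by (auto simp: trivial_class_def)
  then have "equivalent_rep G (SOME \<tau>. \<tau> \<in> trivial_class G) trivial_rep"
    using Irr_eq_iff[OF trivial_class_in_Irr trivial_class_in_Irr Irr_representative(1)[OF trivial_class_in_Irr]]
    by simp
  then have "class_character (trivial_class G) g = character trivial_rep g"
    unfolding class_character_def
    by (rule character_equivalent_irreducible[OF Irr_representative(2)[OF trivial_class_in_Irr] irreducible_trivial _ assms])
  then show ?thesis by (simp add: character_def trivial_rep_def mat_trace_def)
qed

text \<open>The mean of a character is its inner product with the trivial character. This is the
  base case of the induction on powers of the adjacency matrix.\<close>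

lemma average_class_character:
  assumes "X \<in> Irr G"
  shows "(\<Sum>g\<in>carrier G. class_character X g) / ord_c = basis_vector (trivial_class G) X"
proof -
  have "(\<Sum>g\<in>carrier G. class_character X g) / ord_c = char_prod (class_character X) (class_character (trivial_class G))"
    by (simp add: char_prod_def class_character_trivial)
  then show ?thesis
    using char_prod_class_character[OF assms trivial_class_in_Irr] by (simp add: basis_vector_def)
qed

end

subsection \<open>Moments of the McKay graph\<close>

locale finite_subgroup_SU3 =
  fixes \<Gamma> :: "complex mat set"
  assumes group_grp: "group (grp \<Gamma>)" and finite_carrier: "finite \<Gamma>" and subset: "\<Gamma> \<subseteq> carrier SU3"
begin

lemma grp_simps [simp]:
  "carrier (grp \<Gamma>) = \<Gamma>" "mult (grp \<Gamma>) = (*)" "one (grp \<Gamma>) = 1\<^sub>m 3"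
  by (simp_all add: grp_def SU3_def)

sublocale finite_group "grp \<Gamma>"
  by (rule finite_group.intro) (simp_all add: group_grp finite_group_axioms_def finite_carrier)

lemma element_carrier: "g \<in> \<Gamma> \<Longrightarrow> g \<in> carrier_mat 3 3"
  using subset by (auto simp: SU3_def)

lemma representation_inclusion: "representation (grp \<Gamma>) inclusion_rep"
  by (rule representationI) (auto simp: inclusion_rep_def element_carrier group_grp)

text \<open>Tensoring with the conjugate of the inclusion is adjoint to tensoring with the
  inclusion; its character supplies the eigenvalues of the adjoint matrix.\<close>

definition conjugate_rep :: "complex mat rep" where
  "conjugate_rep = Rep 3 (map_mat cnj)"

lemma representation_conjugate: "representation (grp \<Gamma>) conjugate_rep"
proof (rule representationI)
  fix g h assume "g \<in> carrier (grp \<Gamma>)" "h \<in> carrier (grp \<Gamma>)"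
  then have c: "g \<in> carrier_mat 3 3" "h \<in> carrier_mat 3 3" by (auto simp: element_carrier)
  then have c': "map_mat cnj g \<in> carrier_mat 3 3" "map_mat cnj h \<in> carrier_mat 3 3" by auto
  have "map_mat cnj (g * h) = map_mat cnj g * map_mat cnj h"
  proof (rule eq_matI)
    fix i j assume "i < dim_row (map_mat cnj g * map_mat cnj h)" "j < dim_col (map_mat cnj g * map_mat cnj h)"
    then have ij: "i < 3" "j < 3" using c by auto
    have "map_mat cnj (g * h) $$ (i, j) = cnj ((g * h) $$ (i, j))" using ij c by simp
    also have "\<dots> = (\<Sum>k<3. cnj (g $$ (i, k)) * cnj (h $$ (k, j)))"
      unfolding index_mult_sum[OF c ij] by simp
    also have "\<dots> = (map_mat cnj g * map_mat cnj h) $$ (i, j)"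
      unfolding index_mult_sum[OF c' ij] by (intro sum.cong refl) (use ij c in auto)
    finally show "map_mat cnj (g * h) $$ (i, j) = (map_mat cnj g * map_mat cnj h) $$ (i, j)" .
  qed (use c in auto)
  then show "act conjugate_rep (g \<otimes>\<^bsub>grp \<Gamma>\<^esub> h) = act conjugate_rep g * act conjugate_rep h"
    by (simp add: conjugate_rep_def)
next
  show "act conjugate_rep \<one>\<^bsub>grp \<Gamma>\<^esub> = 1\<^sub>m (deg conjugate_rep)"
    by (intro eq_matI) (auto simp: conjugate_rep_def)
qed (auto simp: conjugate_rep_def element_carrier group_grp)

lemma character_conjugate: "g \<in> \<Gamma> \<Longrightarrow> character conjugate_rep g = cnj (mat_trace g)"
  using element_carrier[of g] by (auto simp: character_def conjugate_rep_def mat_trace_def)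

text \<open>The inverse of a unitary matrix is its adjoint; this is how the inclusion in
  \<open>SU3\<close> enters.\<close>

lemma mat_trace_inv:
  assumes g: "g \<in> \<Gamma>"
  shows "mat_trace (inv\<^bsub>grp \<Gamma>\<^esub> g) = cnj (mat_trace g)"
proof -
  have gi: "inv\<^bsub>grp \<Gamma>\<^esub> g \<in> \<Gamma>" "g * inv\<^bsub>grp \<Gamma>\<^esub> g = 1\<^sub>m 3"
    using group.inv_closed[OF group_grp, of g] group.r_inv[OF group_grp, of g] g by auto
  have c: "g \<in> carrier_mat 3 3" "inv\<^bsub>grp \<Gamma>\<^esub> g \<in> carrier_mat 3 3"
    using g gi by (auto simp: element_carrier)
  have adj: "mat_adjoint g \<in> carrier_mat 3 3" using c by (auto simp: mat_adjoint_def)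
  have "mat_adjoint g * g = 1\<^sub>m 3" using subset g by (auto simp: SU3_def)
  then have "inv\<^bsub>grp \<Gamma>\<^esub> g = mat_adjoint g * g * inv\<^bsub>grp \<Gamma>\<^esub> g" using c by simp
  also have "\<dots> = mat_adjoint g" using assoc_mult_mat[OF adj c] gi(2) adj by simp
  finally show ?thesis using c by (auto simp: mat_trace_def mat_adjoint_def mat_of_rows_def)
qed

lemma character_inclusion: "character inclusion_rep g = mat_trace g"
  by (simp add: character_def inclusion_rep_def)

lemma McKay_adj_eq:
  assumes "X \<in> Irr (grp \<Gamma>)" "Y \<in> Irr (grp \<Gamma>)"
  shows "McKay_adj \<Gamma> X Y = char_prod (\<lambda>g. mat_trace g * class_character X g) (class_character Y)"
proof -
  let ?\<sigma> = "SOME \<sigma>. \<sigma> \<in> X"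
  have rs: "representation (grp \<Gamma>) ?\<sigma>"
    using Irr_representative(2)[OF assms(1)] by (simp add: irreducible_rep_def)
  have "McKay_adj \<Gamma> X Y = char_prod (character (tensor_rep inclusion_rep ?\<sigma>)) (class_character Y)"
    unfolding McKay_adj_def class_character_def
    by (rule multiplicity_rep_eq_char_prod[OF Irr_representative(2)[OF assms(2)]
          representation_tensor[OF representation_inclusion rs]])
  also have "\<dots> = char_prod (\<lambda>g. mat_trace g * class_character X g) (class_character Y)"
    by (rule char_prod_cong)
       (simp_all add: character_tensor[OF representation_inclusion rs] class_character_def character_inclusion)
  finally show ?thesis .
qed

text \<open>Common form of the two eigenvector equations: \<open>\<rho>\<close> is the inclusion for
  the McKay matrix and its conjugate for the adjoint.\<close>

lemma expansion_tensor_class: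
  assumes r: "representation (grp \<Gamma>) \<rho>" and X: "X \<in> Irr (grp \<Gamma>)" and g: "g \<in> \<Gamma>"
  shows "(\<Sum>Y\<in>Irr (grp \<Gamma>). char_prod (\<lambda>h. character \<rho> h * class_character X h) (class_character Y) *
      class_character Y g) = character \<rho> g * class_character X g"
proof -
  let ?\<sigma> = "SOME \<sigma>. \<sigma> \<in> X"
  have rs: "representation (grp \<Gamma>) ?\<sigma>"
    using Irr_representative(2)[OF X] by (simp add: irreducible_rep_def)
  have t: "character (tensor_rep \<rho> ?\<sigma>) h = character \<rho> h * class_character X h" if "h \<in> \<Gamma>" for h
    using character_tensor[OF r rs] that by (simp add: class_character_def)
  have "char_prod (\<lambda>h. character \<rho> h * class_character X h) \<psi> = char_prod (character (tensor_rep \<rho> ?\<sigma>)) \<psi>" for \<psi>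
    by (rule char_prod_cong) (auto simp: t)
  then show ?thesis
    using character_expansion[OF representation_tensor[OF r rs], of g] g by (simp add: t)
qed

lemma McKay_adj_eigenvector:
  assumes X: "X \<in> Irr (grp \<Gamma>)" and g: "g \<in> \<Gamma>"
  shows "(\<Sum>Y\<in>Irr (grp \<Gamma>). McKay_adj \<Gamma> X Y * class_character Y g) = mat_trace g * class_character X g"
  using expansion_tensor_class[OF representation_inclusion X g]
  by (simp add: McKay_adj_eq[OF X] character_inclusion)

text \<open>The entries are natural numbers, so the adjoint is the transpose. Replacing
  \<open>h\<close> by its inverse in the sum exchanges the roles of \<open>X\<close> and
  \<open>Y\<close> and conjugates the trace.\<close>

lemma McKay_adjoint_eigenvector:
  assumes X: "X \<in> Irr (grp \<Gamma>)" and g: "g \<in> \<Gamma>"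
  shows "(\<Sum>Y\<in>Irr (grp \<Gamma>). adjoint_matrix (McKay_adj \<Gamma>) X Y * class_character Y g) =
    cnj (mat_trace g) * class_character X g"
proof -
  have "adjoint_matrix (McKay_adj \<Gamma>) X Y =
      char_prod (\<lambda>h. character conjugate_rep h * class_character X h) (class_character Y)"
    if Y: "Y \<in> Irr (grp \<Gamma>)" for Y
  proof -
    let ?f = "\<lambda>h. mat_trace h * class_character Y h * class_character X (inv\<^bsub>grp \<Gamma>\<^esub> h)"
    have "adjoint_matrix (McKay_adj \<Gamma>) X Y = McKay_adj \<Gamma> Y X"
      by (simp add: adjoint_matrix_def McKay_adj_def)
    also have "\<dots> = (\<Sum>h\<in>\<Gamma>. ?f h) / of_nat (card \<Gamma>)"
      by (simp add: McKay_adj_eq[OF Y X] char_prod_def)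
    also have "(\<Sum>h\<in>\<Gamma>. ?f h) = (\<Sum>h\<in>\<Gamma>. ?f (inv\<^bsub>grp \<Gamma>\<^esub> h))"
      using sum_inv[of ?f] by simp
    also have "\<dots> = (\<Sum>h\<in>\<Gamma>. character conjugate_rep h * class_character X h * class_character Y (inv\<^bsub>grp \<Gamma>\<^esub> h))"
      by (rule sum.cong) (use inv_inv in \<open>auto simp: mat_trace_inv character_conjugate\<close>)
    finally show ?thesis by (simp add: char_prod_def)
  qed
  then show ?thesis
    using expansion_tensor_class[OF representation_conjugate X g] character_conjugate[OF g] by simp
qed

theorem McKay_moment_eq:
  "McKay_moment \<Gamma> m1 m2 = (\<Sum>g\<in>\<Gamma>. mat_trace g ^ m1 * cnj (mat_trace g) ^ m2) / of_nat (card \<Gamma>)"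
proof -
  define V where "V = Irr (grp \<Gamma>)"
  define e1 where "e1 = basis_vector (trivial_class (grp \<Gamma>))"
  \<comment> \<open>Invariant of the iteration: an average of the character vectors with
    coefficients \<open>c g\<close> is mapped to another one, each coefficient being multiplied by
    the eigenvalue \<open>w g\<close>.\<close>
  have step: "apply_matrix V M v X = (\<Sum>g\<in>\<Gamma>. (w g * c g) * class_character X g) / of_nat (card \<Gamma>)"
    if eig: "\<And>X g. X \<in> V \<Longrightarrow> g \<in> \<Gamma> \<Longrightarrow> (\<Sum>Y\<in>V. M X Y * class_character Y g) = w g * class_character X g"
      and v: "\<And>X. X \<in> V \<Longrightarrow> v X = (\<Sum>g\<in>\<Gamma>. c g * class_character X g) / of_nat (card \<Gamma>)"
      and X: "X \<in> V" for M v X w c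
  proof -
    have "apply_matrix V M v X = (\<Sum>Y\<in>V. \<Sum>g\<in>\<Gamma>. c g * (M X Y * class_character Y g) / of_nat (card \<Gamma>))"
      unfolding apply_matrix_def
      by (intro sum.cong refl) (simp add: v sum_distrib_left sum_divide_distrib mult_ac)
    also have "\<dots> = (\<Sum>g\<in>\<Gamma>. \<Sum>Y\<in>V. c g * (M X Y * class_character Y g) / of_nat (card \<Gamma>))"
      by (rule sum.swap)
    also have "\<dots> = (\<Sum>g\<in>\<Gamma>. c g * (w g * class_character X g) / of_nat (card \<Gamma>))"
      by (intro sum.cong refl) (simp add: eig[OF X, symmetric] sum_distrib_left sum_divide_distrib)
    finally show ?thesis by (simp add: sum_divide_distrib mult_ac)
  qed
  have adj: "(apply_matrix V (adjoint_matrix (McKay_adj \<Gamma>)) ^^ m) e1 X =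
      (\<Sum>g\<in>\<Gamma>. cnj (mat_trace g) ^ m * class_character X g) / of_nat (card \<Gamma>)" if "X \<in> V" for m X
    using that
  proof (induction m arbitrary: X)
    case 0
    then show ?case using average_class_character[of X] by (simp add: V_def e1_def)
  next
    case (Suc m)
    show ?case
      using step[OF McKay_adjoint_eigenvector[folded V_def] Suc.IH Suc.prems] by simp
  qed
  have all: "(apply_matrix V (McKay_adj \<Gamma>) ^^ m) ((apply_matrix V (adjoint_matrix (McKay_adj \<Gamma>)) ^^ m2) e1) X =
      (\<Sum>g\<in>\<Gamma>. (mat_trace g ^ m * cnj (mat_trace g) ^ m2) * class_character X g) / of_nat (card \<Gamma>)"
    if "X \<in> V" for m X
    using that
  proof (induction m arbitrary: X)
    case 0
    then show ?case by (simp add: adj)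
  next
    case (Suc m)
    show ?case
      using step[OF McKay_adj_eigenvector[folded V_def] Suc.IH Suc.prems] by (simp add: mult_ac)
  qed
  have triv: "trivial_class (grp \<Gamma>) \<in> V" using trivial_class_in_Irr by (simp add: V_def)
  \<comment> \<open>Pairing with \<open>e1\<close> reads off the component at the trivial class,
    where all character values are 1.\<close>
  have "inner_prod_on V u e1 = u (trivial_class (grp \<Gamma>))" for u
  proof -
    have "inner_prod_on V u e1 = (\<Sum>X\<in>V. if X = trivial_class (grp \<Gamma>) then u X else 0)"
      unfolding inner_prod_on_def by (intro sum.cong) (auto simp: e1_def basis_vector_def)
    then show ?thesis using triv finite_Irr by (simp add: V_def)
  qed
  then have "McKay_moment \<Gamma> m1 m2 = (apply_matrix V (McKay_adj \<Gamma>) ^^ m1)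
      ((apply_matrix V (adjoint_matrix (McKay_adj \<Gamma>)) ^^ m2) e1) (trivial_class (grp \<Gamma>))"
    by (simp add: McKay_moment_def McKay_vertices_def V_def e1_def Let_def)
  also have "\<dots> = (\<Sum>g\<in>\<Gamma>. (mat_trace g ^ m1 * cnj (mat_trace g) ^ m2) *
      class_character (trivial_class (grp \<Gamma>)) g) / of_nat (card \<Gamma>)"
    by (rule all[OF triv])
  also have "(\<Sum>g\<in>\<Gamma>. (mat_trace g ^ m1 * cnj (mat_trace g) ^ m2) * class_character (trivial_class (grp \<Gamma>)) g) =
      (\<Sum>g\<in>\<Gamma>. mat_trace g ^ m1 * cnj (mat_trace g) ^ m2)"
    by (intro sum.cong refl) (simp add: class_character_trivial)
  finally show ?thesis .
qed

end

section \<open>The trihedral groups\<close>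

lemma mat_adjoint_carrier: "A \<in> carrier_mat n m \<Longrightarrow> mat_adjoint A \<in> carrier_mat m n"
  by (auto simp: mat_adjoint_def)

lemma index_mat_adjoint:
  fixes A :: "complex mat"
  assumes "A \<in> carrier_mat n m" "i < m" "j < n"
  shows "mat_adjoint A $$ (i, j) = cnj (A $$ (j, i))"
  using assms by (auto simp: mat_adjoint_def mat_of_rows_def)

lemma mat_adjoint_adjoint:
  fixes A :: "complex mat"
  assumes "A \<in> carrier_mat n m"
  shows "mat_adjoint (mat_adjoint A) = A"
  using assms mat_adjoint_carrier[OF assms] mat_adjoint_carrier[OF mat_adjoint_carrier[OF assms]]
  by (intro eq_matI) (auto simp: index_mat_adjoint[of A n m] index_mat_adjoint[of "mat_adjoint A" m n])

lemma mat_adjoint_mult: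
  fixes A B :: "complex mat"
  assumes A: "A \<in> carrier_mat n m" and B: "B \<in> carrier_mat m p"
  shows "mat_adjoint (A * B) = mat_adjoint B * mat_adjoint A"
proof (rule eq_matI)
  have AB: "A * B \<in> carrier_mat n p" using A B by simp
  note A' = mat_adjoint_carrier[OF A] and B' = mat_adjoint_carrier[OF B]
  fix i j assume "i < dim_row (mat_adjoint B * mat_adjoint A)" "j < dim_col (mat_adjoint B * mat_adjoint A)"
  then have ij: "i < p" "j < n" using A' B' by auto
  show "mat_adjoint (A * B) $$ (i, j) = (mat_adjoint B * mat_adjoint A) $$ (i, j)"
    unfolding index_mat_adjoint[OF AB ij] index_mult_sum[OF A B ij(2,1)] index_mult_sum[OF B' A' ij]
    using ij by (auto simp: index_mat_adjoint[OF A] index_mat_adjoint[OF B] mult.commute intro!: sum.cong)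
qed (use mat_adjoint_carrier[OF A] mat_adjoint_carrier[OF B] mat_adjoint_carrier[of "A * B" n p] A B in auto)

lemma SU3_simps: "mult SU3 = (*)" "one SU3 = 1\<^sub>m 3"
  by (simp_all add: SU3_def)

lemma group_SU3: "group SU3"
proof (rule groupI)
  fix A B assume "A \<in> carrier SU3" "B \<in> carrier SU3"
  then have A: "A \<in> carrier_mat 3 3" "mat_adjoint A * A = 1\<^sub>m 3" "det A = 1"
    and B: "B \<in> carrier_mat 3 3" "mat_adjoint B * B = 1\<^sub>m 3" "det B = 1"
    by (auto simp: SU3_def)
  note A' = mat_adjoint_carrier[OF A(1)] and B' = mat_adjoint_carrier[OF B(1)]
  have "mat_adjoint (A * B) * (A * B) = mat_adjoint B * (mat_adjoint A * (A * B))"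
    unfolding mat_adjoint_mult[OF A(1) B(1)] by (rule assoc_mult_mat[OF B' A']) (use A B in auto)
  also have "mat_adjoint A * (A * B) = mat_adjoint A * A * B" using assoc_mult_mat[OF A' A(1) B(1)] ..
  finally have "mat_adjoint (A * B) * (A * B) = 1\<^sub>m 3" using A B by simp
  then show "A \<otimes>\<^bsub>SU3\<^esub> B \<in> carrier SU3" using A B det_mult[OF A(1) B(1)] by (simp add: SU3_def)
next
  show "\<one>\<^bsub>SU3\<^esub> \<in> carrier SU3"
  proof -
    have "mat_adjoint (1\<^sub>m 3) = (1\<^sub>m 3 :: complex mat)"
      using mat_adjoint_carrier[of "1\<^sub>m 3 :: complex mat" 3 3]
      by (intro eq_matI) (auto simp: index_mat_adjoint[of _ 3 3])
    then show ?thesis by (simp add: SU3_def)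
  qed
next
  fix A B C assume "A \<in> carrier SU3" "B \<in> carrier SU3" "C \<in> carrier SU3"
  then show "A \<otimes>\<^bsub>SU3\<^esub> B \<otimes>\<^bsub>SU3\<^esub> C = A \<otimes>\<^bsub>SU3\<^esub> (B \<otimes>\<^bsub>SU3\<^esub> C)"
    by (auto simp: SU3_def intro!: assoc_mult_mat[of _ 3 3 _ 3 _ 3])
next
  fix A assume "A \<in> carrier SU3"
  then have A: "A \<in> carrier_mat 3 3" "mat_adjoint A * A = 1\<^sub>m 3" "det A = 1" by (auto simp: SU3_def)
  note A' = mat_adjoint_carrier[OF A(1)]
  \<comment> \<open>Unitarity of the adjoint is the unitarity equation of \<open>A\<close> with the
    factors in the other order.\<close>
  have "A * mat_adjoint A = 1\<^sub>m 3" by (rule mat_mult_left_right_inverse[OF A' A(1,2)])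
  moreover have "det (mat_adjoint A) = 1" using det_mult[OF A' A(1)] A by simp
  ultimately have "mat_adjoint A \<in> carrier SU3"
    using A' by (simp add: SU3_def mat_adjoint_adjoint[OF A(1)])
  then show "\<exists>B\<in>carrier SU3. B \<otimes>\<^bsub>SU3\<^esub> A = \<one>\<^bsub>SU3\<^esub>"
    using A(2) by (auto simp: SU3_def)
qed (auto simp: SU3_def)

subsection \<open>Monomial matrices\<close>

text \<open>This is \<open>mat_diag 3 t\<close> times the \<open>k\<close>-th power of
  \<open>cyclic_T\<close>. The exponent is not reduced modulo 3, so that exponents simply add in
  products.\<close>

definition monomial :: "nat \<Rightarrow> (nat \<Rightarrow> complex) \<Rightarrow> complex mat" where
  "monomial k t = Matrix.mat 3 3 (\<lambda>(i, j). if j = (i + k) mod 3 then t i else 0)"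

lemma monomial_carrier [simp]: "monomial k t \<in> carrier_mat 3 3"
  by (simp add: monomial_def)

text \<open>The semidirect product law: moving a power of \<open>cyclic_T\<close> past the second
  diagonal factor shifts the entries of that factor cyclically.\<close>

lemma monomial_mult: "monomial k s * monomial l t = monomial (k + l) (\<lambda>i. s i * t ((i + k) mod 3))"
proof (rule eq_matI)
  fix i j assume "i < dim_row (monomial (k + l) (\<lambda>i. s i * t ((i + k) mod 3)))"
    "j < dim_col (monomial (k + l) (\<lambda>i. s i * t ((i + k) mod 3)))"
  then have ij: "i < 3" "j < 3" by (auto simp: monomial_def)
  have "(monomial k s * monomial l t) $$ (i, j) =
      (\<Sum>a<3. if a = (i + k) mod 3 then s i * monomial l t $$ (a, j) else 0)"
    unfolding index_mult_sum[OF monomial_carrier monomial_carrier ij]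
    by (intro sum.cong) (use ij in \<open>auto simp: monomial_def[of k]\<close>)
  also have "\<dots> = s i * monomial l t $$ ((i + k) mod 3, j)" by simp
  also have "\<dots> = monomial (k + l) (\<lambda>i. s i * t ((i + k) mod 3)) $$ (i, j)"
    using ij by (simp add: monomial_def mod_add_left_eq add.assoc)
  finally show "(monomial k s * monomial l t) $$ (i, j) =
    monomial (k + l) (\<lambda>i. s i * t ((i + k) mod 3)) $$ (i, j)" .
qed (simp_all add: monomial_def)

lemma monomial_mod: "monomial (k mod 3) t = monomial k t"
  by (simp add: monomial_def mod_add_right_eq)

lemma monomial_cong: "(\<And>i. i < 3 \<Longrightarrow> s i = t i) \<Longrightarrow> monomial k s = monomial k t"
  by (rule eq_matI) (auto simp: monomial_def)

lemma mat_diag_eq_monomial: "mat_diag 3 t = monomial 0 t"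
  by (rule eq_matI) (auto simp: monomial_def mat_diag_def)

lemma less_3_cases: "(i :: nat) < 3 \<longleftrightarrow> i = 0 \<or> i = 1 \<or> i = 2"
  by auto

text \<open>Each case also rewrites shifted indices, so that after the split every index modulo 3
  can be computed.\<close>

lemma residue_mod_3:
  fixes k :: nat
  obtains "k mod 3 = 0" "\<And>i. (i + k) mod 3 = i mod 3"
    | "k mod 3 = 1" "\<And>i. (i + k) mod 3 = (i + 1) mod 3"
    | "k mod 3 = 2" "\<And>i. (i + k) mod 3 = (i + 2) mod 3"
proof -
  have "(i + k) mod 3 = (i + k mod 3) mod 3" for i by (simp only: mod_add_right_eq)
  moreover have "k mod 3 = 0 \<or> k mod 3 = 1 \<or> k mod 3 = 2" using less_3_cases[of "k mod 3"] by simp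
  ultimately show thesis using that by (metis add_0_right)
qed

lemma cyclic_T_eq_monomial: "cyclic_T = monomial 1 (\<lambda>_. 1)"
  by (rule eq_matI)
     (auto simp: monomial_def cyclic_T_def mat_of_rows_list_def less_3_cases)

lemma mat_trace_monomial:
  "mat_trace (monomial k t) = (if k mod 3 = 0 then t 0 + t 1 + t 2 else 0)"
proof -
  have "mat_trace (monomial k t) = (\<Sum>i<3. if i = (i + k) mod 3 then t i else 0)"
    by (simp add: mat_trace_def monomial_def)
  also have "\<dots> = (\<Sum>i<3. if k mod 3 = 0 then t i else 0)"
  proof (rule sum.cong[OF refl])
    fix i :: nat assume "i \<in> {..<3}"
    then have "i = (i + k) mod 3 \<longleftrightarrow> k mod 3 = 0"
      by (cases k rule: residue_mod_3) (auto simp: less_3_cases)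
    then show "(if i = (i + k) mod 3 then t i else 0) = (if k mod 3 = 0 then t i else 0)" by simp
  qed
  also have "{..<3} = {0, 1, 2 :: nat}" by auto
  finally show ?thesis by (simp add: add.assoc)
qed

lemma det_mat_diag_3: "det (mat_diag 3 t) = t 0 * t 1 * (t 2 :: complex)"
proof -
  have "det (mat_diag 3 t) = prod_list (diag_mat (mat_diag 3 t))"
    by (rule det_upper_triangular[of _ 3]) (auto simp: upper_triangular_def mat_diag_def)
  also have "diag_mat (mat_diag 3 t) = [t 0, t 1, t 2]"
    by (simp add: diag_mat_def mat_diag_def eval_nat_numeral upt_rec)
  finally show ?thesis by simp
qed

lemma monomial_one: "monomial 0 (\<lambda>_. 1) = 1\<^sub>m 3"
  by (simp flip: mat_diag_eq_monomial)

lemma mat_adjoint_monomial_mult: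
  assumes "\<And>i. i < 3 \<Longrightarrow> norm (t i) = 1"
  shows "mat_adjoint (monomial k t) * monomial k t = 1\<^sub>m 3"
proof -
  \<comment> \<open>\<open>3 - k mod 3\<close> lies between 1 and 3, so the subtraction is not
    truncated; it represents the exponent \<open>- k\<close> modulo 3.\<close>
  have "mat_adjoint (monomial k t) = monomial (3 - k mod 3) (\<lambda>i. cnj (t ((i + (3 - k mod 3)) mod 3)))"
  proof (rule eq_matI)
    fix i j assume "i < dim_row (monomial (3 - k mod 3) (\<lambda>i. cnj (t ((i + (3 - k mod 3)) mod 3))))"
      "j < dim_col (monomial (3 - k mod 3) (\<lambda>i. cnj (t ((i + (3 - k mod 3)) mod 3))))"
    then have ij: "i < 3" "j < 3" by (auto simp: monomial_def)
    have "i = 0 \<or> i = 1 \<or> i = 2" "j = 0 \<or> j = 1 \<or> j = 2" using ij by auto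
    then have "i = (j + k) mod 3 \<longleftrightarrow> j = (i + (3 - k mod 3)) mod 3"
      by (cases k rule: residue_mod_3; elim disjE) (simp_all only:, simp_all)
    then show "mat_adjoint (monomial k t) $$ (i, j) =
        monomial (3 - k mod 3) (\<lambda>i. cnj (t ((i + (3 - k mod 3)) mod 3))) $$ (i, j)"
      unfolding index_mat_adjoint[OF monomial_carrier ij] using ij by (auto simp: monomial_def)
  qed (use mat_adjoint_carrier[of "monomial k t" 3 3] in \<open>auto simp: monomial_def\<close>)
  then have "mat_adjoint (monomial k t) * monomial k t = monomial (3 - k mod 3 + k)
      (\<lambda>i. cnj (t ((i + (3 - k mod 3)) mod 3)) * t ((i + (3 - k mod 3)) mod 3))"
    by (simp add: monomial_mult)
  also have "\<dots> = monomial (3 - k mod 3 + k) (\<lambda>_. 1)"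
  proof (rule monomial_cong)
    fix i :: nat
    have "cnj z * z = 1" if "norm z = 1" for z :: complex
      using that complex_norm_square[of z] by (simp add: mult.commute)
    then show "cnj (t ((i + (3 - k mod 3)) mod 3)) * t ((i + (3 - k mod 3)) mod 3) = 1"
      using assms by simp
  qed
  also have "\<dots> = monomial ((3 - k mod 3 + k) mod 3) (\<lambda>_. 1)" by (rule monomial_mod[symmetric])
  also have "(3 - k mod 3 + k) mod 3 = 0"
  proof (cases k rule: residue_mod_3)
    case 2
    then show ?thesis using 2(2)[of 2] by simp
  next
    case 3
    then show ?thesis using 3(2)[of 1] by simp
  qed simp
  finally show ?thesis by (simp add: monomial_one)
qed

text \<open>\<open>cyclic_T\<close> is two column swaps away from the identity, so its powers have
  determinant 1 and the diagonal factor gives the value.\<close>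

lemma det_monomial: "det (monomial k t) = t 0 * t 1 * t 2"
proof -
  have "det (monomial 1 (\<lambda>_. 1)) = 1"
  proof -
    have eq: "monomial 1 (\<lambda>_. 1) = swapcols 0 1 (swapcols 1 2 (1\<^sub>m 3))"
    proof (rule eq_matI)
      fix i j assume "i < dim_row (swapcols 0 1 (swapcols 1 2 (1\<^sub>m 3 :: complex mat)))"
        "j < dim_col (swapcols 0 1 (swapcols 1 2 (1\<^sub>m 3 :: complex mat)))"
      then have "i = 0 \<or> i = 1 \<or> i = 2" "j = 0 \<or> j = 1 \<or> j = 2" by auto
      then show "monomial 1 (\<lambda>_. 1) $$ (i, j) = swapcols 0 1 (swapcols 1 2 (1\<^sub>m 3)) $$ (i, j)"
        by (elim disjE; hypsubst; simp add: monomial_def)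
    qed (simp_all add: monomial_def)
    have "det (swapcols 0 1 (swapcols 1 2 (1\<^sub>m 3))) = - det (swapcols 1 2 (1\<^sub>m 3) :: complex mat)"
      by (rule det_swapcols[of _ 3]) auto
    also have "det (swapcols 1 2 (1\<^sub>m 3) :: complex mat) = - det (1\<^sub>m 3)"
      by (rule det_swapcols[of _ 3]) auto
    finally show ?thesis unfolding eq by simp
  qed
  note T1 = this
  have T: "det (monomial k (\<lambda>_. 1)) = 1" for k
  proof (induction k)
    case 0
    then show ?case by (simp add: monomial_one)
  next
    case (Suc k)
    have "monomial (Suc k) (\<lambda>_. 1) = monomial k (\<lambda>_. 1) * monomial 1 (\<lambda>_. 1)"
      by (simp add: monomial_mult)
    then show ?case
      by (simp only: det_mult[OF monomial_carrier monomial_carrier] Suc T1) simp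
  qed
  have "monomial k t = mat_diag 3 t * monomial k (\<lambda>_. 1)"
    by (simp add: mat_diag_eq_monomial monomial_mult)
  then show ?thesis
    using det_mult[of "mat_diag 3 t" 3 "monomial k (\<lambda>_. 1)"] T by (simp add: det_mat_diag_3)
qed

text \<open>Values at indices from 3 on are free, so different members can give the same matrix;
  counting is done with \<open>torus_diag\<close> instead.\<close>

definition root_triples :: "nat \<Rightarrow> (nat \<Rightarrow> complex) set" where
  "root_triples n = {t. (\<forall>i<3. t i ^ n = 1) \<and> t 0 * t 1 * t 2 = 1}"

lemma norm_root_of_unity:
  fixes z :: complex
  assumes "z ^ n = 1" "n \<ge> 1"
  shows "norm z = 1"
  using power_eq_1_iff[OF assms(1)] assms(2) by auto

lemma monomial_in_SU3:
  assumes "n \<ge> 1" "t \<in> root_triples n"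
  shows "monomial k t \<in> carrier SU3"
proof -
  have "norm (t i) = 1" if "i < 3" for i
    using assms that by (intro norm_root_of_unity[of _ n]) (auto simp: root_triples_def)
  then show ?thesis
    using assms by (simp add: SU3_def mat_adjoint_monomial_mult det_monomial root_triples_def)
qed

text \<open>A cyclic shift permutes the three entries of \<open>t\<close> and so preserves their
  product.\<close>

lemma root_triples_mult:
  assumes "s \<in> root_triples n" "t \<in> root_triples n"
  shows "(\<lambda>i. s i * t ((i + k) mod 3)) \<in> root_triples n"
proof -
  have "t (k mod 3) * t ((1 + k) mod 3) * t ((2 + k) mod 3) = t 0 * t 1 * t 2"
  proof -
    show ?thesis
    proof (cases k rule: residue_mod_3)
      case 1
      then show ?thesis using 1(2)[of 1] 1(2)[of 2] by simp
    next
      case 2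
      then show ?thesis using 2(2)[of 1] 2(2)[of 2] by (simp add: mult_ac numeral_2_eq_2)
    next
      case 3
      then show ?thesis using 3(2)[of 1] 3(2)[of 2] by (simp add: mult_ac numeral_2_eq_2)
    qed
  qed
  moreover have "(a * x) * (b * y) * (c * z) = (a * b * c) * (x * y * z)" for a b c x y z :: complex
    by (simp add: mult_ac)
  ultimately have "s 0 * t (k mod 3) * (s 1 * t ((1 + k) mod 3)) * (s 2 * t ((2 + k) mod 3)) =
      (s 0 * s 1 * s 2) * (t 0 * t 1 * t 2)"
    by metis
  moreover have "s 0 * s 1 * s 2 = 1" "t 0 * t 1 * t 2 = 1" using assms by (auto simp: root_triples_def)
  ultimately have "s 0 * t (k mod 3) * (s 1 * t ((1 + k) mod 3)) * (s 2 * t ((2 + k) mod 3)) = 1"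
    by (simp only: mult_1)
  then show ?thesis using assms by (simp add: root_triples_def power_mult_distrib)
qed

text \<open>Normal form of the words in the generators: the monomial matrices contain the generators
  and their inverses and are closed under products. Conversely, repeated right multiplication of a
  diagonal matrix by \<open>cyclic_T\<close> reaches all of them.\<close>

lemma trihedral_eq:
  assumes n: "n \<ge> 1"
  shows "trihedral n = {monomial k t | k t. t \<in> root_triples n}"
proof
  interpret group SU3 by (rule group_SU3)
  have one: "(\<lambda>_. 1) \<in> root_triples n" by (simp add: root_triples_def)
  have diag: "diag_roots n = monomial 0 ` root_triples n"
    by (auto simp: diag_roots_def root_triples_def det_mat_diag_3 simp flip: mat_diag_eq_monomial)
  show "trihedral n \<subseteq> {monomial k t | k t. t \<in> root_triples n}"
  proof
    fix A assume "A \<in> trihedral n"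
    then have "A \<in> generate SU3 (insert cyclic_T (diag_roots n))" by (simp add: trihedral_def)
    then show "A \<in> {monomial k t | k t. t \<in> root_triples n}"
    proof induction
      case one
      have "\<one>\<^bsub>SU3\<^esub> = monomial 0 (\<lambda>_. 1)" by (simp add: SU3_simps monomial_one)
      then show ?case using \<open>(\<lambda>_. 1) \<in> root_triples n\<close> by blast
    next
      case (incl h)
      then show ?case using one by (auto simp: diag cyclic_T_eq_monomial)
    next
      case (inv h)
      then consider "h = monomial 1 (\<lambda>_. 1)" | t where "h = monomial 0 t" "t \<in> root_triples n"
        by (auto simp: diag cyclic_T_eq_monomial)
      then show ?case
      proof cases
        case 1
        \<comment> \<open>\<open>cyclic_T\<close> has order 3, so its square is its inverse.\<close>
        have "inv\<^bsub>SU3\<^esub> h = monomial 2 (\<lambda>_. 1)"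
        proof (rule inv_equality)
          show "monomial 2 (\<lambda>_. 1) \<otimes>\<^bsub>SU3\<^esub> h = \<one>\<^bsub>SU3\<^esub>"
            using monomial_mod[of 3 "\<lambda>_. 1"] by (simp add: SU3_simps 1 monomial_mult monomial_one)
        qed (use monomial_in_SU3[OF n one] 1 in auto)
        then show ?thesis using one by blast
      next
        case 2
        define s where "s = (\<lambda>i. inverse (t i))"
        have s: "s \<in> root_triples n"
          using 2(2) by (simp add: root_triples_def s_def power_inverse flip: inverse_mult_distrib)
        have "inv\<^bsub>SU3\<^esub> h = monomial 0 s"
        proof (rule inv_equality)
          have "t i \<noteq> 0" if "i < 3" for i
            using 2(2) that n by (auto simp: root_triples_def power_0_left dest!: spec[of _ i])
          then have "monomial 0 s * h = monomial 0 (\<lambda>_. 1)"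
            by (auto simp: 2(1) monomial_mult s_def intro!: monomial_cong)
          then show "monomial 0 s \<otimes>\<^bsub>SU3\<^esub> h = \<one>\<^bsub>SU3\<^esub>" by (simp add: SU3_simps monomial_one)
        qed (use monomial_in_SU3[OF n] s 2 in auto)
        then show ?thesis using s by blast
      qed
    next
      case (eng h1 h2)
      then show ?case by (auto simp: SU3_simps monomial_mult) (use root_triples_mult in blast)
    qed
  qed
  show "{monomial k t | k t. t \<in> root_triples n} \<subseteq> trihedral n"
  proof clarify
    fix k t assume t: "t \<in> root_triples n"
    show "monomial k t \<in> trihedral n"
    proof (induction k)
      case 0
      then show ?case using t by (auto simp: trihedral_def diag intro!: generate.incl)
    next
      case (Suc k)
      have "monomial k t \<otimes>\<^bsub>SU3\<^esub> cyclic_T \<in> trihedral n"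
        using Suc unfolding trihedral_def by (rule generate.eng) (simp add: generate.incl)
      then show ?case by (simp add: SU3_simps cyclic_T_eq_monomial monomial_mult)
    qed
  qed
qed

lemma group_trihedral:
  assumes n: "n \<ge> 1"
  shows "group (grp (trihedral n))" "trihedral n \<subseteq> carrier SU3"
proof -
  interpret group SU3 by (rule group_SU3)
  show sub: "trihedral n \<subseteq> carrier SU3"
    using monomial_in_SU3[OF n] by (auto simp: trihedral_eq[OF n])
  have "insert cyclic_T (diag_roots n) \<subseteq> carrier SU3"
    using sub generate.incl[of _ "insert cyclic_T (diag_roots n)" SU3] unfolding trihedral_def by blast
  then have "subgroup (trihedral n) SU3"
    unfolding trihedral_def by (rule generate_is_subgroup)
  then show "group (grp (trihedral n))"
    unfolding grp_def by (rule subgroup.subgroup_is_group[OF _ is_group])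
qed

text \<open>The parametrization of the diagonal matrices by the torus under which the trace becomes the
  first factor of \<open>R_fun\<close>.\<close>

definition torus_diag :: "complex \<times> complex \<Rightarrow> nat \<Rightarrow> complex" where
  "torus_diag = (\<lambda>(\<omega>1, \<omega>2) i. if i = 0 then \<omega>1 else if i = 1 then inverse \<omega>2 else inverse \<omega>1 * \<omega>2)"

definition roots :: "nat \<Rightarrow> complex set" where
  "roots n = {z. z ^ n = 1}"

text \<open>Row 0 of the matrix determines \<open>k\<close> and the first coordinate, row 1 the
  second; determinant 1 then fixes the remaining entry. Exponents below 3 make the normal form
  unique.\<close>

lemma bij_betw_trihedral:
  assumes n: "n \<ge> 1"
  shows "bij_betw (\<lambda>(k, \<omega>). monomial k (torus_diag \<omega>)) ({..<3} \<times> (roots n \<times> roots n)) (trihedral n)"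
proof (rule bij_betw_imageI)
  have nz: "z \<noteq> 0" if "z \<in> roots n" for z using that n by (auto simp: roots_def power_0_left)
  show "inj_on (\<lambda>(k, \<omega>). monomial k (torus_diag \<omega>)) ({..<3} \<times> (roots n \<times> roots n))"
  proof (rule inj_onI)
    fix x y
    assume x: "x \<in> {..<3} \<times> (roots n \<times> roots n)" and y: "y \<in> {..<3} \<times> (roots n \<times> roots n)"
      and xy: "(case x of (k, \<omega>) \<Rightarrow> monomial k (torus_diag \<omega>)) = (case y of (k, \<omega>) \<Rightarrow> monomial k (torus_diag \<omega>))"
    obtain k a b l c d where [simp]: "x = (k, a, b)" "y = (l, c, d)" by (metis prod.exhaust)
    have kl: "k \<in> {..<3}" "l \<in> {..<3}" and r: "a \<in> roots n" "b \<in> roots n" "c \<in> roots n" "d \<in> roots n"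
      and eq: "monomial k (torus_diag (a, b)) = monomial l (torus_diag (c, d))"
      using x y xy by auto
    have k3: "(0 + k) mod 3 = k" "k < 3" "l < 3" using kl by auto
    have "monomial k (torus_diag (a, b)) $$ (0, k) = a" using k3 by (simp add: monomial_def torus_diag_def)
    moreover have "monomial l (torus_diag (c, d)) $$ (0, k) = (if k = l then c else 0)"
      using k3 by (simp add: monomial_def torus_diag_def)
    ultimately have "k = l" "a = c" using eq nz[OF r(1)] by (auto split: if_splits)
    have "monomial k (torus_diag (a, b)) $$ (1, (1 + k) mod 3) = inverse b"
      "monomial k (torus_diag (c, d)) $$ (1, (1 + k) mod 3) = inverse d"
      by (simp_all add: monomial_def torus_diag_def)
    then have "b = d" using eq \<open>k = l\<close> by simp
    with \<open>k = l\<close> \<open>a = c\<close> show "x = y" by simp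
  qed
  show "(\<lambda>(k, \<omega>). monomial k (torus_diag \<omega>)) ` ({..<3} \<times> (roots n \<times> roots n)) = trihedral n"
  proof
    show "(\<lambda>(k, \<omega>). monomial k (torus_diag \<omega>)) ` ({..<3} \<times> (roots n \<times> roots n)) \<subseteq> trihedral n"
    proof clarify
      fix k a b assume ab: "a \<in> roots n" "b \<in> roots n"
      moreover have "a * inverse b * (inverse a * b) = 1"
        using nz[OF ab(1)] nz[OF ab(2)] by (simp add: field_simps)
      ultimately have "torus_diag (a, b) \<in> root_triples n"
        by (auto simp: torus_diag_def root_triples_def roots_def power_inverse power_mult_distrib)
      then show "monomial k (torus_diag (a, b)) \<in> trihedral n" by (auto simp: trihedral_eq[OF n])
    qed
    show "trihedral n \<subseteq> (\<lambda>(k, \<omega>). monomial k (torus_diag \<omega>)) ` ({..<3} \<times> (roots n \<times> roots n))"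
    proof
      fix A assume "A \<in> trihedral n"
      then obtain k t where t: "A = monomial k t" "t \<in> root_triples n" by (auto simp: trihedral_eq[OF n])
      then have r: "t 0 \<in> roots n" "inverse (t 1) \<in> roots n"
        by (auto simp: root_triples_def roots_def power_inverse)
      have "t 1 \<noteq> 0" "t 0 \<noteq> 0" using t(2) by (auto simp: root_triples_def)
      then have "t 2 = inverse (t 0) * inverse (t 1)"
        using t(2) by (simp add: root_triples_def field_simps)
      then have "monomial (k mod 3) (torus_diag (t 0, inverse (t 1))) = monomial (k mod 3) t"
        by (intro monomial_cong) (auto simp: torus_diag_def less_3_cases)
      then have "A = monomial (k mod 3) (torus_diag (t 0, inverse (t 1)))"
        by (simp add: t(1) monomial_mod)
      then show "A \<in> (\<lambda>(k, \<omega>). monomial k (torus_diag \<omega>)) ` ({..<3} \<times> (roots n \<times> roots n))"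
        using r by (intro image_eqI[of _ _ "(k mod 3, (t 0, inverse (t 1)))"]) auto
    qed
  qed
qed

lemma finite_roots: "n \<ge> 1 \<Longrightarrow> finite (roots n)"
  unfolding roots_def by (rule finite_roots_unity) simp

lemma card_roots: "n \<ge> 1 \<Longrightarrow> card (roots n) = n"
  unfolding roots_def by (rule card_roots_unity_eq) simp

text \<open>Roots of unity lie on the unit circle, so conjugation is inversion and turns the first
  factor of \<open>R_fun\<close> into the second.\<close>

lemma R_fun_eq_trace:
  assumes "n \<ge> 1" "\<omega> \<in> roots n \<times> roots n"
  shows "mat_trace (monomial 0 (torus_diag \<omega>)) ^ m1 * cnj (mat_trace (monomial 0 (torus_diag \<omega>))) ^ m2 =
    R_fun m1 m2 \<omega>"
proof -
  obtain a b where \<omega>: "\<omega> = (a, b)" by fastforce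
  have cnj: "cnj z = inverse z" if "z \<in> roots n" for z
    using norm_root_of_unity[of z n] that assms(1) complex_norm_square[of z]
    by (intro inverse_unique[symmetric]) (simp add: roots_def)
  have "cnj a = inverse a" "cnj b = inverse b" using assms(2) cnj by (auto simp: \<omega>)
  then show ?thesis by (simp add: mat_trace_monomial R_fun_def torus_diag_def \<omega>)
qed

lemma McKay_moment_trihedral:
  assumes n: "n \<ge> 1"
  shows "McKay_moment (trihedral n) m1 m2 =
    (\<Sum>\<omega>\<in>roots n \<times> roots n. R_fun m1 m2 \<omega> / (3 * of_nat n ^ 2)) + (if m1 = 0 \<and> m2 = 0 then 2 / 3 else 0)"
proof -
  note bij = bij_betw_trihedral[OF n]
  have fin: "finite (trihedral n)"
    using bij_betw_finite[OF bij] finite_roots[OF n] by simp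
  have card: "card (trihedral n) = 3 * n ^ 2"
    using bij_betw_same_card[OF bij] card_roots[OF n] by (simp add: card_cartesian_product power2_eq_square)
  interpret finite_subgroup_SU3 "trihedral n"
    by (rule finite_subgroup_SU3.intro) (use group_trihedral[OF n] fin in auto)
  let ?f = "\<lambda>g. mat_trace g ^ m1 * cnj (mat_trace g) ^ m2"
  have "(\<Sum>g\<in>trihedral n. ?f g) = (\<Sum>(k, \<omega>)\<in>{..<3} \<times> (roots n \<times> roots n). ?f (monomial k (torus_diag \<omega>)))"
    using sum.reindex_bij_betw[OF bij, of ?f] by (simp add: case_prod_unfold)
  also have "\<dots> = (\<Sum>k<3. \<Sum>\<omega>\<in>roots n \<times> roots n. ?f (monomial k (torus_diag \<omega>)))"
    by (simp add: sum.cartesian_product)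
  also have "\<dots> = (\<Sum>\<omega>\<in>roots n \<times> roots n. ?f (monomial 0 (torus_diag \<omega>))) +
      (\<Sum>k\<in>{1, 2}. \<Sum>\<omega>\<in>roots n \<times> roots n. ?f (monomial k (torus_diag \<omega>)))"
  proof -
    have "{..<3::nat} = {0, 1, 2}" by auto
    then show ?thesis by simp
  qed
  \<comment> \<open>Each of the \<open>2 * n^2\<close> elements with \<open>k\<close> equal to 1 or
    2 contributes \<open>0 ^ m1 * 0 ^ m2\<close>, which is 1 exactly if both exponents are 0, as
    \<open>0 ^ 0 = 1\<close>.\<close>
  also have "(\<Sum>k\<in>{1, 2}. \<Sum>\<omega>\<in>roots n \<times> roots n. ?f (monomial k (torus_diag \<omega>))) =
      (if m1 = 0 \<and> m2 = 0 then 2 * of_nat n ^ 2 else 0)"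
    by (simp add: mat_trace_monomial card_cartesian_product card_roots[OF n] power2_eq_square power_0_left)
  also have "(\<Sum>\<omega>\<in>roots n \<times> roots n. ?f (monomial 0 (torus_diag \<omega>))) =
      (\<Sum>\<omega>\<in>roots n \<times> roots n. R_fun m1 m2 \<omega>)"
    by (intro sum.cong refl R_fun_eq_trace[OF n])
  finally show ?thesis
    using n by (simp add: McKay_moment_eq card add_divide_distrib sum_divide_distrib)
qed

section \<open>The measures\<close>

subsection \<open>Finitely supported measures on the torus\<close>

text \<open>A measure with these values is the image of a point measure under the inclusion of
  \<open>S\<close>, and integrals transfer along that map.\<close>

lemma has_bochner_integral_finite_support:
  fixes f :: "'a \<Rightarrow> complex" and w :: "'a \<Rightarrow> real"
  assumes S: "finite S" "S \<subseteq> space M" and w: "\<And>s. s \<in> S \<Longrightarrow> w s \<ge> 0"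
    and em: "\<And>A. A \<in> sets M \<Longrightarrow> emeasure M A = (\<Sum>s\<in>S. ennreal (w s) * indicator A s)"
    and f: "f \<in> borel_measurable M"
  shows "has_bochner_integral M f (\<Sum>s\<in>S. w s *\<^sub>R f s)"
proof -
  let ?P = "point_measure S (\<lambda>s. ennreal (w s))"
  have id: "(\<lambda>s. s) \<in> measurable ?P M" using S by (auto simp: measurable_def space_point_measure sets_point_measure)
  have "M = distr ?P M (\<lambda>s. s)"
  proof (rule measure_eqI)
    fix A assume A: "A \<in> sets M"
    have "emeasure (distr ?P M (\<lambda>s. s)) A = emeasure ?P (A \<inter> S)"
      using emeasure_distr[OF id A] by (simp add: space_point_measure vimage_def)
    also have "\<dots> = (\<Sum>s\<in>A \<inter> S. ennreal (w s))"
      using S by (intro emeasure_point_measure_finite) auto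
    also have "\<dots> = (\<Sum>s\<in>S. ennreal (w s) * indicator A s)"
      using S by (intro sum.mono_neutral_cong_left) (auto simp: indicator_def split: if_splits)
    finally show "emeasure M A = emeasure (distr ?P M (\<lambda>s. s)) A" using em[OF A] by simp
  qed simp
  moreover have "has_bochner_integral (distr ?P M (\<lambda>s. s)) f (\<Sum>s\<in>S. w s *\<^sub>R f s)"
    using integrable_point_measure_finite[OF S(1)] S(1) w
    by (simp add: has_bochner_integral_iff integrable_distr_eq[OF id f] integral_distr[OF id f]
        lebesgue_integral_point_measure_finite)
  ultimately show ?thesis by simp
qed

lemma nn_integral_uniform_on:
  assumes S: "finite S" "S \<subseteq> space M" and f: "f \<in> borel_measurable M"
  shows "(\<integral>\<^sup>+x. f x \<partial>uniform_on M S) = (\<Sum>s\<in>S. ennreal (1 / card S) * f s)"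
proof -
  have id: "(\<lambda>s. s) \<in> measurable (uniform_count_measure S) M"
    using S by (auto simp: measurable_def space_uniform_count_measure sets_uniform_count_measure)
  have "(\<integral>\<^sup>+x. f x \<partial>uniform_on M S) = (\<integral>\<^sup>+x. f x \<partial>uniform_count_measure S)"
    unfolding uniform_on_def by (rule nn_integral_distr[OF id]) (use f in simp)
  also have "\<dots> = (\<Sum>s\<in>S. ennreal (1 / card S) * f s)"
    unfolding uniform_count_measure_def using S by (subst nn_integral_point_measure_finite) simp_all
  finally show ?thesis .
qed

lemma sets_uniform_on [simp]: "sets (uniform_on M S) = sets M"
  and space_uniform_on [simp]: "space (uniform_on M S) = space M"
  by (simp_all add: uniform_on_def)

text \<open>Supplies the finiteness under which a product measure is computed by iterated
  integrals.\<close>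

lemma finite_measure_uniform_on:
  assumes "finite S" "S \<subseteq> space M"
  shows "finite_measure (uniform_on M S)"
proof
  have "emeasure (uniform_on M S) (space M) = (\<integral>\<^sup>+x. indicator (space M) x \<partial>uniform_on M S)"
    by (subst nn_integral_indicator) simp_all
  also have "\<dots> = (\<Sum>s\<in>S. ennreal (1 / card S) * indicator (space M) s)"
    by (rule nn_integral_uniform_on[OF assms]) simp
  also have "\<dots> = (\<Sum>s\<in>S. ennreal (1 / card S))"
    using assms(2) by (intro sum.cong refl) auto
  also have "\<dots> < \<infinity>" by (subst sum_ennreal) auto
  finally show "emeasure (uniform_on M S) (space (uniform_on M S)) \<noteq> \<infinity>" by simp
qed

lemma emeasure_pair_uniform_on:
  assumes S: "finite S" "S \<subseteq> space M" and T: "finite T" "T \<subseteq> space N"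
    and A: "A \<in> sets (M \<Otimes>\<^sub>M N)"
  shows "emeasure (uniform_on M S \<Otimes>\<^sub>M uniform_on N T) A =
    (\<Sum>z\<in>S \<times> T. ennreal (1 / (card S * card T)) * indicator A z)"
proof -
  interpret T: finite_measure "uniform_on N T" by (rule finite_measure_uniform_on[OF T])
  have sets: "sets (uniform_on M S \<Otimes>\<^sub>M uniform_on N T) = sets (M \<Otimes>\<^sub>M N)"
    by (intro sets_pair_measure_cong) simp_all
  have ind: "(\<lambda>y. indicator A (x, y)) \<in> borel_measurable N" if "x \<in> space M" for x
    using that A by measurable
  have "emeasure (uniform_on M S \<Otimes>\<^sub>M uniform_on N T) A =
      (\<integral>\<^sup>+x. \<integral>\<^sup>+y. indicator A (x, y) \<partial>uniform_on N T \<partial>uniform_on M S)"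
    by (rule T.emeasure_pair_measure) (use A sets in simp)
  also have "\<dots> = (\<integral>\<^sup>+x. (\<Sum>y\<in>T. ennreal (1 / card T) * indicator A (x, y)) \<partial>uniform_on M S)"
    by (intro nn_integral_cong nn_integral_uniform_on[OF T] ind) simp
  also have "\<dots> = (\<Sum>x\<in>S. ennreal (1 / card S) * (\<Sum>y\<in>T. ennreal (1 / card T) * indicator A (x, y)))"
  proof (rule nn_integral_uniform_on[OF S])
    have "(\<lambda>x. indicator A (x, y)) \<in> borel_measurable M" if "y \<in> T" for y
    proof -
      have "y \<in> space N" using that T by auto
      then show ?thesis using A by measurable
    qed
    then show "(\<lambda>x. \<Sum>y\<in>T. ennreal (1 / card T) * indicator A (x, y)) \<in> borel_measurable M"
      by (intro borel_measurable_sum borel_measurable_times_ennreal borel_measurable_const)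
  qed
  also have "\<dots> = (\<Sum>x\<in>S. \<Sum>y\<in>T. ennreal (1 / (card S * card T)) * indicator A (x, y))"
    by (simp add: sum_distrib_left mult.assoc[symmetric] ennreal_mult[symmetric])
  finally show ?thesis by (simp add: sum.cartesian_product case_prod_unfold)
qed

lemma space_circle_space: "space circle_space = sphere 0 1"
  by (simp add: circle_space_def space_restrict_space)

lemma space_torus_space: "space torus_space = sphere 0 1 \<times> sphere 0 1"
  by (simp add: torus_space_def space_pair_measure space_circle_space)

lemma measurable_torus_coordinates [measurable]:
  "fst \<in> borel_measurable torus_space" "snd \<in> borel_measurable torus_space"
proof -
  have "(\<lambda>z. z) \<in> borel_measurable circle_space"
    unfolding circle_space_def by (intro measurable_restrict_space1) simp
  then show "fst \<in> borel_measurable torus_space" "snd \<in> borel_measurable torus_space"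
    unfolding torus_space_def
    using measurable_compose[OF measurable_fst, of "\<lambda>z. z"] measurable_compose[OF measurable_snd, of "\<lambda>z. z"]
    by auto
qed

lemma R_fun_measurable: "R_fun m1 m2 \<in> borel_measurable torus_space"
  unfolding R_fun_def case_prod_unfold by measurable

text \<open>On the unit circle \<open>cis (Arg z) = z\<close>, so \<open>Arg\<close> disappears.
  What remains is built from Laurent monomials: visibly measurable, and computable from algebraic
  relations between the coordinates.\<close>

lemma J_fun_torus:
  assumes "norm u = 1" "norm v = 1"
  shows "J_fun (u, v) = 4 * pi^2 * (Im (u * v) - Im (u^2 * inverse v) - Im (v^2 * inverse u))"
proof -
  have "cis (2 * pi * (Arg z / (2 * pi))) = z" if "norm z = 1" for z
  proof -
    have "z \<noteq> 0" using that by auto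
    then show ?thesis using that cis_Arg[of z] by (simp add: sgn_eq)
  qed
  then show ?thesis
    unfolding J_fun_def prod.case J_angle_eq_Im Let_def using assms by simp
qed

lemma J_fun_measurable: "J_fun \<in> borel_measurable torus_space"
proof -
  have "(\<lambda>\<omega>. 4 * pi^2 * (Im (fst \<omega> * snd \<omega>) - Im (fst \<omega> ^ 2 * inverse (snd \<omega>)) -
      Im (snd \<omega> ^ 2 * inverse (fst \<omega>)))) \<in> borel_measurable torus_space"
    by measurable
  then show ?thesis
    by (rule measurable_cong[THEN iffD1, rotated])
       (auto simp: space_torus_space J_fun_torus)
qed

lemma roots_subset_circle: "n \<ge> 1 \<Longrightarrow> roots n \<subseteq> space circle_space"
  using norm_root_of_unity by (auto simp: roots_def space_circle_space)

lemma root_measure_half: "root_measure (real n / 2) = uniform_on circle_space (roots n)"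
  by (simp add: root_measure_def roots_def)

subsection \<open>The points of \<open>D_set 3\<close>\<close>

lemma roots_eq_cis:
  assumes "n \<ge> 1"
  shows "roots n = (\<lambda>k. cis (2 * pi * real k / real n)) ` {..<n}"
  using Complex.bij_betw_roots_unity[of n] assms by (simp add: bij_betw_def roots_def)

text \<open>The second factor is the product of the two coordinates of the point.\<close>

lemma bij_betw_D_set:
  "bij_betw (\<lambda>(u, p). (u, p / u)) (roots 9 \<times> roots 3) (D_set 3)"
proof (rule bij_betw_imageI)
  have nz: "u \<noteq> 0" if "u \<in> roots 9" for u using that by (auto simp: roots_def)
  show "inj_on (\<lambda>(u, p). (u, p / u)) (roots 9 \<times> roots 3)"
    using nz by (auto simp: inj_on_def)
  have D: "D_set 3 = {(cis (2 * pi * real q1 / 9), cis (2 * pi * real q2 / 9)) | q1 q2.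
            q1 < 9 \<and> q2 < 9 \<and> (q1 + q2) mod 3 = 0}"
    by (simp add: D_set_def)
  show "(\<lambda>(u, p). (u, p / u)) ` (roots 9 \<times> roots 3) = D_set 3"
  proof
    show "D_set 3 \<subseteq> (\<lambda>(u, p). (u, p / u)) ` (roots 9 \<times> roots 3)"
    proof
      fix \<omega> assume "\<omega> \<in> D_set 3"
      then obtain q1 q2 where q: "\<omega> = (cis (2 * pi * real q1 / 9), cis (2 * pi * real q2 / 9))"
        "q1 < 9" "q2 < 9" "(q1 + q2) mod 3 = 0" unfolding D by (elim CollectE exE conjE) (rule that)
      define u p where "u = cis (2 * pi * real q1 / 9)" and "p = u * cis (2 * pi * real q2 / 9)"
      have u: "u \<in> roots 9" unfolding u_def using q(2) roots_eq_cis[of 9] by auto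
      \<comment> \<open>Divisibility of \<open>q1 + q2\<close> by 3 makes the angle of
        \<open>p\<close> a multiple of \<open>2 * pi / 3\<close>.\<close>
      obtain a where a: "q1 + q2 = 3 * a" using q(4) by auto
      have "real q1 + real q2 = 3 * real a" using a by (metis of_nat_add of_nat_mult of_nat_numeral)
      moreover have "3 * (2 * pi * real q1 / 9 + 2 * pi * real q2 / 9) = 2 * pi * ((real q1 + real q2) / 3)"
        by (simp add: field_simps)
      ultimately have "3 * (2 * pi * real q1 / 9 + 2 * pi * real q2 / 9) = 2 * pi * real a"
        by simp
      then have "p ^ 3 = cis (2 * pi * real a)"
        unfolding p_def u_def cis_mult Complex.DeMoivre by simp
      then have "p \<in> roots 3" by (simp add: roots_def cis_multiple_2pi)
      moreover have "\<omega> = (u, p / u)" using nz[OF u] by (simp add: q(1) p_def flip: u_def)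
      ultimately show "\<omega> \<in> (\<lambda>(u, p). (u, p / u)) ` (roots 9 \<times> roots 3)"
        using u by (intro image_eqI[of _ _ "(u, p)"]) auto
    qed
    show "(\<lambda>(u, p). (u, p / u)) ` (roots 9 \<times> roots 3) \<subseteq> D_set 3"
    proof clarify
      fix u p assume u: "u \<in> roots 9" and p: "p \<in> roots 3"
      have "(p ^ 3) ^ 3 = 1" using p by (simp add: roots_def)
      then have "p / u \<in> roots 9" using u by (simp add: roots_def power_divide flip: power_mult)
      then obtain q2 where q2: "q2 < 9" "p / u = cis (2 * pi * real q2 / 9)"
        using roots_eq_cis[of 9] by auto
      obtain q1 where q1: "q1 < 9" "u = cis (2 * pi * real q1 / 9)"
        using roots_eq_cis[of 9] u by auto
      have "p = u * (p / u)" using nz[OF u] by simp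
      also have "\<dots> = cis (2 * pi * real (q1 + q2) / 9)"
        unfolding q1(2)[symmetric] q2(2) unfolding q1(2) cis_mult by (simp add: field_simps)
      finally have "cis (2 * pi * real (q1 + q2) / 3) = 1"
        using p by (simp add: roots_def Complex.DeMoivre mult.assoc)
      \<comment> \<open>Conversely \<open>p ^ 3 = 1\<close> makes the angle of \<open>p ^ 3\<close>
        a multiple of \<open>2 * pi\<close>, whence the divisibility by 3.\<close>
      then have "cos (2 * pi * real (q1 + q2) / 3) = 1" by (simp add: complex_eq_iff)
      then obtain k :: int where "2 * pi * real (q1 + q2) / 3 = of_int k * 2 * pi"
        unfolding cos_one_2pi_int by blast
      then have "(2 * pi) * real (q1 + q2) = (2 * pi) * (3 * of_int k)" by (simp add: field_simps)
      then have "real (q1 + q2) = 3 * of_int k" by (subst (asm) mult_cancel_left) simp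
      then have "int (q1 + q2) = 3 * k" by linarith
      then have "(q1 + q2) mod 3 = 0" by presburger
      then show "(u, p / u) \<in> D_set 3"
        unfolding D using q1 q2 by (intro CollectI exI[of _ q1] exI[of _ q2] conjI) simp_all
    qed
  qed
qed

text \<open>The primitive cube roots of unity have real part -1/2 and imaginary part plus or minus
  sqrt 3 / 2; the square removes the sign.\<close>

lemma cube_root_of_unity:
  fixes z :: complex
  assumes "z ^ 3 = 1" "z \<noteq> 1"
  shows "z ^ 2 + z + 1 = 0" "Im z ^ 2 = 3 / 4"
proof -
  have "(z - 1) * (z ^ 2 + z + 1) = z ^ 3 - 1" by (simp add: algebra_simps power2_eq_square power3_eq_cube)
  then show eq: "z ^ 2 + z + 1 = 0" using assms by simp
  have n: "(Re z)\<^sup>2 + (Im z)\<^sup>2 = 1"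
    using norm_root_of_unity[OF assms(1)] cmod_power2[of z] by simp
  have "Re (z ^ 2 + z + 1) = 0" using eq by simp
  then have "(Re z)\<^sup>2 - (Im z)\<^sup>2 + Re z + 1 = 0" by (simp add: power2_eq_square)
  \<comment> \<open>Sum of the two equations. The solution \<open>Re z = 0\<close> is spurious: the
    imaginary part of \<open>eq\<close> would then give \<open>Im z = 0\<close>, against norm
    1.\<close>
  with n have "Re z * (2 * Re z + 1) = 0" by (simp add: power2_eq_square algebra_simps)
  then consider "Re z = 0" | "Re z = - 1 / 2" by auto
  then show "Im z ^ 2 = 3 / 4"
  proof cases
    case 1
    have "Im (z ^ 2 + z + 1) = 0" using eq by simp
    then have "Im z = 0" using 1 by (simp add: power2_eq_square)
    with 1 n show ?thesis by simp
  next
    case 2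
    then show ?thesis using n by (simp add: power2_eq_square)
  qed
qed

text \<open>For \<open>v = p / u\<close> the monomials of J are \<open>u * v = p\<close>,
  \<open>u^2 / v = c / p\<close> and \<open>v^2 / u = p^2 / c\<close> with \<open>c = u^3\<close>,
  so J depends only on two cube roots of unity. The nonzero value is
  \<open>(4 * pi^2)^2 * 3^2 * (3 / 4)\<close>.\<close>

lemma J_fun_D_point:
  assumes u: "u \<in> roots 9" and p: "p \<in> roots 3"
  shows "(J_fun (u, p / u))\<^sup>2 = (if u ^ 3 = 1 \<and> p \<noteq> 1 then 108 * pi ^ 4 else 0)"
proof -
  have p3: "p ^ 3 = 1" and c3: "(u ^ 3) ^ 3 = 1" using u p by (simp_all add: roots_def flip: power_mult)
  define c where "c = u ^ 3"
  have nz: "u \<noteq> 0" "p \<noteq> 0" "c \<noteq> 0" using u p3 by (auto simp: roots_def c_def)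
  have norm: "norm u = 1" "norm p = 1" "norm c = 1"
    using norm_root_of_unity[of u 9] norm_root_of_unity[of p 3] norm_root_of_unity[of c 3] u p3 c3
    by (simp_all add: roots_def c_def)
  have inv: "inverse z = cnj z" if "norm z = 1" for z
    using that complex_norm_square[of z] by (intro inverse_unique) simp
  have J: "J_fun (u, p / u) = 4 * pi^2 * (Im p - Im (c * inverse p) - Im (p ^ 2 * inverse c))"
    using nz norm by (subst J_fun_torus)
      (simp_all add: norm_divide c_def field_simps power2_eq_square power3_eq_cube)
  have sq: "z ^ 2 = inverse z" if "z ^ 3 = 1" for z :: complex
    using that by (intro inverse_unique[symmetric]) (simp add: power2_eq_square power3_eq_cube mult.assoc)
  have "Im p - Im (c * inverse p) - Im (p ^ 2 * inverse c) = (if c = 1 then 3 * Im p else 0)"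
  proof (cases "c = 1")
    \<comment> \<open>Both subtracted terms are imaginary parts of the conjugate of
      \<open>p\<close>, so each adds another \<open>Im p\<close>.\<close>
    case True
    then show ?thesis using sq[OF p3] inv[OF norm(2)] by simp
  next
    case False
    have eqc: "c ^ 2 + c + 1 = 0" using cube_root_of_unity(1)[of c] c3 False by (simp add: c_def)
    \<comment> \<open>As \<open>c\<close> is a primitive cube root of unity, \<open>p\<close> is one
      of \<open>1\<close>, \<open>c\<close> and \<open>c ^ 2\<close>. In each case one of the three
      terms is the imaginary part of 1 and the other two cancel.\<close>
    have "(p - 1) * (p - c) * (p - c ^ 2) = p ^ 3 - (c ^ 2 + c + 1) * p ^ 2 + c * (c ^ 2 + c + 1) * p - c ^ 3"
      by (simp add: algebra_simps power2_eq_square power3_eq_cube)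
    also have "\<dots> = 0" using eqc p3 c3 by (simp add: c_def)
    finally consider "p = 1" | "p = c" | "p = c ^ 2" by auto
    then show ?thesis
    proof cases
      case 1
      then show ?thesis using False inv[OF norm(3)] by simp
    next
      case 2
      have "c * inverse c = 1" "c ^ 2 * inverse c = c" using nz by (simp_all add: power2_eq_square)
      then show ?thesis unfolding 2 using False by simp
    next
      case 3
      have "c ^ 3 = 1" using c3 by (simp only: c_def)
      note inv_c = sq[OF this, symmetric]
      have "inverse (c ^ 2) = c" unfolding inv_c[symmetric] by simp
      then have "c * inverse p = p" unfolding 3 by (simp add: power2_eq_square)
      moreover have "p ^ 2 * inverse c = c ^ 3 * c ^ 3"
        unfolding 3 inv_c by (simp add: power2_eq_square power3_eq_cube mult.assoc)
      then have "p ^ 2 * inverse c = 1" using \<open>c ^ 3 = 1\<close> by simp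
      ultimately show ?thesis using False by simp
    qed
  qed
  moreover have "Im p ^ 2 = (if p = 1 then 0 else 3 / 4)"
    using cube_root_of_unity(2)[OF p3] by simp
  ultimately show ?thesis
    unfolding J by (auto simp: c_def power_mult_distrib)
qed

text \<open>Clearing denominators turns either factor into \<open>p ^ 2 + p + 1\<close>, which
  vanishes at a primitive cube root of unity.\<close>

lemma R_fun_cube_roots:
  assumes "u ^ 3 = 1" "p ^ 3 = 1" "p \<noteq> 1"
  shows "R_fun m1 m2 (u, p / u) = (if m1 = 0 \<and> m2 = 0 then 1 else 0)"
proof -
  have nz: "u \<noteq> 0" "p \<noteq> 0" using assms by auto
  have eq: "p ^ 2 + p + 1 = 0" using cube_root_of_unity(1)[OF assms(2,3)] .
  have "(u + inverse (p / u) + inverse u * (p / u)) * (u ^ 2 * p) = u ^ 3 * p + u ^ 3 + p ^ 2"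
    using nz by (simp add: field_simps power2_eq_square power3_eq_cube)
  also have "\<dots> = 0" using eq assms(1) by (simp add: algebra_simps)
  finally have 1: "u + inverse (p / u) + inverse u * (p / u) = 0" using nz by simp
  have "(inverse u + p / u + u * inverse (p / u)) * (u * p) = p + p ^ 2 + u ^ 3"
    using nz by (simp add: field_simps power2_eq_square power3_eq_cube)
  also have "\<dots> = 0" using eq assms(1) by (simp add: algebra_simps)
  finally have 2: "inverse u + p / u + u * inverse (p / u) = 0" using nz by simp
  show ?thesis unfolding R_fun_def prod.case 1 2 by (simp add: power_0_left)
qed

lemma sum_D_set:
  "(\<Sum>\<omega>\<in>D_set 3. (J_fun \<omega>)\<^sup>2 *\<^sub>R R_fun m1 m2 \<omega>) =
    (if m1 = 0 \<and> m2 = 0 then complex_of_real (648 * pi ^ 4) else 0)"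
proof -
  have sub: "roots 3 \<subseteq> roots 9"
  proof
    fix z assume "z \<in> roots 3"
    then have "(z ^ 3) ^ 3 = 1" by (simp add: roots_def)
    then show "z \<in> roots 9" by (simp add: roots_def flip: power_mult)
  qed
  define v where "v = (if m1 = 0 \<and> m2 = 0 then complex_of_real (108 * pi ^ 4) else 0)"
  have pt: "(J_fun (u, p / u))\<^sup>2 *\<^sub>R R_fun m1 m2 (u, p / u) = (if u ^ 3 = 1 \<and> p \<noteq> 1 then v else 0)"
    if "u \<in> roots 9" "p ^ 3 = 1" for u p
    using that R_fun_cube_roots[of u p m1 m2] J_fun_D_point[of u p]
    by (simp add: scaleR_conv_of_real roots_def v_def)
  have "(\<Sum>\<omega>\<in>D_set 3. (J_fun \<omega>)\<^sup>2 *\<^sub>R R_fun m1 m2 \<omega>) =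
      (\<Sum>(u, p)\<in>roots 9 \<times> roots 3. (J_fun (u, p / u))\<^sup>2 *\<^sub>R R_fun m1 m2 (u, p / u))"
    using sum.reindex_bij_betw[OF bij_betw_D_set, of "\<lambda>\<omega>. (J_fun \<omega>)\<^sup>2 *\<^sub>R R_fun m1 m2 \<omega>"]
    by (simp add: case_prod_unfold)
  also have "\<dots> = (\<Sum>(u, p)\<in>roots 9 \<times> roots 3. if u ^ 3 = 1 \<and> p \<noteq> 1 then v else 0)"
    by (intro sum.cong refl) (clarsimp simp: pt roots_def[of 3])
  \<comment> \<open>The six points of the support: \<open>u\<close> is any cube root of unity and
    \<open>p\<close> a primitive one. Hence \<open>648 = 6 * 108\<close>.\<close>
  also have "\<dots> = (\<Sum>(u, p)\<in>roots 3 \<times> (roots 3 - {1}). v)"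
    using sub finite_roots[of 9] finite_roots[of 3]
    by (intro sum.mono_neutral_cong_right) (auto simp: roots_def[of 3] split: if_splits)
  also have "\<dots> = v * of_nat (card (roots 3 \<times> (roots 3 - {1})))"
    by (simp add: case_prod_unfold)
  also have "card (roots 3 \<times> (roots 3 - {1})) = 6"
    using card_roots[of 3] finite_roots[of 3] by (simp add: card_cartesian_product roots_def)
  finally show ?thesis by (simp add: v_def)
qed

lemma finite_D_set: "finite (D_set 3)"
  using bij_betw_finite[OF bij_betw_D_set] finite_roots[of 9] finite_roots[of 3] by simp

lemma card_D_set: "card (D_set 3) = 27"
  using bij_betw_same_card[OF bij_betw_D_set] card_roots[of 9] card_roots[of 3]
  by (simp add: card_cartesian_product)

lemma D_set_subset_torus: "D_set N \<subseteq> space torus_space"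
  by (auto simp: D_set_def space_torus_space)

text \<open>Both summands are finite combinations of point masses, so the integral of
  \<open>R_fun\<close> is a finite sum, to be compared with
  \<open>McKay_moment_trihedral\<close>.\<close>

theorem theorem3p2:
  fixes n :: nat
  assumes "n \<ge> 1"
  shows "spectral_measure (trihedral n)
    (add_measure
      (scale_measure (ennreal (1 / 3)) (root_measure (real n / 2) \<Otimes>\<^sub>M root_measure (real n / 2)))
      (scale_measure (ennreal (1 / (36 * pi ^ 4)))
        (density (D_measure 3) (\<lambda>\<omega>. ennreal ((J_fun \<omega>)\<^sup>2)))))"
proof -
  define \<mu> where "\<mu> = scale_measure (ennreal (1 / 3)) (root_measure (real n / 2) \<Otimes>\<^sub>M root_measure (real n / 2))"
  define \<nu> where "\<nu> = scale_measure (ennreal (1 / (36 * pi ^ 4)))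
        (density (D_measure 3) (\<lambda>\<omega>. ennreal ((J_fun \<omega>)\<^sup>2)))"
  define S where "S = roots n \<times> roots n"
  define D where "D = D_set 3"
  \<comment> \<open>Mass of one point in the first summand: 1/3 times 1/n^2.\<close>
  define a where "a = 1 / (3 * real n ^ 2)"
  \<comment> \<open>\<open>972 = 36 * 27\<close>, from the constant in the theorem and the number of
    points of \<open>D_set 3\<close>.\<close>
  define b where "b \<omega> = (J_fun \<omega>)\<^sup>2 / (972 * pi ^ 4)" for \<omega>
  \<comment> \<open>\<open>S\<close> and \<open>D\<close> overlap, for instance in the point (1, 1);
    at common points the masses add.\<close>
  define w where "w \<omega> = (if \<omega> \<in> S then a else 0) + (if \<omega> \<in> D then b \<omega> else 0)" for \<omega>
  have fin: "finite S" "finite D" using finite_roots[OF assms] finite_D_set by (simp_all add: S_def D_def)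
  have sets: "sets \<mu> = sets torus_space" "sets \<nu> = sets torus_space"
    unfolding \<mu>_def \<nu>_def root_measure_half D_measure_def torus_space_def
    by (simp_all cong: sets_pair_measure_cong)
  have \<mu>: "emeasure \<mu> A = (\<Sum>\<omega>\<in>S. ennreal a * indicator A \<omega>)" if A: "A \<in> sets torus_space" for A
  proof -
    have "emeasure \<mu> A = ennreal (1 / 3) * (\<Sum>\<omega>\<in>S. ennreal (1 / (real n * real n)) * indicator A \<omega>)"
      using A finite_roots[OF assms] roots_subset_circle[OF assms] card_roots[OF assms]
      unfolding \<mu>_def root_measure_half torus_space_def S_def
      by (simp add: emeasure_pair_uniform_on)
    also have "\<dots> = (\<Sum>\<omega>\<in>S. ennreal a * indicator A \<omega>)"
      by (simp add: sum_distrib_left mult.assoc[symmetric] ennreal_mult[symmetric] a_def power2_eq_square)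
    finally show ?thesis .
  qed
  have \<nu>: "emeasure \<nu> A = (\<Sum>\<omega>\<in>D. ennreal (b \<omega>) * indicator A \<omega>)" if A: "A \<in> sets torus_space" for A
  proof -
    have [measurable]: "J_fun \<in> borel_measurable torus_space" by (rule J_fun_measurable)
    have [measurable]: "A \<in> sets torus_space" by (rule A)
    have "emeasure \<nu> A = ennreal (1 / (36 * pi ^ 4)) *
        (\<integral>\<^sup>+\<omega>. ennreal ((J_fun \<omega>)\<^sup>2) * indicator A \<omega> \<partial>uniform_on torus_space D)"
      unfolding \<nu>_def D_measure_def D_def
      by (simp, subst emeasure_density)
         (simp_all add: measurable_cong_sets[OF sets_uniform_on refl] A)
    also have "(\<integral>\<^sup>+\<omega>. ennreal ((J_fun \<omega>)\<^sup>2) * indicator A \<omega> \<partial>uniform_on torus_space D) =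
        (\<Sum>\<omega>\<in>D. ennreal (1 / 27) * (ennreal ((J_fun \<omega>)\<^sup>2) * indicator A \<omega>))"
      using nn_integral_uniform_on[OF fin(2) D_set_subset_torus[of 3, folded D_def],
          of "\<lambda>\<omega>. ennreal ((J_fun \<omega>)\<^sup>2) * indicator A \<omega>"]
      by (simp add: card_D_set[folded D_def])
    also have "ennreal (1 / (36 * pi ^ 4)) * \<dots> = (\<Sum>\<omega>\<in>D. ennreal (b \<omega>) * indicator A \<omega>)"
      unfolding sum_distrib_left
      by (intro sum.cong refl)
         (simp add: mult.assoc[symmetric] ennreal_mult[symmetric] b_def)
    finally show ?thesis .
  qed
  have em: "emeasure (add_measure \<mu> \<nu>) A = (\<Sum>\<omega>\<in>S \<union> D. ennreal (w \<omega>) * indicator A \<omega>)"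
    if A: "A \<in> sets torus_space" for A
  proof -
    have "(\<Sum>\<omega>\<in>S \<union> D. ennreal (w \<omega>) * indicator A \<omega>) =
        (\<Sum>\<omega>\<in>S \<union> D. ennreal (if \<omega> \<in> S then a else 0) * indicator A \<omega>) +
        (\<Sum>\<omega>\<in>S \<union> D. ennreal (if \<omega> \<in> D then b \<omega> else 0) * indicator A \<omega>)"
      unfolding sum.distrib[symmetric]
    proof (intro sum.cong refl)
      fix \<omega>
      have "ennreal (w \<omega>) = ennreal (if \<omega> \<in> S then a else 0) + ennreal (if \<omega> \<in> D then b \<omega> else 0)"
        unfolding w_def by (rule ennreal_plus) (simp_all add: a_def b_def)
      then show "ennreal (w \<omega>) * indicator A \<omega> = ennreal (if \<omega> \<in> S then a else 0) * indicator A \<omega> +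
          ennreal (if \<omega> \<in> D then b \<omega> else 0) * indicator A \<omega>"
        by (simp only: distrib_right)
    qed
    also have "(\<Sum>\<omega>\<in>S \<union> D. ennreal (if \<omega> \<in> S then a else 0) * indicator A \<omega>) = emeasure \<mu> A"
      unfolding \<mu>[OF A] using fin by (intro sum.mono_neutral_cong_right) auto
    also have "(\<Sum>\<omega>\<in>S \<union> D. ennreal (if \<omega> \<in> D then b \<omega> else 0) * indicator A \<omega>) = emeasure \<nu> A"
      unfolding \<nu>[OF A] using fin by (intro sum.mono_neutral_cong_right) auto
    finally show ?thesis using emeasure_add_measure[of \<nu> \<mu> A] sets A by simp
  qed
  have sets_add: "sets (add_measure \<mu> \<nu>) = sets torus_space"
  proof -
    have "sets (add_measure \<mu> \<nu>) = sets \<mu>" by (simp add: add_measure_def)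
    then show ?thesis using sets by simp
  qed
  have "has_bochner_integral (add_measure \<mu> \<nu>) (R_fun m1 m2) (McKay_moment (trihedral n) m1 m2)" for m1 m2
  proof -
    have "has_bochner_integral (add_measure \<mu> \<nu>) (R_fun m1 m2) (\<Sum>\<omega>\<in>S \<union> D. w \<omega> *\<^sub>R R_fun m1 m2 \<omega>)"
    proof (rule has_bochner_integral_finite_support)
      show "S \<union> D \<subseteq> space (add_measure \<mu> \<nu>)"
        using roots_subset_circle[OF assms] D_set_subset_torus[of 3] sets_eq_imp_space_eq[OF sets_add]
        by (auto simp: S_def D_def torus_space_def space_pair_measure)
      show "R_fun m1 m2 \<in> borel_measurable (add_measure \<mu> \<nu>)"
        using R_fun_measurable measurable_cong_sets[OF sets_add refl] by blast
    qed (use fin em sets_add in \<open>auto simp: w_def a_def b_def\<close>)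
    moreover have "(\<Sum>\<omega>\<in>S \<union> D. w \<omega> *\<^sub>R R_fun m1 m2 \<omega>) = McKay_moment (trihedral n) m1 m2"
    proof -
      have "(\<Sum>\<omega>\<in>S \<union> D. w \<omega> *\<^sub>R R_fun m1 m2 \<omega>) =
          (\<Sum>\<omega>\<in>S \<union> D. (if \<omega> \<in> S then a else 0) *\<^sub>R R_fun m1 m2 \<omega>) +
          (\<Sum>\<omega>\<in>S \<union> D. (if \<omega> \<in> D then b \<omega> else 0) *\<^sub>R R_fun m1 m2 \<omega>)"
        by (simp add: w_def scaleR_add_left sum.distrib)
      also have "(\<Sum>\<omega>\<in>S \<union> D. (if \<omega> \<in> S then a else 0) *\<^sub>R R_fun m1 m2 \<omega>) =
          (\<Sum>\<omega>\<in>S. R_fun m1 m2 \<omega> / (3 * of_nat n ^ 2))"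
        using fin by (intro sum.mono_neutral_cong_right) (auto simp: a_def scaleR_conv_of_real)
      also have "(\<Sum>\<omega>\<in>S \<union> D. (if \<omega> \<in> D then b \<omega> else 0) *\<^sub>R R_fun m1 m2 \<omega>) =
          (\<Sum>\<omega>\<in>D. (1 / (972 * pi ^ 4)) *\<^sub>R ((J_fun \<omega>)\<^sup>2 *\<^sub>R R_fun m1 m2 \<omega>))"
        using fin by (intro sum.mono_neutral_cong_right) (auto simp: b_def)
      also have "\<dots> = (1 / (972 * pi ^ 4)) *\<^sub>R (\<Sum>\<omega>\<in>D. (J_fun \<omega>)\<^sup>2 *\<^sub>R R_fun m1 m2 \<omega>)"
        by (rule scaleR_sum_right[symmetric])
      \<comment> \<open>\<open>648 / 972 = 2 / 3\<close>, the share of the group elements with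
        \<open>k\<close> equal to 1 or 2.\<close>
      also have "\<dots> = (if m1 = 0 \<and> m2 = 0 then 2 / 3 else 0)"
        unfolding D_def sum_D_set by (simp add: scaleR_conv_of_real)
      finally show ?thesis by (simp add: McKay_moment_trihedral[OF assms] S_def)
    qed
    ultimately show ?thesis by simp
  qed
  then show ?thesis using sets_add unfolding spectral_measure_def \<mu>_def \<nu>_def by blast
qed

end
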